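(* Let $m\ge 1$, let $D\subset\mathbb R^{2m+1}$ be an open set, let $1<p\le\infty$, and let $u\in C(D)$. The asymptotic mean value formula $$u(X,Y,t)=\mathcal M_\epsilon u(X,Y,t)+o(\epsilon^2)\quad\text{as }\epsilon\to0,$$ where \begin{align*} \mathcal M_\epsilon u(X,Y,t)&=\frac{\alpha}{2}\Big\{\sup_{\tilde X\in B_\epsilon(X)}u\big(\tilde X,Y+\tfrac{\epsilon^2}{2}\tilde X,t-\tfrac{\epsilon^2}{2}\big)+\inf_{\tilde X\in B_\epsilon(X)}u\big(\tilde X,Y+\tfrac{\epsilon^2}{2}\tilde X,t-\tfrac{\epsilon^2}{2}\big)\Big\}\\ &\quad+\frac{\beta}{|B_\epsilon(X)|}\int_{B_\epsilon(X)}u\big(\tilde X,Y+\tfrac{\epsilon^2}{2}\tilde X,t-\tfrac{\epsilon^2}{2}\big)\,d\tilde X, \end{align*} holds for every $(X,Y,t)\in D$ in the viscosity sense if and only if $u$ is a viscosity solution to $\mathcal K_p u=0$ in $D$.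
   Context: Points of $\mathbb R^{2m+1}$ are written $(X,Y,t)\in\mathbb R^m\times\mathbb R^m\times\mathbb R$. $B_r(\cdot)$ denotes an open Euclidean ball in $\mathbb R^m$. The constants are $\alpha=1,\beta=0$ if $p=\infty$, and $\alpha=\frac{p-2}{m+p},\ \beta=\frac{m+2}{m+p}$ if $p<\infty$. Operators. $\nabla_X,\nabla_Y$ are gradients in $X$ and $Y$, $\nabla_X^2\phi$ is the Hessian in the $X$ variables, $\Delta_X$ the Laplacian in $X$, and, where $\nabla_X\phi\ne0$, $\Delta^N_{\infty,X}\phi=|\nabla_X\phi|^{-2}\langle\nabla_X^2\phi\,\nabla_X\phi,\nabla_X\phi\rangle$. For $1<p<\infty$, $\mathcal K_pu=((p-2)\Delta^N_{\infty,X}+\Delta_X)u+(m+p)(X\cdot\nabla_Yu-\partial_tu)$; and $\mathcal K_\infty u=\Delta^N_{\infty,X}u+X\cdot\nabla_Yu-\partial_tu$. For a symmetric matrix $A$, $\lambda(A)$ and $\Lambda(A)$ are its smallest and largest eigenvalues. Touching. $\phi\in C^2(D)$ touches $u$ from below (resp. above) at $(\hat X,\hat Y,\hat t)\in D$ if $u=\phi$ at $(\hat X,\hat Y,\hat t)$ and $u>\phi$ (resp. $u<\phi$) at all other points of $D$. Viscosity solutions. For $1<p<\infty$, a lower semicontinuous $u$ on $D$ is a viscosity supersolution to $\mathcal K_pu=0$ in $D$ if whenever $\phi\in C^2(D)$ touches $u$ from below at $(\hat X,\hat Y,\hat t)\in D$, then at that point $(m+p)(\partial_t\phi-\hat X\cdot\nabla_Y\phi)\ge((p-2)\Delta^N_{\infty,X}+\Delta_X)\phi$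 if $\nabla_X\phi\ne0$, and $(m+p)(\partial_t\phi-\hat X\cdot\nabla_Y\phi)\ge\lambda((p-2)\nabla_X^2\phi)+\Delta_X\phi$ if $\nabla_X\phi=0$. An upper semicontinuous $u$ is a viscosity subsolution if whenever $\phi\in C^2(D)$ touches $u$ from above at $(\hat X,\hat Y,\hat t)\in D$, then at that point $(m+p)(\partial_t\phi-\hat X\cdot\nabla_Y\phi)\le((p-2)\Delta^N_{\infty,X}+\Delta_X)\phi$ if $\nabla_X\phi\ne0$, and $(m+p)(\partial_t\phi-\hat X\cdot\nabla_Y\phi)\le\Lambda((p-2)\nabla_X^2\phi)+\Delta_X\phi$ if $\nabla_X\phi=0$. For $p=\infty$ the same definitions are used with the left sides replaced by $\partial_t\phi-\hat X\cdot\nabla_Y\phi$ and the right sides by $\Delta^N_{\infty,X}\phi$ if $\nabla_X\phi\neq0$, and by $\lambda(\nabla_X^2\phi)$ (supersolution), $\Lambda(\nabla_X^2\phi)$ (subsolution) if $\nabla_X\phi=0$. $u\in C(D)$ is a viscosity solution if it is both a super- and a subsolution. Mean value formula in the viscosity sense. $u\in C(D)$ satisfies $u=\mathcal M_\epsilon u+o(\epsilon^2)$ in the viscosity sense at $(X,Y,t)\in D$ if: for every $\phi\in C^2(D)$ touching $u$ from below at $(X,Y,t)$ such that either $\nabla_X\phi(X,Y,t)\ne0$, or both $\nabla_X\phi(X,Y,t)=0$ and $\nabla_X^2\phi(X,Y,t)=0$, one has $\phi(X,Y,t)\ge\mathcal M_\epsilon\phi(X,Y,t)+o(\epsilon^2)$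 as $\epsilon\to0$; and for every $\phi\in C^2(D)$ touching $u$ from above at $(X,Y,t)$ with the same alternative for its derivatives, one has $\phi(X,Y,t)\le\mathcal M_\epsilon\phi(X,Y,t)+o(\epsilon^2)$ as $\epsilon\to0$. *)

theory Defs
  imports "HOL-Analysis.Analysis" "HOL-Library.Landau_Symbols"
begin

text \<open>
  The ambient space of points \<open>(X, Y, t)\<close>; the dimension \<open>m\<close> is \<open>CARD('m)\<close>. Functions on a
  set \<open>D\<close> are total functions whose values outside \<open>D\<close> are irrelevant.
\<close>

type_synonym 'm pt = "(real ^ 'm) \<times> (real ^ 'm) \<times> real"

section \<open>Regularity and derivatives\<close>

text \<open>For open \<open>D\<close>: twice Frechet differentiable in all variables, with continuous second
  derivative.\<close>

definition C2_on :: "'a::real_normed_vector set \<Rightarrow> ('a \<Rightarrow> real) \<Rightarrow> bool" where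
  "C2_on D f \<longleftrightarrow>
     (\<exists>(f' :: 'a \<Rightarrow> ('a \<Rightarrow>\<^sub>L real)) (f'' :: 'a \<Rightarrow> ('a \<Rightarrow>\<^sub>L ('a \<Rightarrow>\<^sub>L real))).
        (\<forall>x\<in>D. (f has_derivative blinfun_apply (f' x)) (at x)) \<and>
        (\<forall>x\<in>D. (f' has_derivative blinfun_apply (f'' x)) (at x)) \<and>
        continuous_on D f'')"

definition lower_semicontinuous_on :: "'a::topological_space set \<Rightarrow> ('a \<Rightarrow> real) \<Rightarrow> bool" where
  "lower_semicontinuous_on D u \<longleftrightarrow> (\<forall>a. openin (top_of_set D) {x \<in> D. u x > a})"

definition upper_semicontinuous_on :: "'a::topological_space set \<Rightarrow> ('a \<Rightarrow> real) \<Rightarrow> bool" where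
  "upper_semicontinuous_on D u \<longleftrightarrow> (\<forall>a. openin (top_of_set D) {x \<in> D. u x < a})"

definition grad :: "(real ^ 'm \<Rightarrow> real) \<Rightarrow> real ^ 'm \<Rightarrow> real ^ 'm" where
  "grad f x = (\<chi> i. frechet_derivative f (at x) (axis i 1))"

fun grad_X :: "('m::finite pt \<Rightarrow> real) \<Rightarrow> 'm pt \<Rightarrow> real ^ 'm" where
  "grad_X \<phi> (X, Y, t) = grad (\<lambda>X'. \<phi> (X', Y, t)) X"

fun grad_Y :: "('m::finite pt \<Rightarrow> real) \<Rightarrow> 'm pt \<Rightarrow> real ^ 'm" where
  "grad_Y \<phi> (X, Y, t) = grad (\<lambda>Y'. \<phi> (X, Y', t)) Y"

fun deriv_t :: "('m::finite pt \<Rightarrow> real) \<Rightarrow> 'm pt \<Rightarrow> real" where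
  "deriv_t \<phi> (X, Y, t) = deriv (\<lambda>s. \<phi> (X, Y, s)) t"

fun hess_X :: "('m::finite pt \<Rightarrow> real) \<Rightarrow> 'm pt \<Rightarrow> real ^ 'm ^ 'm" where
  "hess_X \<phi> (X, Y, t) = matrix (frechet_derivative (\<lambda>X'. grad_X \<phi> (X', Y, t)) (at X))"

definition laplace_X :: "('m::finite pt \<Rightarrow> real) \<Rightarrow> 'm pt \<Rightarrow> real" where
  "laplace_X \<phi> z = trace (hess_X \<phi> z)"

text \<open>The normalized infinity Laplacian; only used where \<open>grad_X \<phi> z \<noteq> 0\<close>.\<close>

definition inf_laplace_X :: "('m::finite pt \<Rightarrow> real) \<Rightarrow> 'm pt \<Rightarrow> real" where
  "inf_laplace_X \<phi> z = ((hess_X \<phi> z *v grad_X \<phi> z) \<bullet> grad_X \<phi> z) / (norm (grad_X \<phi> z))\<^sup>2"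

definition transport :: "('m::finite pt \<Rightarrow> real) \<Rightarrow> 'm pt \<Rightarrow> real" where
  "transport \<phi> z = deriv_t \<phi> z - fst z \<bullet> grad_Y \<phi> z"

definition is_eigenvalue :: "real ^ 'm ^ 'm \<Rightarrow> real \<Rightarrow> bool" where
  "is_eigenvalue A c \<longleftrightarrow> (\<exists>v. v \<noteq> 0 \<and> A *v v = c *\<^sub>R v)"

definition min_eigenvalue :: "real ^ 'm ^ 'm \<Rightarrow> real" where
  "min_eigenvalue A = (LEAST c. is_eigenvalue A c)"

definition max_eigenvalue :: "real ^ 'm ^ 'm \<Rightarrow> real" where
  "max_eigenvalue A = (GREATEST c. is_eigenvalue A c)"

section \<open>Viscosity solutions\<close>

definition touches_below :: "'a set \<Rightarrow> ('a \<Rightarrow> real) \<Rightarrow> ('a \<Rightarrow> real) \<Rightarrow> 'a \<Rightarrow> bool" where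
  "touches_below D \<phi> u z \<longleftrightarrow> z \<in> D \<and> u z = \<phi> z \<and> (\<forall>w\<in>D - {z}. u w > \<phi> w)"

definition touches_above :: "'a set \<Rightarrow> ('a \<Rightarrow> real) \<Rightarrow> ('a \<Rightarrow> real) \<Rightarrow> 'a \<Rightarrow> bool" where
  "touches_above D \<phi> u z \<longleftrightarrow> z \<in> D \<and> u z = \<phi> z \<and> (\<forall>w\<in>D - {z}. u w < \<phi> w)"

text \<open>The exponent \<open>p\<close> is an extended real, to include \<open>p = \<infinity>\<close>.\<close>

definition supersolution_ineq :: "ereal \<Rightarrow> ('m::finite pt \<Rightarrow> real) \<Rightarrow> 'm pt \<Rightarrow> bool" where
  "supersolution_ineq p \<phi> z \<longleftrightarrow>
     (if p = \<infinity> then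
        (if grad_X \<phi> z \<noteq> 0 then transport \<phi> z \<ge> inf_laplace_X \<phi> z
         else transport \<phi> z \<ge> min_eigenvalue (hess_X \<phi> z))
      else
        (let q = real_of_ereal p; m = real CARD('m) in
         if grad_X \<phi> z \<noteq> 0
         then (m + q) * transport \<phi> z \<ge> (q - 2) * inf_laplace_X \<phi> z + laplace_X \<phi> z
         else (m + q) * transport \<phi> z \<ge> min_eigenvalue ((q - 2) *\<^sub>R hess_X \<phi> z) + laplace_X \<phi> z))"

definition subsolution_ineq :: "ereal \<Rightarrow> ('m::finite pt \<Rightarrow> real) \<Rightarrow> 'm pt \<Rightarrow> bool" where
  "subsolution_ineq p \<phi> z \<longleftrightarrow>
     (if p = \<infinity> then
        (if grad_X \<phi> z \<noteq> 0 then transport \<phi> z \<le> inf_laplace_X \<phi> z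
         else transport \<phi> z \<le> max_eigenvalue (hess_X \<phi> z))
      else
        (let q = real_of_ereal p; m = real CARD('m) in
         if grad_X \<phi> z \<noteq> 0
         then (m + q) * transport \<phi> z \<le> (q - 2) * inf_laplace_X \<phi> z + laplace_X \<phi> z
         else (m + q) * transport \<phi> z \<le> max_eigenvalue ((q - 2) *\<^sub>R hess_X \<phi> z) + laplace_X \<phi> z))"

definition viscosity_supersolution :: "ereal \<Rightarrow> 'm::finite pt set \<Rightarrow> ('m pt \<Rightarrow> real) \<Rightarrow> bool" where
  "viscosity_supersolution p D u \<longleftrightarrow>
     lower_semicontinuous_on D u \<and>
     (\<forall>\<phi> z. C2_on D \<phi> \<longrightarrow> touches_below D \<phi> u z \<longrightarrow> supersolution_ineq p \<phi> z)"

definition viscosity_subsolution :: "ereal \<Rightarrow> 'm::finite pt set \<Rightarrow> ('m pt \<Rightarrow> real) \<Rightarrow> bool" where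
  "viscosity_subsolution p D u \<longleftrightarrow>
     upper_semicontinuous_on D u \<and>
     (\<forall>\<phi> z. C2_on D \<phi> \<longrightarrow> touches_above D \<phi> u z \<longrightarrow> subsolution_ineq p \<phi> z)"

definition viscosity_solution :: "ereal \<Rightarrow> 'm::finite pt set \<Rightarrow> ('m pt \<Rightarrow> real) \<Rightarrow> bool" where
  "viscosity_solution p D u \<longleftrightarrow>
     continuous_on D u \<and> viscosity_supersolution p D u \<and> viscosity_subsolution p D u"

section \<open>The mean value formula\<close>

definition alpha :: "nat \<Rightarrow> ereal \<Rightarrow> real" where
  "alpha m p = (if p = \<infinity> then 1 else (real_of_ereal p - 2) / (real m + real_of_ereal p))"

definition beta :: "nat \<Rightarrow> ereal \<Rightarrow> real" where
  "beta m p = (if p = \<infinity> then 0 else (real m + 2) / (real m + real_of_ereal p))"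

text \<open>For \<open>z \<in> D\<close>, \<open>D\<close> open, and small \<open>\<epsilon> > 0\<close> only values of \<open>w\<close> on \<open>D\<close> enter; for \<open>w\<close>
  continuous on \<open>D\<close> they are then bounded, so that the real-valued \<open>SUP\<close>, \<open>INF\<close> and the
  integral are the genuine ones.\<close>

fun mean_value_op :: "ereal \<Rightarrow> real \<Rightarrow> ('m::finite pt \<Rightarrow> real) \<Rightarrow> 'm pt \<Rightarrow> real" where
  "mean_value_op p \<epsilon> w (X, Y, t) =
     alpha CARD('m) p / 2 *
       ((SUP X'\<in>ball X \<epsilon>. w (X', Y + (\<epsilon>\<^sup>2 / 2) *\<^sub>R X', t - \<epsilon>\<^sup>2 / 2)) +
        (INF X'\<in>ball X \<epsilon>. w (X', Y + (\<epsilon>\<^sup>2 / 2) *\<^sub>R X', t - \<epsilon>\<^sup>2 / 2))) +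
     beta CARD('m) p / measure lborel (ball X \<epsilon>) *
       (LINT X':ball X \<epsilon>|lborel. w (X', Y + (\<epsilon>\<^sup>2 / 2) *\<^sub>R X', t - \<epsilon>\<^sup>2 / 2))"

definition admissible_test :: "('m::finite pt \<Rightarrow> real) \<Rightarrow> 'm pt \<Rightarrow> bool" where
  "admissible_test \<phi> z \<longleftrightarrow> grad_X \<phi> z \<noteq> 0 \<or> (grad_X \<phi> z = 0 \<and> hess_X \<phi> z = 0)"

text \<open>An inequality \<open>a \<ge> b(\<epsilon>) + o(\<epsilon>\<^sup>2)\<close> as \<open>\<epsilon> \<rightarrow> 0\<close> means that it holds for all
  small \<open>\<epsilon> > 0\<close> with some error term \<open>r(\<epsilon>)\<close> in the class \<open>o(\<epsilon>\<^sup>2)\<close>.\<close>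

definition mean_value_viscosity_at ::
  "ereal \<Rightarrow> 'm::finite pt set \<Rightarrow> ('m pt \<Rightarrow> real) \<Rightarrow> 'm pt \<Rightarrow> bool" where
  "mean_value_viscosity_at p D u z \<longleftrightarrow>
     (\<forall>\<phi>. C2_on D \<phi> \<longrightarrow> touches_below D \<phi> u z \<longrightarrow> admissible_test \<phi> z \<longrightarrow>
        (\<exists>r. r \<in> o[at_right 0](\<lambda>\<epsilon>::real. \<epsilon>\<^sup>2) \<and>
             (\<forall>\<^sub>F \<epsilon> in at_right 0. \<phi> z \<ge> mean_value_op p \<epsilon> \<phi> z + r \<epsilon>))) \<and>
     (\<forall>\<phi>. C2_on D \<phi> \<longrightarrow> touches_above D \<phi> u z \<longrightarrow> admissible_test \<phi> z \<longrightarrow>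
        (\<exists>r. r \<in> o[at_right 0](\<lambda>\<epsilon>::real. \<epsilon>\<^sup>2) \<and>
             (\<forall>\<^sub>F \<epsilon> in at_right 0. \<phi> z \<le> mean_value_op p \<epsilon> \<phi> z + r \<epsilon>)))"

end

theory Submission
  imports Defs
begin

text \<open>
  For a \<open>C\<^sup>2\<close> function \<open>\<phi>\<close> with \<open>\<nabla>\<^sub>X \<phi> \<noteq> 0\<close> at \<open>z\<close>, Taylor expansion gives
  \<open>M\<^sub>\<epsilon> \<phi> z = \<phi> z + \<epsilon>\<^sup>2/2 (\<alpha> \<Delta>\<^sub>\<infinity> \<phi> + \<beta>/(m+2) \<Delta> \<phi> - (\<partial>\<^sub>t \<phi> - X \<bullet> \<nabla>\<^sub>Y \<phi>)) + o(\<epsilon>\<^sup>2)\<close>: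
  half the sum of supremum and infimum over the ball sees the Hessian in the gradient direction
  (\<open>midrange_ball_expansion\<close>), the average sees its trace divided by \<open>m + 2\<close>
  (\<open>average_ball_expansion\<close>), and the shift of \<open>(Y, t)\<close> by \<open>O(\<epsilon>\<^sup>2)\<close> produces the transport term
  (\<open>kinetic_shift_expansion\<close>). The same formula holds, without second order terms, if gradient and Hessian in \<open>X\<close> both
  vanish. So for admissible test functions the asymptotic mean value inequality is equivalent to the
  differential inequality (\<open>mean_value_inequality_iff\<close>), and a viscosity solution satisfies the mean value formula.

  For the converse the differential inequality is also needed for test functions with vanishing gradient and
  nonzero Hessian, about which the mean value formula says nothing. The lemma
  \<open>degenerate_supersolution_inequality\<close> derives it from the admissible ones. Near the contact point the test function is
  replaced by a quadratic minorant, its \<open>X\<close> argument is shifted by a vector \<open>h\<close>, and the resulting difference with \<open>u\<close>,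
  penalized by \<open>j |h|\<^sup>4\<close>, is minimized. Either the minimizing shift is nonzero and the shifted quadratic touches \<open>u\<close> with
  nonzero gradient, or it is zero and \<open>u\<close> is touched by a function whose \<open>X\<close> gradient and \<open>X\<close> Hessian vanish. The
  local test functions so obtained are extended to \<open>D\<close> by gluing them to the original one
  (\<open>global_test_function\<close>).

  Statements about contact from above follow by replacing \<open>u\<close> with \<open>- u\<close>.
\<close>

section \<open>Calculus of twice continuously differentiable functions\<close>

lemma C2_on_const: "C2_on D (\<lambda>_. c)"
  unfolding C2_on_def
  by (rule exI[of _ "\<lambda>_. 0"], rule exI[of _ "\<lambda>_. 0"]) (auto intro!: derivative_eq_intros)

lemma C2_on_bounded_linear:
  assumes "bounded_linear f"
  shows "C2_on D f"
  unfolding C2_on_def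
  by (rule exI[of _ "\<lambda>_. Blinfun f"], rule exI[of _ "\<lambda>_. 0"])
     (auto intro!: derivative_eq_intros bounded_linear_imp_has_derivative assms
        simp: bounded_linear_Blinfun_apply[OF assms])

lemma C2_on_add:
  assumes "C2_on D f" "C2_on D g"
  shows "C2_on D (\<lambda>x. f x + g x)"
proof -
  from assms(1) obtain f' f'' where f: "\<forall>x\<in>D. (f has_derivative blinfun_apply (f' x)) (at x)"
    "\<forall>x\<in>D. (f' has_derivative blinfun_apply (f'' x)) (at x)" "continuous_on D f''"
    unfolding C2_on_def by blast
  from assms(2) obtain g' g'' where g: "\<forall>x\<in>D. (g has_derivative blinfun_apply (g' x)) (at x)"
    "\<forall>x\<in>D. (g' has_derivative blinfun_apply (g'' x)) (at x)" "continuous_on D g''"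
    unfolding C2_on_def by blast
  show ?thesis
    unfolding C2_on_def
    by (rule exI[of _ "\<lambda>x. f' x + g' x"], rule exI[of _ "\<lambda>x. f'' x + g'' x"])
       (use f g in \<open>auto intro!: derivative_eq_intros continuous_intros simp: blinfun.add_left\<close>)
qed

lemma C2_on_mult:
  assumes "C2_on D f" "C2_on D g"
  shows "C2_on D (\<lambda>x. f x * g x)"
proof -
  from assms(1) obtain f' f'' where f: "\<forall>x\<in>D. (f has_derivative blinfun_apply (f' x)) (at x)"
    "\<forall>x\<in>D. (f' has_derivative blinfun_apply (f'' x)) (at x)" "continuous_on D f''"
    unfolding C2_on_def by blast
  from assms(2) obtain g' g'' where g: "\<forall>x\<in>D. (g has_derivative blinfun_apply (g' x)) (at x)"
    "\<forall>x\<in>D. (g' has_derivative blinfun_apply (g'' x)) (at x)" "continuous_on D g''"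
    unfolding C2_on_def by blast
  have cont: "continuous_on D f" "continuous_on D g" "continuous_on D f'" "continuous_on D g'"
    using f g by (auto intro!: continuous_at_imp_continuous_on dest!: bspec has_derivative_continuous)
  show ?thesis
    unfolding C2_on_def
  proof (rule exI[of _ "\<lambda>x. f x *\<^sub>R g' x + g x *\<^sub>R f' x"],
      rule exI[of _ "\<lambda>x. f x *\<^sub>R g'' x + (blinfun_scaleR_left (g' x) o\<^sub>L f' x)
         + (g x *\<^sub>R f'' x + (blinfun_scaleR_left (f' x) o\<^sub>L g' x))"], intro conjI ballI)
    show "continuous_on D (\<lambda>x. f x *\<^sub>R g'' x + (blinfun_scaleR_left (g' x) o\<^sub>L f' x)
         + (g x *\<^sub>R f'' x + (blinfun_scaleR_left (f' x) o\<^sub>L g' x)))"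
      using f g cont
      by (intro continuous_intros bounded_linear.continuous_on[OF bounded_linear_blinfun_scaleR_left]) auto
  qed (use f g in \<open>auto intro!: derivative_eq_intros ext simp: blinfun.add_left blinfun.scaleR_left algebra_simps\<close>)
qed

lemma C2_on_compose:
  assumes "C2_on D f"
    and F: "\<And>s. (F has_real_derivative F' s) (at s)" "\<And>s. (F' has_real_derivative F'' s) (at s)"
      "continuous_on UNIV F''"
  shows "C2_on D (\<lambda>x. F (f x))"
proof -
  from assms(1) obtain f' f'' where f: "\<forall>x\<in>D. (f has_derivative blinfun_apply (f' x)) (at x)"
    "\<forall>x\<in>D. (f' has_derivative blinfun_apply (f'' x)) (at x)" "continuous_on D f''"
    unfolding C2_on_def by blast
  have cont: "continuous_on D f" "continuous_on D f'"
    using f by (auto intro!: continuous_at_imp_continuous_on dest!: bspec has_derivative_continuous)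
  have dF: "((\<lambda>x. F (f x)) has_derivative (\<lambda>h. F' (f x) * f' x h)) (at x)"
    "((\<lambda>x. F' (f x)) has_derivative (\<lambda>h. F'' (f x) * f' x h)) (at x)" if "x \<in> D" for x
    using has_derivative_compose[OF f(1)[rule_format, OF that] F(1)[unfolded has_field_derivative_def]]
      has_derivative_compose[OF f(1)[rule_format, OF that] F(2)[unfolded has_field_derivative_def]]
    by auto
  have contF: "continuous_on D (\<lambda>x. F' (f x))" "continuous_on D (\<lambda>x. F'' (f x))"
    using continuous_at_imp_continuous_on has_derivative_continuous[OF dF(2)]
      continuous_on_compose2[OF F(3) cont(1)] by auto
  show ?thesis
    unfolding C2_on_def
  proof (rule exI[of _ "\<lambda>x. F' (f x) *\<^sub>R f' x"],
      rule exI[of _ "\<lambda>x. F' (f x) *\<^sub>R f'' x + (blinfun_scaleR_left (f' x) o\<^sub>L (F'' (f x) *\<^sub>R f' x))"],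
      intro conjI ballI)
    show "continuous_on D (\<lambda>x. F' (f x) *\<^sub>R f'' x + (blinfun_scaleR_left (f' x) o\<^sub>L (F'' (f x) *\<^sub>R f' x)))"
      using f cont contF
      by (intro continuous_intros bounded_linear.continuous_on[OF bounded_linear_blinfun_scaleR_left]) auto
    fix x assume x: "x \<in> D"
    show "((\<lambda>x. F (f x)) has_derivative blinfun_apply (F' (f x) *\<^sub>R f' x)) (at x)"
      by (rule has_derivative_eq_rhs[OF dF(1)[OF x]]) (auto simp: blinfun.scaleR_left)
    show "((\<lambda>x. F' (f x) *\<^sub>R f' x) has_derivative
          blinfun_apply (F' (f x) *\<^sub>R f'' x + (blinfun_scaleR_left (f' x) o\<^sub>L (F'' (f x) *\<^sub>R f' x)))) (at x)"
      using f(2) x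
      by (auto intro!: derivative_eq_intros dF(2) simp: blinfun.add_left blinfun.scaleR_left algebra_simps)
  qed
qed

lemma C2_on_cmult: "C2_on D f \<Longrightarrow> C2_on D (\<lambda>x. c * f x)"
  by (intro C2_on_mult C2_on_const)

lemma C2_on_minus: "C2_on D f \<Longrightarrow> C2_on D (\<lambda>x. - f x)"
  using C2_on_cmult[of D f "-1"] by simp

lemma C2_on_diff: "C2_on D f \<Longrightarrow> C2_on D g \<Longrightarrow> C2_on D (\<lambda>x. f x - g x)"
  using C2_on_add[OF _ C2_on_minus, of D f g] by simp

lemma C2_on_sum: "(\<And>i. i \<in> I \<Longrightarrow> C2_on D (f i)) \<Longrightarrow> C2_on D (\<lambda>x. \<Sum>i\<in>I. f i x)"
  by (induction I rule: infinite_finite_induct) (auto intro: C2_on_const C2_on_add)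

lemma C2_on_inner:
  fixes L M :: "'a::real_normed_vector \<Rightarrow> 'b::euclidean_space"
  assumes "\<And>b. b \<in> Basis \<Longrightarrow> C2_on D (\<lambda>x. L x \<bullet> b)" "\<And>b. b \<in> Basis \<Longrightarrow> C2_on D (\<lambda>x. M x \<bullet> b)"
  shows "C2_on D (\<lambda>x. L x \<bullet> M x)"
proof -
  have "(\<lambda>x. L x \<bullet> M x) = (\<lambda>x. \<Sum>b\<in>Basis. (L x \<bullet> b) * (M x \<bullet> b))"
    by (rule ext) (rule euclidean_inner)
  then show ?thesis by (simp only:) (intro C2_on_sum C2_on_mult assms)
qed

text \<open>
  The cube is the lowest power whose truncation at zero is still \<open>C\<^sup>2\<close>. It yields compactly supported
  cut-off functions from polynomials.
\<close>
lemma C2_on_cutoff: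
  assumes "C2_on D f"
  shows "C2_on D (\<lambda>x. (max 0 (f x)) ^ 3)"
proof (rule C2_on_compose[where F = "\<lambda>s. (max 0 s) ^ 3" and F' = "\<lambda>s. 3 * (max 0 s)\<^sup>2" and F'' = "\<lambda>s. 6 * max 0 s", OF assms])
  have *: "((\<lambda>s::real. max 0 s ^ Suc (Suc n)) has_real_derivative real (n+2) * max 0 s ^ Suc n) (at s)" for s n
  proof -
    consider "s > 0" | "s < 0" | "s = 0" by linarith
    then show ?thesis
    proof cases
      case 1
      have "((\<lambda>s. s ^ Suc (Suc n)) has_real_derivative real (n+2) * s ^ Suc n) (at s)"
        by (rule derivative_eq_intros refl)+ (simp add: algebra_simps)
      then have "((\<lambda>s. max 0 s ^ Suc (Suc n)) has_real_derivative real (n+2) * s ^ Suc n) (at s)"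
        by (rule has_field_derivative_transform_within_open[where S="{0<..}"]) (use 1 in auto)
      then show ?thesis using 1 by simp
    next
      case 2
      have "((\<lambda>s. 0) has_real_derivative 0) (at s)" by simp
      then have "((\<lambda>s. max 0 s ^ Suc (Suc n)) has_real_derivative 0) (at s)"
        by (rule has_field_derivative_transform_within_open[where S="{..<0}"]) (use 2 in auto)
      then show ?thesis using 2 by simp
    next
      case 3
      have "(\<lambda>h::real. (max 0 (0+h) ^ Suc (Suc n) - max 0 0 ^ Suc (Suc n)) / h) \<midarrow>0\<rightarrow> 0"
      proof (rule Lim_null_comparison[where g = "\<lambda>h. \<bar>h\<bar> ^ Suc n"])
        show "\<forall>\<^sub>F h in at 0. norm ((max 0 (0+h) ^ Suc (Suc n) - max 0 0 ^ Suc (Suc n)) / h) \<le> \<bar>h\<bar> ^ Suc n"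
        proof (intro always_eventually allI)
          fix h :: real
          show "norm ((max 0 (0+h) ^ Suc (Suc n) - max 0 0 ^ Suc (Suc n)) / h) \<le> \<bar>h\<bar> ^ Suc n"
            by (cases "h > 0") (simp_all add: max_def mult_nonpos_nonneg)
        qed
        show "(\<lambda>h::real. \<bar>h\<bar> ^ Suc n) \<midarrow>0\<rightarrow> 0" by (auto intro!: tendsto_eq_intros)
      qed
      then show ?thesis using 3 by (simp add: DERIV_def)
    qed
  qed
  show "((\<lambda>s::real. max 0 s ^ 3) has_real_derivative 3 * (max 0 s)\<^sup>2) (at s)" for s
    using *[of 1 s] by (simp add: numeral_eq_Suc)
  show "((\<lambda>s::real. 3 * (max 0 s)\<^sup>2) has_real_derivative 6 * max 0 s) (at s)" for s
    using DERIV_cmult[OF *[of 0 s], of 3] by (simp add: numeral_eq_Suc)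
qed (intro continuous_intros)

section \<open>Second order Taylor expansion and symmetry of the second derivative\<close>

lemma has_real_derivative_along_line:
  assumes "(f has_derivative blinfun_apply f') (at (a + \<tau> *\<^sub>R v))"
  shows "((\<lambda>\<tau>. f (a + \<tau> *\<^sub>R v)) has_real_derivative f' v) (at \<tau>)"
proof -
  have "((\<lambda>\<tau>. f (a + \<tau> *\<^sub>R v)) has_derivative (\<lambda>h. f' (h *\<^sub>R v))) (at \<tau>)"
    by (rule has_derivative_compose[where f = "\<lambda>\<tau>. a + \<tau> *\<^sub>R v" and g = f, OF _ assms])
       (auto intro!: derivative_eq_intros)
  moreover have "(\<lambda>h. f' (h *\<^sub>R v)) = (*) (f' v)" by (auto simp: blinfun.scaleR_right)
  ultimately show ?thesis by (simp only: has_field_derivative_def)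
qed

text \<open>
  The mean value theorem, applied on the
  segment from \<open>z\<close> to \<open>z + v\<close> to \<open>f\<close> minus its second order Taylor polynomial, reduces the claim to the first order
  expansion of \<open>f'\<close>.
\<close>
lemma second_order_taylor:
  fixes f :: "'a::real_normed_vector \<Rightarrow> real"
  assumes "open D" "z \<in> D" "0 < \<eta>"
    and f: "\<And>x. x \<in> D \<Longrightarrow> (f has_derivative blinfun_apply (f' x)) (at x)"
    and f': "(f' has_derivative blinfun_apply f'') (at z)"
  shows "\<exists>\<delta>>0. \<forall>v. norm v < \<delta> \<longrightarrow> \<bar>f (z + v) - f z - f' z v - f'' v v / 2\<bar> \<le> \<eta> * (norm v)\<^sup>2"
proof -
  obtain d where d: "d > 0" "\<And>y. norm (y - z) < d \<Longrightarrow> norm (f' y - f' z - f'' (y - z)) \<le> \<eta> * norm (y - z)"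
    using f' \<open>0 < \<eta>\<close> unfolding has_derivative_at_alt by blast
  obtain e where e: "e > 0" "ball z e \<subseteq> D" using assms open_contains_ball by blast
  have "\<bar>f (z + v) - f z - f' z v - f'' v v / 2\<bar> \<le> \<eta> * (norm v)\<^sup>2" if v: "norm v < min d e" for v
  proof -
    define g where "g s = f (z + s *\<^sub>R v) - s * f' z v - s\<^sup>2 / 2 * f'' v v" for s
    have g': "(g has_real_derivative (f' (z + s *\<^sub>R v) - f' z - f'' (s *\<^sub>R v)) v) (at s)"
      if "0 \<le> s" "s \<le> 1" for s
    proof -
      have "norm (s *\<^sub>R v) < e" using v that by (auto intro: le_less_trans[OF mult_left_le_one_le])
      then have "z + s *\<^sub>R v \<in> D" using e by (auto simp: dist_norm subset_iff)
      note f1 = f[OF this]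
      have f2: "((\<lambda>s. f (z + s *\<^sub>R v)) has_real_derivative (f' (z + s *\<^sub>R v) v)) (at s)"
        by (rule has_real_derivative_along_line[OF f1])
      have f3: "((\<lambda>s. s * c + s\<^sup>2 / 2 * d) has_real_derivative c + s * d) (at s)" for c d :: real
        by (auto intro!: derivative_eq_intros)
      show ?thesis
        using DERIV_diff[OF f2 f3[of "f' z v" "f'' v v"]]
        by (simp add: g_def[abs_def] blinfun.diff_left blinfun.scaleR_right blinfun.add_left blinfun.scaleR_left diff_diff_eq)
    qed
    obtain \<xi> where \<xi>: "0 < \<xi>" "\<xi> < 1" "g 1 - g 0 = (1 - 0) * (f' (z + \<xi> *\<^sub>R v) - f' z - f'' (\<xi> *\<^sub>R v)) v"
      using MVT2[of 0 1 g "\<lambda>s. (f' (z + s *\<^sub>R v) - f' z - f'' (s *\<^sub>R v)) v"] g' by auto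
    have "norm (\<xi> *\<^sub>R v) < d" using v \<xi> by (auto intro: le_less_trans[OF mult_left_le_one_le])
    then have "norm (f' (z + \<xi> *\<^sub>R v) - f' z - f'' (\<xi> *\<^sub>R v)) \<le> \<eta> * norm (\<xi> *\<^sub>R v)"
      using d(2)[of "z + \<xi> *\<^sub>R v"] by simp
    also have "\<dots> \<le> \<eta> * norm v" using \<xi> assms by (auto intro: mult_left_le_one_le)
    finally have *: "norm (f' (z + \<xi> *\<^sub>R v) - f' z - f'' (\<xi> *\<^sub>R v)) \<le> \<eta> * norm v" .
    have "g 1 - g 0 = (f' (z + \<xi> *\<^sub>R v) - f' z - f'' (\<xi> *\<^sub>R v)) v" using \<xi>(3) by simp
    then have "\<bar>g 1 - g 0\<bar> \<le> norm (f' (z + \<xi> *\<^sub>R v) - f' z - f'' (\<xi> *\<^sub>R v)) * norm v"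
      using norm_blinfun[of "f' (z + \<xi> *\<^sub>R v) - f' z - f'' (\<xi> *\<^sub>R v)" v] by simp
    also have "\<dots> \<le> \<eta> * norm v * norm v" using * by (rule mult_right_mono) simp
    finally have "\<bar>g 1 - g 0\<bar> \<le> \<eta> * norm v * norm v" .
    then show ?thesis by (simp add: g_def power2_eq_square mult.assoc)
  qed
  then show ?thesis using d e by (intro exI[of _ "min d e"]) auto
qed

text \<open>
  The second difference of \<open>f\<close> over the parallelogram spanned by \<open>s v\<close> and \<open>s w\<close> is symmetric in \<open>v\<close> and \<open>w\<close>.
  By the mean value theorem in direction \<open>v\<close> and the differentiability of \<open>f'\<close> at \<open>z\<close> it equals
  \<open>s\<^sup>2 f'' w v + o(s\<^sup>2)\<close>; exchanging the roles of \<open>v\<close> and \<open>w\<close> gives \<open>s\<^sup>2 f'' v w + o(s\<^sup>2)\<close>. In particular, the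
  Hessians below are symmetric matrices, without which their extremal eigenvalues need not exist.
\<close>
lemma symmetric_second_derivative:
  fixes f :: "'a::real_normed_vector \<Rightarrow> real"
  assumes "open D" "z \<in> D"
    and f: "\<And>x. x \<in> D \<Longrightarrow> (f has_derivative blinfun_apply (f' x)) (at x)"
    and f': "(f' has_derivative blinfun_apply f'') (at z)"
  shows "f'' v w = f'' w v"
proof -
  define \<Delta> where "\<Delta> v w s = f (z + s *\<^sub>R v + s *\<^sub>R w) - f (z + s *\<^sub>R v) - f (z + s *\<^sub>R w) + f z" for v w s
  have key: "\<exists>\<delta>>0. \<forall>s. 0 < s \<longrightarrow> s < \<delta> \<longrightarrow> \<bar>\<Delta> v w s - s\<^sup>2 * f'' w v\<bar> \<le> \<eta> * s\<^sup>2"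
    if \<eta>: "\<eta> > 0" for v w \<eta>
  proof -
    define N where "N = norm v + norm w + 1"
    have N: "N \<ge> 1" by (simp add: N_def)
    define \<theta> where "\<theta> = \<eta> / (2 * N\<^sup>2)"
    have \<theta>: "\<theta> > 0" using \<eta> N by (simp add: \<theta>_def)
    obtain d where d: "d > 0" "\<And>y. norm (y - z) < d \<Longrightarrow> norm (f' y - f' z - f'' (y - z)) \<le> \<theta> * norm (y - z)"
      using f' \<theta> unfolding has_derivative_at_alt by blast
    obtain e where e: "e > 0" "ball z e \<subseteq> D" using assms open_contains_ball by blast
    have "\<bar>\<Delta> v w s - s\<^sup>2 * f'' w v\<bar> \<le> \<eta> * s\<^sup>2" if s: "0 < s" "s < min d e / N" for s
    proof -
      have sN: "s * N < min d e" using s N by (simp add: field_simps)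
      have nrm: "norm (\<tau> *\<^sub>R s *\<^sub>R v + \<kappa> *\<^sub>R s *\<^sub>R w) \<le> s * N" if "0 \<le> \<tau>" "\<tau> \<le> 1" "0 \<le> \<kappa>" "\<kappa> \<le> 1" for \<tau> \<kappa>
      proof -
        have "norm (\<tau> *\<^sub>R s *\<^sub>R v + \<kappa> *\<^sub>R s *\<^sub>R w) \<le> \<tau> * (s * norm v) + \<kappa> * (s * norm w)"
          using norm_triangle_ineq[of "\<tau> *\<^sub>R s *\<^sub>R v" "\<kappa> *\<^sub>R s *\<^sub>R w"] that s by simp
        also have "\<dots> \<le> s * norm v + s * norm w" using that s by (intro add_mono mult_left_le_one_le) auto
        also have "\<dots> \<le> s * N" using s by (simp add: N_def algebra_simps)
        finally show ?thesis .
      qed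
      define G where "G \<tau> = f (z + (\<tau> *\<^sub>R s *\<^sub>R v + 1 *\<^sub>R s *\<^sub>R w)) - f (z + (\<tau> *\<^sub>R s *\<^sub>R v + 0 *\<^sub>R s *\<^sub>R w))" for \<tau>
      have dd: "((\<lambda>\<tau>. f (z + (\<tau> *\<^sub>R s *\<^sub>R v + \<kappa> *\<^sub>R s *\<^sub>R w))) has_real_derivative
            f' (z + (\<tau> *\<^sub>R s *\<^sub>R v + \<kappa> *\<^sub>R s *\<^sub>R w)) (s *\<^sub>R v)) (at \<tau>)" if "0 \<le> \<tau>" "\<tau> \<le> 1" "0 \<le> \<kappa>" "\<kappa> \<le> 1" for \<tau> \<kappa>
      proof -
        have "z + (\<tau> *\<^sub>R s *\<^sub>R v + \<kappa> *\<^sub>R s *\<^sub>R w) \<in> ball z e"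
          unfolding mem_ball dist_norm using nrm[OF that] sN by (subst norm_minus_commute) simp
        then have "z + (\<tau> *\<^sub>R s *\<^sub>R v + \<kappa> *\<^sub>R s *\<^sub>R w) \<in> D" using e by blast
        note f1 = f[OF this]
        then show ?thesis
          using has_real_derivative_along_line[of f "f' (z + (\<tau> *\<^sub>R s *\<^sub>R v + \<kappa> *\<^sub>R s *\<^sub>R w))" "z + \<kappa> *\<^sub>R s *\<^sub>R w" \<tau> "s *\<^sub>R v"]
          by (simp add: add_ac)
      qed
      have "(G has_real_derivative (f' (z + (\<tau> *\<^sub>R s *\<^sub>R v + 1 *\<^sub>R s *\<^sub>R w)) - f' (z + (\<tau> *\<^sub>R s *\<^sub>R v + 0 *\<^sub>R s *\<^sub>R w))) (s *\<^sub>R v)) (at \<tau>)"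
        if "0 \<le> \<tau>" "\<tau> \<le> 1" for \<tau>
        unfolding G_def[abs_def] using DERIV_diff[OF dd[of \<tau> 1] dd[of \<tau> 0]] that by (simp add: blinfun.diff_left)
      then obtain \<xi> where \<xi>: "0 < \<xi>" "\<xi> < 1" "G 1 - G 0 =
          (1 - 0) * (f' (z + (\<xi> *\<^sub>R s *\<^sub>R v + 1 *\<^sub>R s *\<^sub>R w)) - f' (z + (\<xi> *\<^sub>R s *\<^sub>R v + 0 *\<^sub>R s *\<^sub>R w))) (s *\<^sub>R v)"
        using MVT2[of 0 1 G "\<lambda>\<tau>. (f' (z + (\<tau> *\<^sub>R s *\<^sub>R v + 1 *\<^sub>R s *\<^sub>R w)) - f' (z + (\<tau> *\<^sub>R s *\<^sub>R v + 0 *\<^sub>R s *\<^sub>R w))) (s *\<^sub>R v)"] by auto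
      have b: "norm (f' (z + (\<xi> *\<^sub>R s *\<^sub>R v + \<kappa> *\<^sub>R s *\<^sub>R w)) - f' z - f'' (\<xi> *\<^sub>R s *\<^sub>R v + \<kappa> *\<^sub>R s *\<^sub>R w)) \<le> \<theta> * (s * N)"
        if "0 \<le> \<kappa>" "\<kappa> \<le> 1" for \<kappa>
        using d(2)[of "z + (\<xi> *\<^sub>R s *\<^sub>R v + \<kappa> *\<^sub>R s *\<^sub>R w)"] nrm[of \<xi> \<kappa>] that \<xi> sN \<theta>
        by (smt (verit) add_diff_cancel_left' mult_left_mono min_less_iff_conj)
      define E where "E = f' (z + (\<xi> *\<^sub>R s *\<^sub>R v + 1 *\<^sub>R s *\<^sub>R w)) - f' (z + (\<xi> *\<^sub>R s *\<^sub>R v + 0 *\<^sub>R s *\<^sub>R w)) - f'' (s *\<^sub>R w)"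
      have E: "norm E \<le> 2 * (\<theta> * (s * N))"
      proof -
        have "E = (f' (z + (\<xi> *\<^sub>R s *\<^sub>R v + 1 *\<^sub>R s *\<^sub>R w)) - f' z - f'' (\<xi> *\<^sub>R s *\<^sub>R v + 1 *\<^sub>R s *\<^sub>R w))
          - (f' (z + (\<xi> *\<^sub>R s *\<^sub>R v + 0 *\<^sub>R s *\<^sub>R w)) - f' z - f'' (\<xi> *\<^sub>R s *\<^sub>R v + 0 *\<^sub>R s *\<^sub>R w))"
          by (simp add: E_def blinfun.add_right)
        then show ?thesis using norm_triangle_ineq4 b[of 1] b[of 0] by (smt (verit))
      qed
      have "\<Delta> v w s - s\<^sup>2 * f'' w v = E (s *\<^sub>R v)"
        using \<xi>(3) by (simp add: G_def \<Delta>_def E_def blinfun.diff_left blinfun.add_left blinfun.scaleR_right blinfun.scaleR_left power2_eq_square algebra_simps)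
      also have "\<bar>\<dots>\<bar> \<le> norm E * (s * norm v)" using norm_blinfun[of E "s *\<^sub>R v"] s by simp
      also have "\<dots> \<le> 2 * (\<theta> * (s * N)) * (s * N)"
        using E s N \<theta> by (intro mult_mono) (auto simp: N_def)
      also have "\<dots> = \<eta> * s\<^sup>2" using N by (simp add: \<theta>_def power2_eq_square field_simps)
      finally show ?thesis .
    qed
    then show ?thesis using d e N by (intro exI[of _ "min d e / N"]) auto
  qed
  have "\<bar>f'' v w - f'' w v\<bar> \<le> \<eta>" if \<eta>: "\<eta> > 0" for \<eta>
  proof -
    obtain \<delta>1 where 1: "\<delta>1 > 0" "\<forall>s. 0 < s \<longrightarrow> s < \<delta>1 \<longrightarrow> \<bar>\<Delta> v w s - s\<^sup>2 * f'' w v\<bar> \<le> \<eta>/2 * s\<^sup>2"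
      using key[of "\<eta>/2" v w] \<eta> by auto
    obtain \<delta>2 where 2: "\<delta>2 > 0" "\<forall>s. 0 < s \<longrightarrow> s < \<delta>2 \<longrightarrow> \<bar>\<Delta> w v s - s\<^sup>2 * f'' v w\<bar> \<le> \<eta>/2 * s\<^sup>2"
      using key[of "\<eta>/2" w v] \<eta> by auto
    define s where "s = min \<delta>1 \<delta>2 / 2"
    have s: "0 < s" "s < \<delta>1" "s < \<delta>2" using 1 2 by (auto simp: s_def)
    have "\<Delta> v w s = \<Delta> w v s" by (simp add: \<Delta>_def add_ac)
    then have "\<bar>s\<^sup>2 * f'' v w - s\<^sup>2 * f'' w v\<bar> \<le> \<eta> * s\<^sup>2"
      using 1(2)[rule_format, OF s(1,2)] 2(2)[rule_format, OF s(1,3)] by linarith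
    also have "\<bar>s\<^sup>2 * f'' v w - s\<^sup>2 * f'' w v\<bar> = \<bar>f'' v w - f'' w v\<bar> * s\<^sup>2"
      by (simp add: abs_mult flip: right_diff_distrib)
    finally show ?thesis using s(1) by simp
  qed
  then show ?thesis by (metis abs_le_zero_iff abs_ge_zero dense_ge eq_iff_diff_eq_0 order_antisym)
qed

section \<open>Second order jets in the variables X, Y, t\<close>

lemma linear_eq_inner_axis:
  fixes L :: "real ^ 'm \<Rightarrow> real"
  assumes "linear L"
  shows "L k = (\<chi> i. L (axis i 1)) \<bullet> k"
proof -
  have "L k = L (\<Sum>i\<in>UNIV. (k $ i) *\<^sub>R axis i 1)" using basis_expansion[of k] by (simp add: scalar_mult_eq_scaleR)
  also have "\<dots> = (\<Sum>i\<in>UNIV. (k $ i) * L (axis i 1))" using assms by (simp add: linear_sum linear_cmul)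
  finally show ?thesis by (simp add: inner_vec_def mult.commute)
qed

lemma has_derivative_vec_lambda:
  fixes f :: "'a::real_normed_vector \<Rightarrow> 'm::finite \<Rightarrow> real"
  assumes "\<And>i. ((\<lambda>x. f x i) has_derivative (\<lambda>h. f' h i)) F"
  shows "((\<lambda>x. \<chi> i. f x i) has_derivative (\<lambda>h. \<chi> i. f' h i)) F"
proof -
  have eq: "(\<chi> i. v i) = (\<Sum>i\<in>UNIV. v i *\<^sub>R axis i 1)" for v :: "'m \<Rightarrow> real"
    using basis_expansion[of "\<chi> i. v i"] by (simp add: scalar_mult_eq_scaleR)
  show ?thesis unfolding eq
    by (intro has_derivative_sum has_derivative_scaleR_left assms)
qed

text \<open>
  The coordinate expressions \<open>grad_X\<close>, \<open>grad_Y\<close>, \<open>deriv_t\<close>, \<open>hess_X\<close> are the components of the two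
  Frechet derivatives, so that Taylor expansions can be written in terms of them.
\<close>
lemma jet_of_C2:
  fixes \<phi> :: "'m::finite pt \<Rightarrow> real"
  assumes "open D" "z \<in> D"
    and f: "\<And>x. x \<in> D \<Longrightarrow> (\<phi> has_derivative blinfun_apply (f' x)) (at x)"
    and f': "(f' has_derivative blinfun_apply f'') (at z)"
  shows "f' z v = grad_X \<phi> z \<bullet> fst v + grad_Y \<phi> z \<bullet> fst (snd v) + deriv_t \<phi> z * snd (snd v)"
    and "f'' (k, 0, 0) (k', 0, 0) = (hess_X \<phi> z *v k) \<bullet> k'"
proof -
  obtain X Y t where z: "z = (X, Y, t)" by (cases z)
  have emb: "bounded_linear (\<lambda>k::real^'m. (k, 0::real^'m, 0::real))"
    "bounded_linear (\<lambda>k::real^'m. (0::real^'m, k, 0::real))"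
    "bounded_linear (\<lambda>k::real. (0::real^'m, 0::real^'m, k))"
    by (intro bounded_linear_Pair bounded_linear_ident bounded_linear_zero)+
  have lin: "linear (\<lambda>k. f' x (k, 0, 0))" "linear (\<lambda>k. f' x (0, k, 0))" "linear (\<lambda>k. f' x (0, 0, k))" for x
    by (intro bounded_linear.linear bounded_linear_compose[OF blinfun.bounded_linear_right] emb)+
  have gX: "grad_X \<phi> (X', Y, t) = (\<chi> i. f' (X', Y, t) (axis i 1, 0, 0))" if "(X', Y, t) \<in> D" for X'
  proof -
    have "((\<lambda>X'. \<phi> (X', Y, t)) has_derivative (\<lambda>k. f' (X', Y, t) (k, 0, 0))) (at X')"
      by (rule has_derivative_compose[where f = "\<lambda>X'. (X', Y, t)" and g = \<phi>, OF _ f[OF that]])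
         (auto intro!: derivative_eq_intros simp: zero_prod_def)
    from frechet_derivative_at[OF this, symmetric] show ?thesis by (simp add: grad_def)
  qed
  have gY: "grad_Y \<phi> z = (\<chi> i. f' z (0, axis i 1, 0))"
  proof -
    have "((\<lambda>Y'. \<phi> (X, Y', t)) has_derivative (\<lambda>k. f' (X, Y, t) (0, k, 0))) (at Y)"
      by (rule has_derivative_compose[where f = "\<lambda>Y'. (X, Y', t)" and g = \<phi>, OF _ f])
         (use assms z in \<open>auto intro!: derivative_eq_intros simp: zero_prod_def\<close>)
    from frechet_derivative_at[OF this, symmetric] show ?thesis by (simp add: grad_def z)
  qed
  have gt: "deriv_t \<phi> z = f' z (0, 0, 1)"
  proof -
    have "((\<lambda>s. \<phi> (X, Y, s)) has_derivative (\<lambda>k. f' (X, Y, t) (0, 0, k))) (at t)"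
      by (rule has_derivative_compose[where f = "\<lambda>s. (X, Y, s)" and g = \<phi>, OF _ f])
         (use assms z in \<open>auto intro!: derivative_eq_intros simp: zero_prod_def\<close>)
    moreover have "(\<lambda>k. f' (X, Y, t) (0, 0, k)) = (*) (f' z (0, 0, 1))"
    proof
      fix k :: real
      show "f' (X, Y, t) (0, 0, k) = f' z (0, 0, 1) * k"
        using linear_cmul[OF lin(3)[of z], of k 1] by (simp add: z)
    qed
    ultimately have "((\<lambda>s. \<phi> (X, Y, s)) has_real_derivative f' z (0, 0, 1)) (at t)"
      by (simp only: has_field_derivative_def)
    then show ?thesis by (simp add: z DERIV_imp_deriv)
  qed
  have "f' z v = f' z (fst v, 0, 0) + f' z (0, fst (snd v), 0) + f' z (0, 0, snd (snd v))"
    by (simp flip: blinfun.add_right)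
  also have "f' z (fst v, 0, 0) = grad_X \<phi> z \<bullet> fst v"
    using linear_eq_inner_axis[OF lin(1), of z "fst v"] gX[of X] assms z by simp
  also have "f' z (0, fst (snd v), 0) = grad_Y \<phi> z \<bullet> fst (snd v)"
    using linear_eq_inner_axis[OF lin(2), of z "fst (snd v)"] gY by simp
  also have "f' z (0, 0, snd (snd v)) = deriv_t \<phi> z * snd (snd v)"
    using linear_cmul[OF lin(3)[of z], of "snd (snd v)" 1] gt by simp
  finally show "f' z v = grad_X \<phi> z \<bullet> fst v + grad_Y \<phi> z \<bullet> fst (snd v) + deriv_t \<phi> z * snd (snd v)" .

  define S where "S = (\<lambda>X'. (X', Y, t)) -` D"
  have S: "open S" "X \<in> S" using assms z unfolding S_def by (auto intro!: continuous_intros open_vimage)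
  have dd: "((\<lambda>X'. \<chi> i. f' (X', Y, t) (axis i 1, 0, 0)) has_derivative (\<lambda>k. \<chi> i. f'' (k, 0, 0) (axis i 1, 0, 0))) (at X)"
  proof (rule has_derivative_vec_lambda)
    fix i :: 'm
    have "((\<lambda>X'. f' (X', Y, t)) has_derivative (\<lambda>k. f'' (k, 0, 0))) (at X)"
      by (rule has_derivative_compose[where f = "\<lambda>X'. (X', Y, t)" and g = f'])
         (use f' z in \<open>auto intro!: derivative_eq_intros simp: zero_prod_def\<close>)
    then show "((\<lambda>X'. f' (X', Y, t) (axis i 1, 0, 0)) has_derivative (\<lambda>k. f'' (k, 0, 0) (axis i 1, 0, 0))) (at X)"
      by (rule bounded_linear.has_derivative[OF blinfun.bounded_linear_left])
  qed
  have "((\<lambda>X'. grad_X \<phi> (X', Y, t)) has_derivative (\<lambda>k. \<chi> i. f'' (k, 0, 0) (axis i 1, 0, 0))) (at X)"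
    by (rule has_derivative_transform_within_open[OF dd S]) (simp add: gX S_def del: grad_X.simps)
  from frechet_derivative_at[OF this, symmetric]
  have H: "hess_X \<phi> z = matrix (\<lambda>k. \<chi> i. f'' (k, 0, 0) (axis i 1, 0, 0))" by (simp add: z)
  have lin2: "linear (\<lambda>k. f'' (k, 0, 0) w)" for w
    by (intro bounded_linear.linear bounded_linear_compose[OF blinfun.bounded_linear_left]
          bounded_linear_compose[OF blinfun.bounded_linear_right] emb)
  have "linear (\<lambda>k. \<chi> i. f'' (k, 0, 0) (axis i 1, 0, 0))"
    by (rule linearI) (simp_all add: vec_eq_iff linear_add[OF lin2] linear_cmul[OF lin2])
  then have "hess_X \<phi> z *v k = (\<chi> i. f'' (k, 0, 0) (axis i 1, 0, 0))"
    unfolding H by (simp add: matrix_works linear_matrix_vector_mul_eq)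
  moreover have "linear (\<lambda>k'. f'' (k, 0, 0) (k', 0, 0))"
    by (intro bounded_linear.linear bounded_linear_compose[OF blinfun.bounded_linear_right] emb)
  from linear_eq_inner_axis[OF this, of k']
  show "f'' (k, 0, 0) (k', 0, 0) = (hess_X \<phi> z *v k) \<bullet> k'" using calculation by simp
qed

lemma C2_expansion:
  fixes \<phi> :: "'m::finite pt \<Rightarrow> real"
  assumes "open D" "z \<in> D" "C2_on D \<phi>"
  obtains B :: "'m pt \<Rightarrow>\<^sub>L 'm pt \<Rightarrow>\<^sub>L real"
  where "\<And>v w. B v w = B w v" "\<And>k k'. B (k, 0, 0) (k', 0, 0) = (hess_X \<phi> z *v k) \<bullet> k'"
    "\<And>\<eta>. \<eta> > 0 \<Longrightarrow> \<exists>\<delta>>0. \<forall>v. norm v < \<delta> \<longrightarrow>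
       \<bar>\<phi> (z + v) - \<phi> z - (grad_X \<phi> z \<bullet> fst v + grad_Y \<phi> z \<bullet> fst (snd v) + deriv_t \<phi> z * snd (snd v)) - B v v / 2\<bar>
         \<le> \<eta> * (norm v)\<^sup>2"
proof -
  from assms(3) obtain f' f'' where f: "\<And>x. x \<in> D \<Longrightarrow> (\<phi> has_derivative blinfun_apply (f' x)) (at x)"
    "\<forall>x\<in>D. (f' has_derivative blinfun_apply (f'' x)) (at x)"
    unfolding C2_on_def by blast
  note f'' = f(2)[rule_format, OF assms(2)]
  show ?thesis
  proof (rule that[of "f'' z"])
    show "f'' z v w = f'' z w v" for v w
      by (rule symmetric_second_derivative[OF assms(1,2) f(1) f''])
    show "f'' z (k, 0, 0) (k', 0, 0) = (hess_X \<phi> z *v k) \<bullet> k'" for k k'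
      by (rule jet_of_C2(2)[OF assms(1,2) f(1) f''])
    show "\<exists>\<delta>>0. \<forall>v. norm v < \<delta> \<longrightarrow>
       \<bar>\<phi> (z + v) - \<phi> z - (grad_X \<phi> z \<bullet> fst v + grad_Y \<phi> z \<bullet> fst (snd v) + deriv_t \<phi> z * snd (snd v)) - f'' z v v / 2\<bar>
         \<le> \<eta> * (norm v)\<^sup>2" if "\<eta> > 0" for \<eta>
      using second_order_taylor[OF assms(1,2) that f(1) f''] jet_of_C2(1)[OF assms(1,2) f(1) f''] by simp
  qed
qed

lemma hess_X_symmetric:
  fixes \<phi> :: "'m::finite pt \<Rightarrow> real"
  assumes "open D" "z \<in> D" "C2_on D \<phi>"
  shows "(hess_X \<phi> z *v k) \<bullet> k' = (hess_X \<phi> z *v k') \<bullet> k"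
proof -
  obtain B :: "'m pt \<Rightarrow>\<^sub>L 'm pt \<Rightarrow>\<^sub>L real" where "\<And>v w. B v w = B w v"
    "\<And>k k'. B (k, 0, 0) (k', 0, 0) = (hess_X \<phi> z *v k) \<bullet> k'"
    using C2_expansion[OF assms] by metis
  then show ?thesis by metis
qed

text \<open>
  A polynomial without constant term and of degree at most two that is \<open>o(s\<^sup>2)\<close> vanishes. This is what makes
  second order jets unique.
\<close>
lemma quadratic_small_imp_zero:
  fixes l q :: real
  assumes "\<And>\<eta>. \<eta> > 0 \<Longrightarrow> \<exists>\<delta>>0. \<forall>s. \<bar>s\<bar> < \<delta> \<longrightarrow> \<bar>s * l + s\<^sup>2 * q\<bar> \<le> \<eta> * s\<^sup>2"
  shows "l = 0" "q = 0"
proof -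
  have *: "\<bar>l\<bar> \<le> \<theta>" if \<theta>: "\<theta> > 0" for \<theta>
  proof -
    obtain \<delta> where \<delta>: "\<delta> > 0" "\<forall>s. \<bar>s\<bar> < \<delta> \<longrightarrow> \<bar>s * l + s\<^sup>2 * q\<bar> \<le> 1 * s\<^sup>2" using assms[of 1] by auto
    define s where "s = min (\<delta>/2) (\<theta> / (1 + \<bar>q\<bar>))"
    have s: "s > 0" "s < \<delta>" "s * (1 + \<bar>q\<bar>) \<le> \<theta>"
      using \<delta> \<theta> pos_le_divide_eq[of "1 + \<bar>q\<bar>" s \<theta>] by (auto simp: s_def add_pos_nonneg)
    have "\<bar>s * l + s\<^sup>2 * q\<bar> \<le> 1 * s\<^sup>2" using \<delta>(2) s by auto
    moreover have "s * l + s\<^sup>2 * q = s * (l + s * q)" by (simp add: power2_eq_square algebra_simps)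
    ultimately have "s * \<bar>l + s * q\<bar> \<le> s * s" using s by (simp add: abs_mult power2_eq_square)
    then have "\<bar>l + s * q\<bar> \<le> s" using s by simp
    moreover have "\<bar>s * q\<bar> = s * \<bar>q\<bar>" using s by (simp add: abs_mult)
    ultimately show ?thesis using s(3) by (simp add: algebra_simps)
  qed
  then show l: "l = 0" by (metis abs_le_zero_iff dense_ge)
  have "\<bar>q\<bar> \<le> \<eta>" if \<eta>: "\<eta> > 0" for \<eta>
  proof -
    obtain \<delta> where \<delta>: "\<delta> > 0" "\<forall>s. \<bar>s\<bar> < \<delta> \<longrightarrow> \<bar>s * l + s\<^sup>2 * q\<bar> \<le> \<eta> * s\<^sup>2" using assms[OF \<eta>] by auto
    have "\<bar>(\<delta>/2)\<^sup>2 * q\<bar> \<le> \<eta> * (\<delta>/2)\<^sup>2" using \<delta>(2)[rule_format, of "\<delta>/2"] \<delta>(1) l by auto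
    then show ?thesis using \<delta>(1) by (simp add: abs_mult field_simps)
  qed
  then show "q = 0" by (metis abs_le_zero_iff dense_ge)
qed

text \<open>
  Reads the derivatives off from a Taylor expansion: two second order expansions differ by a polynomial that is
  \<open>o(|v|\<^sup>2)\<close> and hence is zero on every line through the origin. It yields the derivatives of the cut-off
  constructions below. The quadratic part of the expansion is assumed to split into an \<open>X\<close> part \<open>A\<close> and a part
  \<open>Q\<close> in \<open>(Y, t)\<close>; polarization recovers the matrix from its quadratic form.
\<close>
lemma jet_unique:
  fixes \<phi> :: "'m::finite pt \<Rightarrow> real"
  assumes "open D" "z \<in> D" "C2_on D \<phi>"
    and A: "\<And>k k'. (A *v k) \<bullet> k' = (A *v k') \<bullet> k"
    and exp: "\<And>\<eta>. \<eta> > 0 \<Longrightarrow> \<exists>\<delta>>0. \<forall>v. norm v < \<delta> \<longrightarrow>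
       \<bar>\<phi> (z + v) - \<phi> z - (g \<bullet> fst v + b \<bullet> fst (snd v) + c * snd (snd v))
          - ((A *v fst v) \<bullet> fst v / 2 + Q (snd v))\<bar> \<le> \<eta> * (norm v)\<^sup>2"
    and Q: "\<And>s w. Q (s *\<^sub>R w) = s\<^sup>2 * Q w"
  shows "grad_X \<phi> z = g" "grad_Y \<phi> z = b" "deriv_t \<phi> z = c" "hess_X \<phi> z = A"
proof -
  obtain B :: "'m pt \<Rightarrow>\<^sub>L 'm pt \<Rightarrow>\<^sub>L real" where B: "\<And>v w. B v w = B w v"
    "\<And>k k'. B (k, 0, 0) (k', 0, 0) = (hess_X \<phi> z *v k) \<bullet> k'"
    "\<And>\<eta>. \<eta> > 0 \<Longrightarrow> \<exists>\<delta>>0. \<forall>v. norm v < \<delta> \<longrightarrow>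
       \<bar>\<phi> (z + v) - \<phi> z - (grad_X \<phi> z \<bullet> fst v + grad_Y \<phi> z \<bullet> fst (snd v) + deriv_t \<phi> z * snd (snd v)) - B v v / 2\<bar>
         \<le> \<eta> * (norm v)\<^sup>2"
    using C2_expansion[OF assms(1-3)] by metis
  define l where "l v = (g - grad_X \<phi> z) \<bullet> fst v + (b - grad_Y \<phi> z) \<bullet> fst (snd v) + (c - deriv_t \<phi> z) * snd (snd v)" for v
  define q where "q v = ((A *v fst v) \<bullet> fst v / 2 + Q (snd v)) - B v v / 2" for v
  have lq: "l v = 0 \<and> q v = 0" for v
  proof -
    have "\<exists>\<delta>>0. \<forall>s. \<bar>s\<bar> < \<delta> \<longrightarrow> \<bar>s * l v + s\<^sup>2 * q v\<bar> \<le> \<eta> * s\<^sup>2" if \<eta>: "\<eta> > 0" for \<eta>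
    proof -
      define \<theta> where "\<theta> = \<eta> / (2 * (1 + (norm v)\<^sup>2))"
      have \<theta>: "\<theta> > 0" using \<eta> by (simp add: \<theta>_def add_pos_nonneg)
      have \<theta>2: "2 * \<theta> * (norm v)\<^sup>2 \<le> \<eta>"
        using \<eta> by (simp add: \<theta>_def field_simps add_pos_nonneg)
      obtain d1 where d1: "d1 > 0" "\<forall>v. norm v < d1 \<longrightarrow>
       \<bar>\<phi> (z + v) - \<phi> z - (grad_X \<phi> z \<bullet> fst v + grad_Y \<phi> z \<bullet> fst (snd v) + deriv_t \<phi> z * snd (snd v)) - B v v / 2\<bar>
         \<le> \<theta> * (norm v)\<^sup>2" using B(3)[OF \<theta>] by blast
      obtain d2 where d2: "d2 > 0" "\<forall>v. norm v < d2 \<longrightarrow>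
       \<bar>\<phi> (z + v) - \<phi> z - (g \<bullet> fst v + b \<bullet> fst (snd v) + c * snd (snd v))
          - ((A *v fst v) \<bullet> fst v / 2 + Q (snd v))\<bar> \<le> \<theta> * (norm v)\<^sup>2" using exp[OF \<theta>] by blast
      have "\<bar>s * l v + s\<^sup>2 * q v\<bar> \<le> \<eta> * s\<^sup>2" if s: "\<bar>s\<bar> < min d1 d2 / (1 + norm v)" for s
      proof -
        have "\<bar>s\<bar> * (1 + norm v) < min d1 d2" using s by (simp add: field_simps add_pos_nonneg)
        then have n: "norm (s *\<^sub>R v) < d1" "norm (s *\<^sub>R v) < d2" by (auto simp: algebra_simps)
        have "s * l v + s\<^sup>2 * q v = 
          (\<phi> (z + s *\<^sub>R v) - \<phi> z - (grad_X \<phi> z \<bullet> fst (s *\<^sub>R v) + grad_Y \<phi> z \<bullet> fst (snd (s *\<^sub>R v)) + deriv_t \<phi> z * snd (snd (s *\<^sub>R v))) - B (s *\<^sub>R v) (s *\<^sub>R v) / 2)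
          - (\<phi> (z + s *\<^sub>R v) - \<phi> z - (g \<bullet> fst (s *\<^sub>R v) + b \<bullet> fst (snd (s *\<^sub>R v)) + c * snd (snd (s *\<^sub>R v)))
          - ((A *v fst (s *\<^sub>R v)) \<bullet> fst (s *\<^sub>R v) / 2 + Q (snd (s *\<^sub>R v))))"
          by (simp add: l_def q_def Q blinfun.scaleR_right blinfun.scaleR_left algebra_simps inner_diff_left
             inner_add_left matrix_vector_mult_scaleR power2_eq_square)
        also have "\<bar>\<dots>\<bar> \<le> \<theta> * (norm (s *\<^sub>R v))\<^sup>2 + \<theta> * (norm (s *\<^sub>R v))\<^sup>2"
          using d1(2)[rule_format, OF n(1)] d2(2)[rule_format, OF n(2)] by linarith
        also have "\<dots> = (2 * \<theta> * (norm v)\<^sup>2) * s\<^sup>2" by (simp add: power_mult_distrib)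
        also have "\<dots> \<le> \<eta> * s\<^sup>2" using \<theta>2 by (rule mult_right_mono) simp
        finally show ?thesis .
      qed
      then show ?thesis using d1 d2 by (intro exI[of _ "min d1 d2 / (1 + norm v)"]) (auto simp: add_pos_nonneg)
    qed
    then show ?thesis using quadratic_small_imp_zero[of "l v" "q v"] by blast
  qed
  have Q0: "Q 0 = 0" using Q[of 0 0] by simp
  show "grad_X \<phi> z = g" using lq[of "(g - grad_X \<phi> z, 0, 0)"] by (simp add: l_def)
  show "grad_Y \<phi> z = b" using lq[of "(0, b - grad_Y \<phi> z, 0)"] by (simp add: l_def)
  show "deriv_t \<phi> z = c" using lq[of "(0, 0, c - deriv_t \<phi> z)"] by (simp add: l_def)
  have dg: "(A *v k) \<bullet> k = (hess_X \<phi> z *v k) \<bullet> k" for k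
    using lq[of "(k, 0, 0)"] Q0 by (simp add: q_def B(2) zero_prod_def)
  have "(A *v k) \<bullet> k' = (hess_X \<phi> z *v k) \<bullet> k'" for k k'
    using dg[of "k + k'"] dg[of k] dg[of k'] A[of k k'] hess_X_symmetric[OF assms(1-3), of k k']
    by (simp add: matrix_vector_right_distrib inner_add_left inner_add_right)
  then have "A *v k = hess_X \<phi> z *v k" for k by (metis vector_eq_rdot)
  then show "hess_X \<phi> z = A" by (metis matrix_eq)
qed

section \<open>Second moments of a ball\<close>

lemma distr_lborel_permute_basis:
  fixes \<pi> :: "'a::euclidean_space \<Rightarrow> 'a"
  assumes \<pi>: "\<And>b. b \<in> Basis \<Longrightarrow> \<pi> b \<in> Basis" "\<And>b. b \<in> Basis \<Longrightarrow> \<pi> (\<pi> b) = b"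
  shows "distr lborel borel (\<lambda>x. \<Sum>b\<in>Basis. (x \<bullet> \<pi> b) *\<^sub>R b) = (lborel :: 'a measure)" (is "distr _ _ ?T = _")
proof (rule lborel_eqI[symmetric])
  fix l u :: 'a assume le: "\<And>b. b \<in> Basis \<Longrightarrow> l \<bullet> b \<le> u \<bullet> b"
  have [measurable]: "?T \<in> borel \<rightarrow>\<^sub>M borel" by simp
  have bij: "bij_betw \<pi> Basis Basis"
    by (rule bij_betwI[where g = \<pi>]) (use \<pi> in auto)
  have Tb: "?T x \<bullet> b = x \<bullet> \<pi> b" if "b \<in> Basis" for x b
    using that by (simp add: inner_sum_left_Basis)
  have "?T -` box l u = box (?T l) (?T u)"
  proof -
    have "(\<forall>b\<in>Basis. l \<bullet> b < x \<bullet> \<pi> b \<and> x \<bullet> \<pi> b < u \<bullet> b) \<longleftrightarrow>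
          (\<forall>b\<in>Basis. l \<bullet> \<pi> b < x \<bullet> b \<and> x \<bullet> b < u \<bullet> \<pi> b)" for x
      using \<pi> by metis
    then show ?thesis by (auto simp: box_def Tb)
  qed
  then have "emeasure (distr lborel borel ?T) (box l u) = emeasure lborel (box (?T l) (?T u))"
    by (simp add: emeasure_distr)
  also have "\<dots> = (\<Prod>b\<in>Basis. (?T u - ?T l) \<bullet> b)"
    using le \<pi> by (subst emeasure_lborel_box_eq) (auto simp: Tb inner_diff_left)
  also have "(\<Prod>b\<in>Basis. (?T u - ?T l) \<bullet> b) = (\<Prod>b\<in>Basis. (u - l) \<bullet> \<pi> b)"
    by (rule prod.cong) (simp_all add: Tb inner_diff_left)
  also have "\<dots> = (\<Prod>b\<in>Basis. (u - l) \<bullet> b)"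
    using prod.reindex_bij_betw[OF bij, of "\<lambda>b. (u - l) \<bullet> b"] .
  finally show "emeasure (distr lborel borel ?T) (box l u) = (\<Prod>b\<in>Basis. (u - l) \<bullet> b)" .
qed simp

lemma distr_lborel_reflect_basis:
  fixes j :: "'a::euclidean_space"
  assumes j: "j \<in> Basis"
  shows "distr lborel borel (\<lambda>x. x - (2 * (x \<bullet> j)) *\<^sub>R j) = (lborel :: 'a measure)"
proof -
  define c where "c i = (if i = j then -1 else 1 :: real)" for i
  have T: "(\<Sum>i\<in>Basis. (c i * (x \<bullet> i)) *\<^sub>R i) = x - (2 * (x \<bullet> j)) *\<^sub>R j" for x
    by (rule euclidean_eqI) (use j in \<open>auto simp: c_def inner_sum_left_Basis inner_diff_left inner_Basis\<close>)
  have "\<bar>c i\<bar> = 1" for i by (simp add: c_def)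
  moreover have "lborel = density (distr lborel borel (\<lambda>x. 0 + (\<Sum>i\<in>Basis. (c i * (x \<bullet> i)) *\<^sub>R i))) (\<lambda>_. (\<Prod>j\<in>Basis. \<bar>c j\<bar>))"
    by (rule lborel_affine_euclidean) (simp add: c_def)
  ultimately show ?thesis by (simp add: T density_1)
qed

lemma integral_ball_isometry:
  fixes T :: "'a::euclidean_space \<Rightarrow> 'a" and g :: "'a \<Rightarrow> real"
  assumes "distr lborel borel T = lborel" "T \<in> borel_measurable borel" "\<And>x. norm (T x) = norm x"
    and [measurable]: "g \<in> borel_measurable borel"
  shows "(LINT x:ball 0 r|lborel. g (T x)) = (LINT x:ball 0 r|lborel. g x)"
proof -
  have [measurable]: "ball (0::'a) r \<in> sets borel" by simp
  have ind: "(\<lambda>x. indicator (ball 0 r) x *\<^sub>R g x) \<in> borel_measurable borel" by measurable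
  have "(LINT x:ball 0 r|lborel. g x) = (LINT x|distr lborel borel T. indicator (ball 0 r) x *\<^sub>R g x)"
    by (simp add: assms(1) set_lebesgue_integral_def)
  also have "\<dots> = (LINT x|lborel. indicator (ball 0 r) (T x) *\<^sub>R g (T x))"
    by (rule integral_distr) (use assms(2) ind in auto)
  also have "\<dots> = (LINT x:ball 0 r|lborel. g (T x))"
    using assms(3) by (simp add: set_lebesgue_integral_def indicator_def)
  finally show ?thesis ..
qed

lemma set_integrable_ball:
  fixes g :: "'a::euclidean_space \<Rightarrow> real"
  assumes "continuous_on (cball x r) g"
  shows "set_integrable lborel (ball x r) g"
proof -
  have "set_integrable lborel (cball x r) g"
    unfolding set_integrable_def by (rule borel_integrable_compact[OF compact_cball assms])
  then show ?thesis by (rule set_integrable_subset) auto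
qed

lemma set_integral_const_ball:
  "(LINT x:ball (y::'a::euclidean_space) r|lborel. (c::real)) = c * measure lborel (ball y r)"
  by (simp add: set_lebesgue_integral_def mult.commute)

text \<open>
  Put \<open>F R = \<integral>\<^bsub>|x| < R\<^esub> |x|\<^sup>2 dx\<close>. By scaling, \<open>F R = F 1 R\<^bsup>m+2\<^esup>\<close> and the volume is \<open>v R\<^bsup>m\<^esup>\<close>.
  On the shell between the radii \<open>1\<close> and \<open>R\<close> the integrand lies between \<open>1\<close> and \<open>R\<^sup>2\<close>; comparing derivatives at
  \<open>R = 1\<close> gives \<open>(m + 2) F 1 = m v\<close>.
\<close>
lemma integral_ball_norm_square:
  fixes R :: real
  assumes "R \<ge> 0"
  shows "(LINT x:ball (0::'a::euclidean_space) R|lborel. (norm x)\<^sup>2)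
    = real DIM('a) / (real DIM('a) + 2) * R\<^sup>2 * measure lborel (ball (0::'a) R)"
proof -
  let ?m = "DIM('a)"
  define F where "F R = (LINT x:ball (0::'a) R|lborel. (norm x)\<^sup>2)" for R
  define v where "v = measure lborel (ball (0::'a) 1)"
  have V: "measure lborel (ball (0::'a) R) = v * R ^ ?m" if "R \<ge> 0" for R
    using content_ball_conv_unit_ball[OF that, of "0::'a"] by (simp add: v_def mult.commute)
  have F: "F R = F 1 * R ^ (?m + 2)" if "R > 0" for R
  proof -
    have [measurable]: "ball (0::'a) R \<in> sets borel" by simp
    have meas: "(\<lambda>x::'a. indicator (ball 0 R) x * (norm x)\<^sup>2) \<in> borel_measurable borel" by measurable
    have "F R = (LINT x|lborel. indicator (ball 0 R) x * (norm (x::'a))\<^sup>2)"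
      by (simp add: F_def set_lebesgue_integral_def)
    also have "\<dots> = (LINT x|density (distr lborel borel (\<lambda>x::'a. 0 + R *\<^sub>R x)) (\<lambda>_. ennreal (\<bar>R\<bar> ^ ?m)).
         indicator (ball 0 R) x * (norm x)\<^sup>2)"
      using lborel_affine[of R "0::'a"] that by (simp add: ennreal_power)
    also have "\<dots> = (LINT x|lborel. R ^ ?m * (indicator (ball 0 R) (R *\<^sub>R (x::'a)) * (norm (R *\<^sub>R x))\<^sup>2))"
      using that meas by (subst integral_real_density) (auto simp: integral_distr simp del: norm_scaleR)
    also have "\<dots> = (LINT x|lborel. R ^ (?m + 2) * (indicator (ball 0 1) (x::'a) * (norm x)\<^sup>2))"
      using that by (intro Bochner_Integration.integral_cong) (auto simp: indicator_def power_mult_distrib power_add power2_eq_square)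
    also have "\<dots> = F 1 * R ^ (?m + 2)"
      by (simp add: F_def set_lebesgue_integral_def mult.commute)
    finally show ?thesis .
  qed
  have int: "set_integrable lborel (ball (0::'a) R) g" if "continuous_on UNIV g" for R and g :: "'a \<Rightarrow> real"
    by (rule set_integrable_ball) (use that continuous_on_subset in blast)
  have shell: "v * (R ^ ?m - 1) \<le> F 1 * (R ^ (?m+2) - 1)" "F 1 * (R ^ (?m+2) - 1) \<le> R\<^sup>2 * (v * (R ^ ?m - 1))"
    if R: "R \<ge> 1" for R
  proof -
    define S where "S = ball (0::'a) R - ball 0 1"
    have un: "ball (0::'a) R = ball 0 1 \<union> S" "ball 0 1 \<inter> S = {}" using R by (auto simp: S_def)
    have intS: "set_integrable lborel S g" if "continuous_on UNIV g" for g :: "'a \<Rightarrow> real"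
      by (rule set_integrable_subset[OF int[OF that, of R]]) (auto simp: S_def)
    have split: "(LINT x:S|lborel. g x) = (LINT x:ball 0 R|lborel. g x) - (LINT x:ball 0 1|lborel. g x)"
      if "continuous_on UNIV g" for g :: "'a \<Rightarrow> real"
      using set_integral_Un[OF un(2) int[OF that] intS[OF that]] un(1) by simp
    have FS: "(LINT x:S|lborel. (norm x)\<^sup>2) = F 1 * (R ^ (?m+2) - 1)"
      using R F[of R] by (subst split) (auto intro!: continuous_intros simp: F_def algebra_simps)
    have VS: "(LINT x:S|lborel. 1) = v * (R ^ ?m - 1)"
      using R V[of R] V[of 1] by (subst split) (auto simp: set_integral_const_ball algebra_simps)
    have i1: "set_integrable lborel S (\<lambda>x. 1 :: real)" and i2: "set_integrable lborel S (\<lambda>x. (norm x)\<^sup>2)"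
      and i3: "set_integrable lborel S (\<lambda>x. R\<^sup>2 * 1)"
      by (intro intS continuous_intros)+
    have "(LINT x:S|lborel. 1) \<le> (LINT x:S|lborel. (norm x)\<^sup>2)"
      by (rule set_integral_mono[OF i1 i2]) (auto simp: S_def not_less one_le_power)
    then show "v * (R ^ ?m - 1) \<le> F 1 * (R ^ (?m+2) - 1)" using FS VS by simp
    have "(LINT x:S|lborel. (norm x)\<^sup>2) \<le> (LINT x:S|lborel. R\<^sup>2 * 1)"
      by (rule set_integral_mono[OF i2 i3]) (auto intro!: power_mono simp: S_def)
    then show "F 1 * (R ^ (?m+2) - 1) \<le> R\<^sup>2 * (v * (R ^ ?m - 1))" 
      using FS VS by (simp only: set_integral_mult_right)
  qed
  have nonneg: "h' \<ge> 0" if "(h has_real_derivative h') (at 1)" "\<And>R. R \<ge> 1 \<Longrightarrow> h R \<ge> 0" "h 1 = 0" for h :: "real \<Rightarrow> real" and h'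
  proof (rule ccontr)
    assume neg: "\<not> h' \<ge> 0"
    have "\<exists>d>0. \<forall>e>0. e < d \<longrightarrow> h (1 + e) < h 1"
      using DERIV_neg_dec_right[OF that(1)] neg by simp
    then obtain d where d: "d > 0" "\<forall>e>0. e < d \<longrightarrow> h (1 + e) < h 1" by blast
    show False using d(2)[rule_format, of "d/2"] d(1) that(2)[of "1 + d/2"] that(3) by simp
  qed
  have 1: "((\<lambda>R. F 1 * (R ^ (?m+2) - 1) - v * (R ^ ?m - 1)) has_real_derivative F 1 * (?m+2) - v * ?m) (at 1)"
    by (auto intro!: derivative_eq_intros)
  have 2: "((\<lambda>R. R\<^sup>2 * (v * (R ^ ?m - 1)) - F 1 * (R ^ (?m+2) - 1)) has_real_derivative v * ?m - F 1 * (?m+2)) (at 1)"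
    by (auto intro!: derivative_eq_intros)
  have "F 1 * (?m+2) = v * ?m"
    using nonneg[OF 1] nonneg[OF 2] shell by fastforce
  then have F1: "F 1 = real ?m / (real ?m + 2) * v" by (simp add: field_simps)
  show ?thesis
  proof (cases "R = 0")
    case False
    then have "F R = real ?m / (real ?m + 2) * v * R ^ (?m + 2)" using F assms F1 by simp
    then show ?thesis using V[OF assms] by (simp add: F_def power_add power2_eq_square mult_ac)
  qed (simp add: set_lebesgue_integral_def)
qed

text \<open>
  The mixed moments vanish because reflecting one coordinate preserves the ball and the measure. Exchanging
  two coordinates shows that the pure moments agree, so each of them is the \<open>m\<close>-th part of the integral of \<open>|x|\<^sup>2\<close>.
\<close>
lemma integral_ball_coordinates:
  fixes i j :: "'a::euclidean_space"
  assumes "i \<in> Basis" "j \<in> Basis" "R \<ge> 0"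
  shows "(LINT x:ball (0::'a) R|lborel. (x \<bullet> i) * (x \<bullet> j))
    = (if i = j then R\<^sup>2 / (real DIM('a) + 2) * measure lborel (ball (0::'a) R) else 0)"
proof (cases "i = j")
  case False
  define T where "T x = x - (2 * (x \<bullet> j)) *\<^sub>R j" for x
  have T: "norm (T x) = norm x" for x
  proof -
    have "T x \<bullet> T x = x \<bullet> x" using assms(2) by (simp add: T_def algebra_simps inner_diff_left inner_diff_right inner_commute)
    then show ?thesis by (simp add: norm_eq_sqrt_inner)
  qed
  have D: "distr lborel borel T = lborel" unfolding T_def[abs_def] by (rule distr_lborel_reflect_basis[OF assms(2)])
  have "(LINT x:ball (0::'a) R|lborel. (T x \<bullet> i) * (T x \<bullet> j)) = (LINT x:ball (0::'a) R|lborel. (x \<bullet> i) * (x \<bullet> j))"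
    by (rule integral_ball_isometry[where g = "\<lambda>x. (x \<bullet> i) * (x \<bullet> j)"])
       (use T D in \<open>auto simp: T_def[abs_def]\<close>)
  moreover have "(T x \<bullet> i) * (T x \<bullet> j) = - ((x \<bullet> i) * (x \<bullet> j))" for x
    using assms False by (simp add: T_def inner_diff_left inner_Basis algebra_simps)
  ultimately have "(LINT x:ball (0::'a) R|lborel. - ((x \<bullet> i) * (x \<bullet> j))) = (LINT x:ball (0::'a) R|lborel. (x \<bullet> i) * (x \<bullet> j))"
    by simp
  moreover have "(LINT x:ball (0::'a) R|lborel. - ((x \<bullet> i) * (x \<bullet> j))) = - (LINT x:ball (0::'a) R|lborel. (x \<bullet> i) * (x \<bullet> j))"
    by (rule set_integral_uminus) (auto intro!: set_integrable_ball continuous_intros)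
  ultimately show ?thesis using False by simp
next
  case True
  have eq: "(LINT x:ball (0::'a) R|lborel. (x \<bullet> k)\<^sup>2) = (LINT x:ball (0::'a) R|lborel. (x \<bullet> i)\<^sup>2)" if k: "k \<in> Basis" for k
  proof -
    define \<pi> where "\<pi> b = (if b = i then k else if b = k then i else b)" for b
    define T :: "'a \<Rightarrow> 'a" where "T x = (\<Sum>b\<in>Basis. (x \<bullet> \<pi> b) *\<^sub>R b)" for x
    have \<pi>: "\<And>b. b \<in> Basis \<Longrightarrow> \<pi> b \<in> Basis" "\<And>b. b \<in> Basis \<Longrightarrow> \<pi> (\<pi> b) = b"
      using assms k by (auto simp: \<pi>_def)
    have bij: "bij_betw \<pi> Basis Basis"
      by (rule bij_betwI[where g = \<pi>]) (use \<pi> in auto)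
    have Tb: "T x \<bullet> b = x \<bullet> \<pi> b" if "b \<in> Basis" for x b
      using that by (simp add: T_def inner_sum_left_Basis)
    have T: "norm (T x) = norm x" for x
    proof -
      have "T x \<bullet> T x = (\<Sum>b\<in>Basis. (x \<bullet> \<pi> b) * (x \<bullet> \<pi> b))"
        by (subst euclidean_inner) (simp add: Tb)
      also have "\<dots> = (\<Sum>b\<in>Basis. (x \<bullet> b) * (x \<bullet> b))"
        using sum.reindex_bij_betw[OF bij, of "\<lambda>b. (x \<bullet> b) * (x \<bullet> b)"] .
      also have "\<dots> = x \<bullet> x" by (rule euclidean_inner[symmetric])
      finally show ?thesis by (simp add: norm_eq_sqrt_inner)
    qed
    have D: "distr lborel borel T = lborel" unfolding T_def[abs_def] by (rule distr_lborel_permute_basis[OF \<pi>])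
    have "(LINT x:ball (0::'a) R|lborel. (T x \<bullet> i)\<^sup>2) = (LINT x:ball (0::'a) R|lborel. (x \<bullet> i)\<^sup>2)"
      by (rule integral_ball_isometry[where g = "\<lambda>x. (x \<bullet> i)\<^sup>2"])
         (use T D in \<open>auto simp: T_def[abs_def]\<close>)
    moreover have "T x \<bullet> i = x \<bullet> k" for x using Tb[OF assms(1)] by (simp add: \<pi>_def)
    ultimately show ?thesis by simp
  qed
  have "(LINT x:ball (0::'a) R|lborel. (norm x)\<^sup>2) = (LINT x:ball (0::'a) R|lborel. \<Sum>k\<in>Basis. (x \<bullet> k)\<^sup>2)"
    unfolding power2_norm_eq_inner by (subst euclidean_inner) (simp add: power2_eq_square)
  also have "\<dots> = (\<Sum>k\<in>Basis. LINT x:ball (0::'a) R|lborel. (x \<bullet> k)\<^sup>2)"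
    unfolding set_lebesgue_integral_def scaleR_sum_right
    by (rule Bochner_Integration.integral_sum)
       (rule set_integrable_ball[unfolded set_integrable_def], intro continuous_intros)
  also have "\<dots> = real DIM('a) * (LINT x:ball (0::'a) R|lborel. (x \<bullet> i)\<^sup>2)"
    by (simp add: eq)
  finally have "real DIM('a) * (LINT x:ball (0::'a) R|lborel. (x \<bullet> i)\<^sup>2)
     = real DIM('a) * (R\<^sup>2 / (real DIM('a) + 2) * measure lborel (ball (0::'a) R))"
    using integral_ball_norm_square[OF assms(3), where 'a='a] by simp
  then have "(LINT x:ball (0::'a) R|lborel. (x \<bullet> i)\<^sup>2) = R\<^sup>2 / (real DIM('a) + 2) * measure lborel (ball (0::'a) R)"
    by (simp only: mult_cancel_left) simp
  then show ?thesis using True by (simp add: power2_eq_square)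
qed

lemma integral_ball_linear:
  fixes g :: "'a::euclidean_space"
  shows "(LINT x:ball (0::'a) R|lborel. g \<bullet> x) = 0"
proof -
  have "lborel = density (distr lborel borel (\<lambda>x::'a. 0 + (-1) *\<^sub>R x)) (\<lambda>_. \<bar>-1::real\<bar> ^ DIM('a))"
    by (rule lborel_affine) simp
  then have "distr lborel borel (\<lambda>x::'a. - x) = lborel" by (simp add: density_1)
  from integral_ball_isometry[OF this, of "\<lambda>x. g \<bullet> x" R]
  have "(LINT x:ball (0::'a) R|lborel. - (g \<bullet> x)) = (LINT x:ball (0::'a) R|lborel. g \<bullet> x)" by simp
  moreover have "(LINT x:ball (0::'a) R|lborel. - (g \<bullet> x)) = - (LINT x:ball (0::'a) R|lborel. g \<bullet> x)"
    by (rule set_integral_uminus) (auto intro!: set_integrable_ball continuous_intros)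
  ultimately show ?thesis by simp
qed

lemma integral_ball_quadratic:
  fixes H :: "real ^ 'm ^ 'm"
  assumes "R \<ge> 0"
  shows "(LINT x:ball (0::real^'m) R|lborel. (H *v x) \<bullet> x) = R\<^sup>2 / (real CARD('m) + 2) * trace H * measure lborel (ball (0::real^'m) R)"
proof -
  let ?c = "R\<^sup>2 / (real CARD('m) + 2) * measure lborel (ball (0::real^'m) R)"
  have mom: "(LINT x:ball (0::real^'m) R|lborel. x $ i * x $ j) = (if i = j then ?c else 0)" for i j
    using integral_ball_coordinates[of "axis i 1 :: real^'m" "axis j 1" R] assms
    by (simp add: inner_axis axis_eq_axis)
  have ex: "(H *v x) \<bullet> x = (\<Sum>i\<in>UNIV. \<Sum>j\<in>UNIV. H $ i $ j * (x $ i * x $ j))" for x :: "real^'m"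
    by (simp add: inner_vec_def matrix_vector_mult_def sum_distrib_left sum_distrib_right mult_ac)
  have int: "integrable lborel (\<lambda>x::real^'m. indicator (ball 0 R) x *\<^sub>R (H $ i $ j * (x $ i * x $ j)))" for i j
    by (rule set_integrable_ball[unfolded set_integrable_def]) (intro continuous_intros)
  have "(LINT x:ball (0::real^'m) R|lborel. (H *v x) \<bullet> x)
      = (\<Sum>i\<in>UNIV. \<Sum>j\<in>UNIV. LINT x:ball (0::real^'m) R|lborel. H $ i $ j * (x $ i * x $ j))"
    unfolding ex set_lebesgue_integral_def scaleR_sum_right
    using int by (simp only: Bochner_Integration.integral_sum Bochner_Integration.integrable_sum)
  also have "\<dots> = (\<Sum>i\<in>UNIV. \<Sum>j\<in>UNIV. H $ i $ j * (if i = j then ?c else 0))"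
    by (simp only: set_integral_mult_right mom)
  also have "\<dots> = (\<Sum>i\<in>UNIV. H $ i $ i * ?c)"
    by (intro sum.cong refl) (simp add: if_distrib sum.delta' cong: if_cong)
  finally show ?thesis by (simp add: trace_def sum_distrib_left sum_distrib_right mult_ac flip: sum_divide_distrib)
qed

section \<open>Supremum, infimum and average over small balls\<close>

lemma uminus_matrix_vector_mult: "(- S) *v x = - (S *v (x :: real ^ 'm))"
  by (simp add: matrix_vector_mult_def vec_eq_iff sum_negf)

lemma scaleR_matrix_vector_mult: "(c *\<^sub>R S) *v x = c *\<^sub>R (S *v (x :: real ^ 'm))"
  by (simp add: matrix_vector_mult_def vec_eq_iff sum_distrib_left mult.assoc)

lemma matrix_bilinear_bound:
  fixes H :: "real ^ 'm ^ 'm"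
  obtains C where "C \<ge> 0" "\<And>x y. \<bar>(H *v x) \<bullet> y\<bar> \<le> C * norm x * norm y"
proof (rule that[of "onorm ((*v) H)"])
  have bl: "bounded_linear ((*v) H)" by (simp add: linear_linear)
  then show "0 \<le> onorm ((*v) H)" by (rule onorm_pos_le)
  fix x y :: "real ^ 'm"
  have "\<bar>(H *v x) \<bullet> y\<bar> \<le> norm (H *v x) * norm y" by (rule Cauchy_Schwarz_ineq2)
  also have "\<dots> \<le> onorm ((*v) H) * norm x * norm y"
    using onorm[OF bl, of x] by (simp add: mult_right_mono)
  finally show "\<bar>(H *v x) \<bullet> y\<bar> \<le> onorm ((*v) H) * norm x * norm y" .
qed

text \<open>
  For \<open>k = \<epsilon> y\<close> and \<open>n = g/|g|\<close> the linear term loses at least \<open>\<epsilon>|g||y - n|\<^sup>2/2\<close> against its maximum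
  \<open>\<epsilon>|g|\<close>, because \<open>n \<bullet> y \<le> 1 - |y - n|\<^sup>2/2\<close> on the unit ball, while the quadratic term gains at most
  \<open>\<epsilon>\<^sup>2 C |y - n|\<close> over its value in direction \<open>n\<close>. The best balance of the two is of order \<open>\<epsilon>\<^sup>3\<close>.
\<close>
lemma quadratic_on_ball_le:
  fixes g k :: "real ^ 'm" and H :: "real ^ 'm ^ 'm"
  assumes C: "C \<ge> 0" "\<And>x y. \<bar>(H *v x) \<bullet> y\<bar> \<le> C * norm x * norm y"
    and g: "g \<noteq> 0" and \<epsilon>: "\<epsilon> > 0" and k: "norm k \<le> \<epsilon>"
  shows "g \<bullet> k + (H *v k) \<bullet> k / 2 \<le>
    \<epsilon> * norm g + \<epsilon>\<^sup>2 / 2 * (((H *v g) \<bullet> g) / (norm g)\<^sup>2) + \<epsilon> ^ 3 * C\<^sup>2 / (2 * norm g)"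
proof -
  define n where "n = (1 / norm g) *\<^sub>R g"
  define y where "y = (1 / \<epsilon>) *\<^sub>R k"
  define d where "d = norm (y - n)"
  have n: "norm n = 1" "g = norm g *\<^sub>R n" using g by (auto simp: n_def)
  have y: "norm y \<le> 1" "k = \<epsilon> *\<^sub>R y" using \<epsilon> k by (auto simp: y_def)
  have "d\<^sup>2 = norm y ^ 2 + 1 - 2 * (n \<bullet> y)"
    using n(1) by (simp add: d_def power2_norm_eq_inner inner_diff_left inner_diff_right inner_commute norm_eq_1)
  moreover have "(norm y)\<^sup>2 \<le> 1" using y by (simp add: power_le_one)
  ultimately have ny: "n \<bullet> y \<le> 1 - d\<^sup>2 / 2" by linarith
  have "(H *v y) \<bullet> y - (H *v n) \<bullet> n = (H *v (y - n)) \<bullet> y + (H *v n) \<bullet> (y - n)"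
    by (simp add: matrix_vector_mult_diff_distrib inner_diff_left inner_diff_right)
  also have "\<dots> \<le> C * d * norm y + C * norm n * d"
    using C(2)[of "y - n" y] C(2)[of n "y - n"] by (simp add: d_def)
  also have "\<dots> \<le> 2 * C * d"
    using y n C mult_left_mono[of "norm y" 1 "C * d"] by (simp add: d_def)
  finally have Hy: "(H *v y) \<bullet> y \<le> (H *v n) \<bullet> n + 2 * C * d" by simp
  have Hn: "(H *v n) \<bullet> n = ((H *v g) \<bullet> g) / (norm g)\<^sup>2"
    by (simp add: n_def matrix_vector_mult_scaleR power2_eq_square)
  have sq: "\<epsilon>\<^sup>2 * C * d - \<epsilon> * norm g * d\<^sup>2 / 2 \<le> \<epsilon> ^ 3 * C\<^sup>2 / (2 * norm g)"
  proof -
    have "0 \<le> \<epsilon> / (2 * norm g) * (norm g * d - \<epsilon> * C)\<^sup>2" using \<epsilon> by simp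
    also have "\<dots> = \<epsilon> ^ 3 * C\<^sup>2 / (2 * norm g) - (\<epsilon>\<^sup>2 * C * d - \<epsilon> * norm g * d\<^sup>2 / 2)"
      using g by (simp add: power2_eq_square power3_eq_cube field_simps)
    finally show ?thesis by simp
  qed
  have "g \<bullet> k = \<epsilon> * norm g * (n \<bullet> y)" by (subst n(2), subst y(2)) simp
  also have "\<dots> \<le> \<epsilon> * norm g * (1 - d\<^sup>2 / 2)" using ny \<epsilon> by (intro mult_left_mono) auto
  finally have 1: "g \<bullet> k \<le> \<epsilon> * norm g * (1 - d\<^sup>2 / 2)" .
  have "(H *v k) \<bullet> k / 2 = \<epsilon>\<^sup>2 / 2 * ((H *v y) \<bullet> y)"
    by (subst (1 2) y(2)) (simp add: matrix_vector_mult_scaleR power2_eq_square)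
  also have "\<dots> \<le> \<epsilon>\<^sup>2 / 2 * ((H *v n) \<bullet> n + 2 * C * d)" using Hy by (intro mult_left_mono) auto
  finally have 2: "(H *v k) \<bullet> k / 2 \<le> \<epsilon>\<^sup>2 / 2 * ((H *v n) \<bullet> n + 2 * C * d)" .
  have 3: "\<epsilon>\<^sup>2 / 2 * (I + 2 * C * d) = \<epsilon>\<^sup>2 / 2 * I + \<epsilon>\<^sup>2 * C * d" for I
    by (simp add: algebra_simps)
  have 4: "\<epsilon> * norm g * (1 - d\<^sup>2 / 2) = \<epsilon> * norm g - \<epsilon> * norm g * d\<^sup>2 / 2"
    by (simp add: algebra_simps)
  show ?thesis using 1 2 sq unfolding Hn 3 4 by linarith
qed

text \<open>
  To second order the supremum is attained in the gradient direction. The point \<open>X + \<epsilon> n\<close> lies on the boundary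
  of the open ball, so the lower bound is obtained along \<open>X + s n\<close> for \<open>s < \<epsilon>\<close> and \<open>s\<close> tending to \<open>\<epsilon>\<close>.
\<close>
lemma SUP_ball_expansion:
  fixes g :: "real ^ 'm" and H :: "real ^ 'm ^ 'm" and h :: "real ^ 'm \<Rightarrow> real"
  assumes C: "C \<ge> 0" "\<And>x y. \<bar>(H *v x) \<bullet> y\<bar> \<le> C * norm x * norm y"
    and g: "g \<noteq> 0" and \<epsilon>: "\<epsilon> > 0"
    and h: "\<And>k. norm k < \<epsilon> \<Longrightarrow> \<bar>h (X + k) - (a + g \<bullet> k + (H *v k) \<bullet> k / 2)\<bar> \<le> \<theta>"
  shows "\<bar>(SUP x\<in>ball X \<epsilon>. h x) - (a + \<epsilon> * norm g + \<epsilon>\<^sup>2 / 2 * (((H *v g) \<bullet> g) / (norm g)\<^sup>2))\<bar>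
    \<le> \<theta> + \<epsilon> ^ 3 * C\<^sup>2 / (2 * norm g)"
proof -
  define I where "I = ((H *v g) \<bullet> g) / (norm g)\<^sup>2"
  define U where "U = a + \<epsilon> * norm g + \<epsilon>\<^sup>2 / 2 * I + \<epsilon> ^ 3 * C\<^sup>2 / (2 * norm g) + \<theta>"
  have ub: "h x \<le> U" if "x \<in> ball X \<epsilon>" for x
  proof -
    have k: "norm (x - X) < \<epsilon>" using that by (simp add: dist_norm norm_minus_commute)
    show ?thesis
      using h[OF k] quadratic_on_ball_le[OF C g \<epsilon>, of "x - X"] k by (simp add: U_def I_def)
  qed
  have bdd: "bdd_above (h ` ball X \<epsilon>)" using ub by (auto intro!: bdd_aboveI2)
  have up: "(SUP x\<in>ball X \<epsilon>. h x) \<le> U" using \<epsilon> by (intro cSUP_least ub) auto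
  define n where "n = (1 / norm g) *\<^sub>R g"
  have n: "norm n = 1" "g \<bullet> n = norm g" "(H *v n) \<bullet> n = I"
    using g by (auto simp: n_def I_def matrix_vector_mult_scaleR power2_eq_square dot_square_norm)
  have low: "a + s * norm g + s\<^sup>2 / 2 * I - \<theta> \<le> (SUP x\<in>ball X \<epsilon>. h x)" if s: "0 < s" "s < \<epsilon>" for s
  proof -
    have k: "norm (s *\<^sub>R n) < \<epsilon>" using n s by simp
    have "a + s * norm g + s\<^sup>2 / 2 * I - \<theta> \<le> h (X + s *\<^sub>R n)"
      using h[OF k] n by (simp add: matrix_vector_mult_scaleR power2_eq_square)
    also have "\<dots> \<le> (SUP x\<in>ball X \<epsilon>. h x)"
      by (rule cSUP_upper[OF _ bdd]) (use k in \<open>simp add: dist_norm\<close>)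
    finally show ?thesis .
  qed
  have "((\<lambda>s. a + s * norm g + s\<^sup>2 / 2 * I - \<theta>) \<longlongrightarrow> a + \<epsilon> * norm g + \<epsilon>\<^sup>2 / 2 * I - \<theta>) (at_left \<epsilon>)"
    by (intro tendsto_intros) simp
  moreover have "\<forall>\<^sub>F s in at_left \<epsilon>. a + s * norm g + s\<^sup>2 / 2 * I - \<theta> \<le> (SUP x\<in>ball X \<epsilon>. h x)"
    using eventually_at_left_real[OF \<epsilon>] by eventually_elim (use low in auto)
  ultimately have lo: "a + \<epsilon> * norm g + \<epsilon>\<^sup>2 / 2 * I - \<theta> \<le> (SUP x\<in>ball X \<epsilon>. h x)"
    by (rule tendsto_upperbound) simp
  have "\<epsilon> ^ 3 * C\<^sup>2 / (2 * norm g) \<ge> 0" using \<epsilon> by simp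
  with lo up show ?thesis unfolding U_def I_def[symmetric] by linarith
qed

lemma INF_eq_uminus_SUP:
  fixes h :: "'a \<Rightarrow> real"
  shows "(INF x\<in>A. h x) = - (SUP x\<in>A. - h x)"
  by (simp add: Inf_real_def image_image)

text \<open>
  The infimum is minus the supremum of \<open>- h\<close>. The first order terms \<open>\<plusminus>\<epsilon>|g|\<close> cancel in the sum and the two
  second order terms add up to the normalized infinity Laplacian.
\<close>
lemma midrange_ball_expansion:
  fixes g :: "real ^ 'm" and H :: "real ^ 'm ^ 'm" and h :: "real ^ 'm \<Rightarrow> real"
  assumes C: "C \<ge> 0" "\<And>x y. \<bar>(H *v x) \<bullet> y\<bar> \<le> C * norm x * norm y"
    and g: "g \<noteq> 0" and \<epsilon>: "\<epsilon> > 0"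
    and h: "\<And>k. norm k < \<epsilon> \<Longrightarrow> \<bar>h (X + k) - (a + g \<bullet> k + (H *v k) \<bullet> k / 2)\<bar> \<le> \<theta>"
  shows "\<bar>(SUP x\<in>ball X \<epsilon>. h x) + (INF x\<in>ball X \<epsilon>. h x) - (2 * a + \<epsilon>\<^sup>2 * (((H *v g) \<bullet> g) / (norm g)\<^sup>2))\<bar>
    \<le> 2 * \<theta> + \<epsilon> ^ 3 * C\<^sup>2 / norm g"
proof -
  have C': "\<bar>((- H) *v x) \<bullet> y\<bar> \<le> C * norm x * norm y" for x y using C(2) by (simp add: uminus_matrix_vector_mult)
  have h': "\<bar>- h (X + k) - (- a + (- g) \<bullet> k + ((- H) *v k) \<bullet> k / 2)\<bar> \<le> \<theta>" if "norm k < \<epsilon>" for k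
    using h[OF that] by (simp add: uminus_matrix_vector_mult)
  have g': "- g \<noteq> 0" using g by simp
  have e: "\<epsilon> ^ 3 * C\<^sup>2 / norm g = \<epsilon> ^ 3 * C\<^sup>2 / (2 * norm g) + \<epsilon> ^ 3 * C\<^sup>2 / (2 * norm g)" by simp
  have f: "((- H) *v (- g)) \<bullet> (- g) / (norm g)\<^sup>2 = - (((H *v g) \<bullet> g) / (norm g)\<^sup>2)"
    by (simp add: uminus_matrix_vector_mult linear_neg[OF matrix_vector_mul_linear])
  have 1: "\<bar>(SUP x\<in>ball X \<epsilon>. h x) - (a + \<epsilon> * norm g + \<epsilon>\<^sup>2 / 2 * (((H *v g) \<bullet> g) / (norm g)\<^sup>2))\<bar>
      \<le> \<theta> + \<epsilon> ^ 3 * C\<^sup>2 / (2 * norm g)"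
    by (rule SUP_ball_expansion[OF C g \<epsilon>]) (rule h)
  have 2: "\<bar>(SUP x\<in>ball X \<epsilon>. - h x) - (- a + \<epsilon> * norm (- g) + \<epsilon>\<^sup>2 / 2 * (((- H) *v (- g)) \<bullet> (- g) / (norm (- g))\<^sup>2))\<bar>
      \<le> \<theta> + \<epsilon> ^ 3 * C\<^sup>2 / (2 * norm (- g))"
    by (rule SUP_ball_expansion[OF C(1) C' g' \<epsilon>]) (rule h')
  have d: "2 * a + \<epsilon>\<^sup>2 * I = (a + \<epsilon> * norm g + \<epsilon>\<^sup>2 / 2 * I) - (- a + \<epsilon> * norm g + \<epsilon>\<^sup>2 / 2 * (- I))" for I
    by simp
  show ?thesis
    using 1 2 unfolding norm_minus_cancel f INF_eq_uminus_SUP[of h] e d by linarith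
qed

lemma SUP_INF_ball_close:
  fixes h :: "real ^ 'm \<Rightarrow> real"
  assumes "\<epsilon> > 0" "\<And>k. norm k < \<epsilon> \<Longrightarrow> \<bar>h (X + k) - a\<bar> \<le> \<theta>"
  shows "\<bar>(SUP x\<in>ball X \<epsilon>. h x) + (INF x\<in>ball X \<epsilon>. h x) - 2 * a\<bar> \<le> 2 * \<theta>"
proof -
  have b: "\<bar>h x - a\<bar> \<le> \<theta>" if "x \<in> ball X \<epsilon>" for x
    using assms(2)[of "x - X"] that by (simp add: dist_norm norm_minus_commute)
  have bd: "h x \<le> a + \<theta> \<and> a - \<theta> \<le> h x" if "x \<in> ball X \<epsilon>" for x using b[OF that] by linarith
  have X: "X \<in> ball X \<epsilon>" using assms by simp
  have bdd: "bdd_above (h ` ball X \<epsilon>)" "bdd_below (h ` ball X \<epsilon>)"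
    using bd by (auto intro!: bdd_aboveI2[where M = "a + \<theta>"] bdd_belowI2[where m = "a - \<theta>"])
  have "(SUP x\<in>ball X \<epsilon>. h x) \<le> a + \<theta>" "(INF x\<in>ball X \<epsilon>. h x) \<ge> a - \<theta>"
    using X bd by (auto intro!: cSUP_least cINF_greatest)
  moreover have "(SUP x\<in>ball X \<epsilon>. h x) \<ge> h X" "(INF x\<in>ball X \<epsilon>. h x) \<le> h X"
    using X bdd by (auto intro!: cSUP_upper cINF_lower)
  ultimately show ?thesis using bd[OF X] by linarith
qed

text \<open>
  The linear term averages to zero by symmetry, and the second moments of the ball turn the Hessian into its
  trace.
\<close>
lemma average_ball_expansion:
  fixes g :: "real ^ 'm" and H :: "real ^ 'm ^ 'm" and h :: "real ^ 'm \<Rightarrow> real"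
  assumes \<epsilon>: "\<epsilon> > 0" and cont: "continuous_on (cball X \<epsilon>) h"
    and h: "\<And>k. norm k < \<epsilon> \<Longrightarrow> \<bar>h (X + k) - (a + g \<bullet> k + (H *v k) \<bullet> k / 2)\<bar> \<le> \<theta>"
  shows "\<bar>(LINT x:ball X \<epsilon>|lborel. h x) / measure lborel (ball X \<epsilon>) - (a + \<epsilon>\<^sup>2 / (2 * (real CARD('m) + 2)) * trace H)\<bar> \<le> \<theta>"
proof -
  define V where "V = measure lborel (ball X \<epsilon>)"
  have V0: "V = measure lborel (ball (0::real^'m) \<epsilon>)"
    using content_ball_conv_unit_ball[of \<epsilon> X] content_ball_conv_unit_ball[of \<epsilon> "0::real^'m"] \<epsilon>
    by (simp add: V_def)
  have Vpos: "V > 0" using \<epsilon> by (simp add: V_def content_ball_pos)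
  define P where "P x = a + g \<bullet> (x - X) + (H *v (x - X)) \<bullet> (x - X) / 2" for x
  have cH: "continuous_on S (\<lambda>x. H *v (f x))" if "continuous_on S f" for S and f :: "real^'m \<Rightarrow> real^'m"
    by (rule linear_continuous_on_compose[OF that]) simp
  have cP: "continuous_on S P" for S
    unfolding P_def[abs_def] by (intro continuous_intros cH) simp
  have ih: "set_integrable lborel (ball X \<epsilon>) h" and iP: "set_integrable lborel (ball X \<epsilon>) P"
    by (intro set_integrable_ball cont cP)+
  have shift: "(LINT x:ball X \<epsilon>|lborel. f x) = (LINT k:ball (0::real^'m) \<epsilon>|lborel. f (X + k))"
    if "continuous_on UNIV f" for f :: "real^'m \<Rightarrow> real"
  proof -
    have [measurable]: "f \<in> borel_measurable borel" using that by (rule borel_measurable_continuous_onI)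
    have [measurable]: "ball X \<epsilon> \<in> sets borel" by simp
    have m: "(\<lambda>x. indicator (ball X \<epsilon>) x *\<^sub>R f x) \<in> borel_measurable borel" by measurable
    have "(LINT x:ball X \<epsilon>|lborel. f x) = (LINT x|distr lborel borel ((+) X). indicator (ball X \<epsilon>) x *\<^sub>R f x)"
      by (simp add: lborel_distr_plus set_lebesgue_integral_def)
    also have "\<dots> = (LINT k|lborel. indicator (ball X \<epsilon>) (X + k) *\<^sub>R f (X + k))"
      by (rule integral_distr) (use m in auto)
    finally show ?thesis by (simp add: set_lebesgue_integral_def indicator_def dist_norm)
  qed
  have IP: "(LINT x:ball X \<epsilon>|lborel. P x) = (a + \<epsilon>\<^sup>2 / (2 * (real CARD('m) + 2)) * trace H) * V"
  proof -
    have "(LINT x:ball X \<epsilon>|lborel. P x) = (LINT k:ball (0::real^'m) \<epsilon>|lborel. a + g \<bullet> k + (H *v k) \<bullet> k / 2)"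
      using shift[OF cP] by (simp add: P_def)
    also have "\<dots> = (LINT k:ball (0::real^'m) \<epsilon>|lborel. a) + (LINT k:ball (0::real^'m) \<epsilon>|lborel. g \<bullet> k) + (LINT k:ball (0::real^'m) \<epsilon>|lborel. (H *v k) \<bullet> k / 2)"
    proof -
      have i: "set_integrable lborel (ball (0::real^'m) \<epsilon>) (\<lambda>k. a)" "set_integrable lborel (ball (0::real^'m) \<epsilon>) (\<lambda>k. g \<bullet> k)"
        "set_integrable lborel (ball (0::real^'m) \<epsilon>) (\<lambda>k. (H *v k) \<bullet> k / 2)"
        by (intro set_integrable_ball continuous_intros cH; simp)+
      show ?thesis
        using set_integral_add(2)[OF set_integral_add(1)[OF i(1,2)] i(3)] set_integral_add(2)[OF i(1,2)] by simp
    qed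
    also have "\<dots> = (a + \<epsilon>\<^sup>2 / (2 * (real CARD('m) + 2)) * trace H) * V"
      using \<epsilon> integral_ball_quadratic[of \<epsilon> H]
      by (simp add: set_integral_const_ball integral_ball_linear V0 field_simps)
    finally show ?thesis .
  qed
  have bnd: "h x - P x \<le> \<theta> \<and> - \<theta> \<le> h x - P x" if "x \<in> ball X \<epsilon>" for x
    using h[of "x - X"] that by (simp add: P_def dist_norm norm_minus_commute abs_le_iff)
  have ic: "set_integrable lborel (ball X \<epsilon>) (\<lambda>_. c)" for c :: real
    by (intro set_integrable_ball continuous_intros)
  have id: "set_integrable lborel (ball X \<epsilon>) (\<lambda>x. h x - P x)" using ih iP by simp
  have "(LINT x:ball X \<epsilon>|lborel. h x - P x) \<le> (LINT x:ball X \<epsilon>|lborel. \<theta>)"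
    by (rule set_integral_mono[OF id ic]) (use bnd in auto)
  moreover have "(LINT x:ball X \<epsilon>|lborel. - \<theta>) \<le> (LINT x:ball X \<epsilon>|lborel. h x - P x)"
    by (rule set_integral_mono[OF ic id]) (use bnd in auto)
  moreover have "(LINT x:ball X \<epsilon>|lborel. h x - P x) = (LINT x:ball X \<epsilon>|lborel. h x) - (LINT x:ball X \<epsilon>|lborel. P x)"
    using ih iP by (rule set_integral_diff(2))
  ultimately have "\<bar>(LINT x:ball X \<epsilon>|lborel. h x) - (a + \<epsilon>\<^sup>2 / (2 * (real CARD('m) + 2)) * trace H) * V\<bar> \<le> \<theta> * V"
    unfolding IP set_integral_const_ball V_def[symmetric] by (simp add: abs_le_iff)
  moreover have "(LINT x:ball X \<epsilon>|lborel. h x) / V - (a + \<epsilon>\<^sup>2 / (2 * (real CARD('m) + 2)) * trace H)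
     = ((LINT x:ball X \<epsilon>|lborel. h x) - (a + \<epsilon>\<^sup>2 / (2 * (real CARD('m) + 2)) * trace H) * V) / V"
    using Vpos by (simp add: diff_divide_distrib)
  ultimately show ?thesis using Vpos
    unfolding V_def[symmetric] by (simp add: abs_divide pos_divide_le_eq)
qed

section \<open>Asymptotic expansion of the mean value operator\<close>

lemma blinfun_bilinear_bound:
  fixes B :: "'a::real_normed_vector \<Rightarrow>\<^sub>L 'a \<Rightarrow>\<^sub>L real"
  shows "\<bar>B x y\<bar> \<le> norm B * norm x * norm y"
proof -
  have "\<bar>B x y\<bar> \<le> norm (B x) * norm y" using norm_blinfun[of "B x" y] by simp
  also have "\<dots> \<le> norm B * norm x * norm y" using norm_blinfun[of B x] by (rule mult_right_mono) simp
  finally show ?thesis .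
qed

text \<open>
  The evaluation point moves by \<open>k\<close> in \<open>X\<close> and by \<open>O(\<epsilon>\<^sup>2)\<close> in \<open>(Y, t)\<close>. Hence, up to \<open>o(\<epsilon>\<^sup>2)\<close>, the
  variables \<open>(Y, t)\<close> enter only through first derivatives, and these combine to the transport term.
\<close>
lemma kinetic_shift_expansion:
  fixes \<phi> :: "'m::finite pt \<Rightarrow> real"
  assumes D: "open D" "(X, Y, t) \<in> D" "C2_on D \<phi>" and \<eta>: "\<eta> > 0"
  defines "z \<equiv> (X, Y, t)"
  shows "\<forall>\<^sub>F \<epsilon> in at_right 0. continuous_on (cball X \<epsilon>) (\<lambda>X'. \<phi> (X', Y + (\<epsilon>\<^sup>2 / 2) *\<^sub>R X', t - \<epsilon>\<^sup>2 / 2)) \<and>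
    (\<forall>k. norm k < \<epsilon> \<longrightarrow> \<bar>\<phi> (X + k, Y + (\<epsilon>\<^sup>2 / 2) *\<^sub>R (X + k), t - \<epsilon>\<^sup>2 / 2)
       - ((\<phi> z - \<epsilon>\<^sup>2 / 2 * transport \<phi> z) + grad_X \<phi> z \<bullet> k + (hess_X \<phi> z *v k) \<bullet> k / 2)\<bar> \<le> \<eta> * \<epsilon>\<^sup>2)"
proof -
  have z: "z \<in> D" using D by (simp add: z_def)
  obtain B :: "'m pt \<Rightarrow>\<^sub>L 'm pt \<Rightarrow>\<^sub>L real" where B: "\<And>v w. B v w = B w v"
    "\<And>k k'. B (k, 0, 0) (k', 0, 0) = (hess_X \<phi> z *v k) \<bullet> k'"
    "\<And>\<eta>. \<eta> > 0 \<Longrightarrow> \<exists>\<delta>>0. \<forall>v. norm v < \<delta> \<longrightarrow>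
       \<bar>\<phi> (z + v) - \<phi> z - (grad_X \<phi> z \<bullet> fst v + grad_Y \<phi> z \<bullet> fst (snd v) + deriv_t \<phi> z * snd (snd v)) - B v v / 2\<bar>
         \<le> \<eta> * (norm v)\<^sup>2"
    using C2_expansion[OF D(1) z D(3)] by metis
  define M where "M = norm X + 2"
  define K where "K = norm (grad_Y \<phi> z) + norm B * (M + M\<^sup>2)"
  have M: "M \<ge> 2" by (simp add: M_def)
  have K: "K \<ge> 0" using M by (simp add: K_def)
  define \<eta>1 where "\<eta>1 = \<eta> / (2 * (1 + M)\<^sup>2)"
  have \<eta>1: "\<eta>1 > 0" using \<eta> M by (simp add: \<eta>1_def)
  obtain \<delta> where \<delta>: "\<delta> > 0" "\<And>v. norm v < \<delta> \<Longrightarrow>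
       \<bar>\<phi> (z + v) - \<phi> z - (grad_X \<phi> z \<bullet> fst v + grad_Y \<phi> z \<bullet> fst (snd v) + deriv_t \<phi> z * snd (snd v)) - B v v / 2\<bar>
         \<le> \<eta>1 * (norm v)\<^sup>2" using B(3)[OF \<eta>1] by blast
  obtain e where e: "e > 0" "ball z e \<subseteq> D" using D(1) z open_contains_ball by blast
  \<comment> \<open>Radii up to \<open>\<epsilon>0\<close> keep the shifted points in the range of the Taylor estimate and inside \<open>D\<close>,
    and let the cubic error \<open>K \<epsilon>\<^sup>3\<close> stay below \<open>\<eta> \<epsilon>\<^sup>2/2\<close>.\<close>
  define \<epsilon>0 where "\<epsilon>0 = min (min 1 (\<eta> / (2 * (K + 1)))) (min \<delta> e / (1 + M))"
  have \<epsilon>0: "\<epsilon>0 > 0" using \<eta> K M \<delta> e by (simp add: \<epsilon>0_def)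
  have contD: "continuous_on D \<phi>"
  proof -
    from D(3) obtain f' where "\<forall>x\<in>D. (\<phi> has_derivative blinfun_apply (f' x)) (at x)" unfolding C2_on_def by blast
    then show ?thesis by (auto intro!: continuous_at_imp_continuous_on dest!: bspec has_derivative_continuous)
  qed
  have main: "continuous_on (cball X \<epsilon>) (\<lambda>X'. \<phi> (X', Y + (\<epsilon>\<^sup>2 / 2) *\<^sub>R X', t - \<epsilon>\<^sup>2 / 2)) \<and>
    (\<forall>k. norm k < \<epsilon> \<longrightarrow> \<bar>\<phi> (X + k, Y + (\<epsilon>\<^sup>2 / 2) *\<^sub>R (X + k), t - \<epsilon>\<^sup>2 / 2)
       - ((\<phi> z - \<epsilon>\<^sup>2 / 2 * transport \<phi> z) + grad_X \<phi> z \<bullet> k + (hess_X \<phi> z *v k) \<bullet> k / 2)\<bar> \<le> \<eta> * \<epsilon>\<^sup>2)"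
    if \<epsilon>: "0 < \<epsilon>" "\<epsilon> < \<epsilon>0" for \<epsilon>
  proof -
    have \<epsilon>1: "\<epsilon> \<le> 1" and \<epsilon>K: "\<epsilon> * K \<le> \<eta> / 2" and \<epsilon>M: "\<epsilon> * (1 + M) < min \<delta> e"
    proof -
      show "\<epsilon> \<le> 1" using \<epsilon> by (simp add: \<epsilon>0_def)
      have "\<epsilon> < \<eta> / (2 * (K + 1))" "\<epsilon> < min \<delta> e / (1 + M)" using \<epsilon> by (auto simp: \<epsilon>0_def)
      then show "\<epsilon> * K \<le> \<eta> / 2" "\<epsilon> * (1 + M) < min \<delta> e" using K M \<epsilon> by (simp_all add: field_simps)
    qed
    have sq: "\<epsilon>\<^sup>2 \<le> \<epsilon>" using \<epsilon> \<epsilon>1 by (simp add: power2_eq_square mult_left_le)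
    define w where "w k = (0 :: real^'m, (\<epsilon>\<^sup>2 / 2) *\<^sub>R (X + k), - (\<epsilon>\<^sup>2 / 2))" for k
    define v where "v k = (k, 0, 0) + w k" for k
    have nw: "norm (w k) \<le> \<epsilon>\<^sup>2 * M" if "norm k \<le> \<epsilon>" for k
    proof -
      have "norm (w k) \<le> norm ((\<epsilon>\<^sup>2 / 2) *\<^sub>R (X + k)) + norm (- (\<epsilon>\<^sup>2 / 2))"
        unfolding w_def using norm_Pair_le by (metis (no_types) add_0 norm_zero order.trans)
      also have "\<dots> = \<epsilon>\<^sup>2 / 2 * (norm (X + k) + 1)" by (simp add: distrib_left del: scaleR_add_right)
      also have "\<dots> \<le> \<epsilon>\<^sup>2 * M"
      proof -
        have "norm (X + k) + 1 \<le> M" using norm_triangle_ineq[of X k] that \<epsilon>1 by (simp add: M_def)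
        then have "\<epsilon>\<^sup>2 / 2 * (norm (X + k) + 1) \<le> \<epsilon>\<^sup>2 / 2 * M" by (intro mult_left_mono) auto
        also have "\<dots> \<le> \<epsilon>\<^sup>2 * M" using M by (simp add: mult_right_mono)
        finally show ?thesis .
      qed
      finally show ?thesis .
    qed
    have nv: "norm (v k) \<le> \<epsilon> * (1 + M)" if "norm k \<le> \<epsilon>" for k
    proof -
      have "norm (v k) \<le> norm k + norm (w k)"
        unfolding v_def using norm_triangle_ineq[of "(k, 0, 0)" "w k"] by (simp add: norm_Pair)
      also have "\<dots> \<le> \<epsilon> + \<epsilon> * M"
      proof -
        have "\<epsilon>\<^sup>2 * M \<le> \<epsilon> * M" using sq M by (intro mult_right_mono) auto
        then show ?thesis using that nw[OF that] by linarith
      qed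
      finally show ?thesis by (simp add: algebra_simps)
    qed
    have zv: "z + v k = (X + k, Y + (\<epsilon>\<^sup>2 / 2) *\<^sub>R (X + k), t - \<epsilon>\<^sup>2 / 2)" for k
      by (simp add: z_def v_def w_def)
    have inD: "z + v k \<in> D" if "norm k \<le> \<epsilon>" for k
      using e(2) nv[OF that] \<epsilon>M by (force simp: dist_norm)
    have "continuous_on (cball X \<epsilon>) (\<lambda>X'. \<phi> (X', Y + (\<epsilon>\<^sup>2 / 2) *\<^sub>R X', t - \<epsilon>\<^sup>2 / 2))"
    proof (rule continuous_on_compose2[OF contD])
      show "(\<lambda>X'. (X', Y + (\<epsilon>\<^sup>2 / 2) *\<^sub>R X', t - \<epsilon>\<^sup>2 / 2)) ` cball X \<epsilon> \<subseteq> D"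
      proof clarify
        fix X' assume "X' \<in> cball X \<epsilon>"
        then show "(X', Y + (\<epsilon>\<^sup>2 / 2) *\<^sub>R X', t - \<epsilon>\<^sup>2 / 2) \<in> D"
          using inD[of "X' - X"] by (simp add: zv dist_norm norm_minus_commute)
      qed
    qed (intro continuous_intros)
    moreover have "\<bar>\<phi> (X + k, Y + (\<epsilon>\<^sup>2 / 2) *\<^sub>R (X + k), t - \<epsilon>\<^sup>2 / 2)
       - ((\<phi> z - \<epsilon>\<^sup>2 / 2 * transport \<phi> z) + grad_X \<phi> z \<bullet> k + (hess_X \<phi> z *v k) \<bullet> k / 2)\<bar> \<le> \<eta> * \<epsilon>\<^sup>2"
      if "norm k < \<epsilon>" for k
    proof -
      have k: "norm k \<le> \<epsilon>" using that by simp
      define E where "E = \<phi> (z + v k) - \<phi> z - (grad_X \<phi> z \<bullet> fst (v k) + grad_Y \<phi> z \<bullet> fst (snd (v k))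
          + deriv_t \<phi> z * snd (snd (v k))) - B (v k) (v k) / 2"
      have E: "\<bar>E\<bar> \<le> \<eta> / 2 * \<epsilon>\<^sup>2"
      proof -
        have "\<bar>E\<bar> \<le> \<eta>1 * (norm (v k))\<^sup>2" unfolding E_def
          by (rule \<delta>(2)) (use nv[OF k] \<epsilon>M in simp)
        also have "\<dots> \<le> \<eta>1 * (\<epsilon> * (1 + M))\<^sup>2"
          using nv[OF k] \<eta>1 by (intro mult_left_mono power_mono) auto
        also have "\<dots> = \<eta> / 2 * \<epsilon>\<^sup>2" using M by (simp add: \<eta>1_def power_mult_distrib)
        finally show ?thesis .
      qed
      have B1: "B (v k) (v k) = (hess_X \<phi> z *v k) \<bullet> k + 2 * B (k, 0, 0) (w k) + B (w k) (w k)"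
        by (simp add: v_def blinfun.add_left blinfun.add_right B(2) B(1)[of "w k" "(k, 0, 0)"])
      have n0: "norm (k, 0::real^'m, 0::real) \<le> \<epsilon>" using k by (simp add: norm_Pair)
      have "\<bar>B (k, 0, 0) (w k)\<bar> \<le> norm B * \<epsilon> * (\<epsilon>\<^sup>2 * M)"
        using blinfun_bilinear_bound[of B "(k, 0, 0)" "w k"] mult_mono[OF mult_left_mono[OF n0, of "norm B"] nw[OF k]] \<epsilon> by fastforce
      then have B2: "\<bar>B (k, 0, 0) (w k)\<bar> \<le> \<epsilon> * \<epsilon>\<^sup>2 * (norm B * M)" by (simp add: mult_ac)
      have "\<bar>B (w k) (w k)\<bar> \<le> norm B * (\<epsilon>\<^sup>2 * M) * (\<epsilon>\<^sup>2 * M)"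
        using blinfun_bilinear_bound[of B "w k" "w k"] mult_mono[OF mult_left_mono[OF nw[OF k], of "norm B"] nw[OF k]] M by fastforce
      also have "\<dots> = \<epsilon>\<^sup>2 * (\<epsilon>\<^sup>2 * (norm B * M\<^sup>2))" by (simp add: power2_eq_square mult_ac)
      also have "\<dots> \<le> \<epsilon> * (\<epsilon>\<^sup>2 * (norm B * M\<^sup>2))" using sq by (intro mult_right_mono) auto
      finally have B3: "\<bar>B (w k) (w k)\<bar> \<le> \<epsilon> * \<epsilon>\<^sup>2 * (norm B * M\<^sup>2)" by (simp add: mult_ac)
      have "\<bar>grad_Y \<phi> z \<bullet> k\<bar> \<le> norm (grad_Y \<phi> z) * \<epsilon>"
        using Cauchy_Schwarz_ineq2[of "grad_Y \<phi> z" k] mult_left_mono[OF k, of "norm (grad_Y \<phi> z)"] by simp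
      then have "\<bar>\<epsilon>\<^sup>2 / 2 * (grad_Y \<phi> z \<bullet> k)\<bar> \<le> \<epsilon>\<^sup>2 / 2 * (norm (grad_Y \<phi> z) * \<epsilon>)"
        unfolding abs_mult by (intro mult_mono) auto
      also have "\<dots> \<le> \<epsilon> * \<epsilon>\<^sup>2 * norm (grad_Y \<phi> z)" using \<epsilon> by simp
      finally have G: "\<bar>\<epsilon>\<^sup>2 / 2 * (grad_Y \<phi> z \<bullet> k)\<bar> \<le> \<epsilon> * \<epsilon>\<^sup>2 * norm (grad_Y \<phi> z)" .
      have T: "grad_X \<phi> z \<bullet> fst (v k) + grad_Y \<phi> z \<bullet> fst (snd (v k)) + deriv_t \<phi> z * snd (snd (v k))
         = grad_X \<phi> z \<bullet> k - \<epsilon>\<^sup>2 / 2 * transport \<phi> z + \<epsilon>\<^sup>2 / 2 * (grad_Y \<phi> z \<bullet> k)"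
        by (simp add: v_def w_def transport_def z_def algebra_simps inner_add_right inner_commute)
      have "\<phi> (z + v k) - ((\<phi> z - \<epsilon>\<^sup>2 / 2 * transport \<phi> z) + grad_X \<phi> z \<bullet> k + (hess_X \<phi> z *v k) \<bullet> k / 2)
         = E + \<epsilon>\<^sup>2 / 2 * (grad_Y \<phi> z \<bullet> k) + B (k, 0, 0) (w k) + B (w k) (w k) / 2"
        unfolding E_def T B1 by (simp add: field_simps)
      also have "\<bar>\<dots>\<bar> \<le> \<eta> / 2 * \<epsilon>\<^sup>2 + \<epsilon> * \<epsilon>\<^sup>2 * norm (grad_Y \<phi> z) + \<epsilon> * \<epsilon>\<^sup>2 * (norm B * M) + \<epsilon> * \<epsilon>\<^sup>2 * (norm B * M\<^sup>2)"
        using E G B2 B3 by linarith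
      also have "\<dots> = \<eta> / 2 * \<epsilon>\<^sup>2 + (\<epsilon> * K) * \<epsilon>\<^sup>2" by (simp add: K_def algebra_simps)
      also have "\<dots> \<le> \<eta> / 2 * \<epsilon>\<^sup>2 + \<eta> / 2 * \<epsilon>\<^sup>2" by (intro add_left_mono mult_right_mono \<epsilon>K) simp
      also have "\<dots> = \<eta> * \<epsilon>\<^sup>2" by simp
      finally show ?thesis by (simp only: zv)
    qed
    ultimately show ?thesis by blast
  qed
  show ?thesis using eventually_at_right_real[OF \<epsilon>0] by eventually_elim (use main in auto)
qed

text \<open>
  The weights \<open>\<alpha>\<close> and \<open>\<beta>\<close> add up to one, so the constant and transport terms are reproduced exactly. At an
  admissible test function with vanishing gradient the Hessian vanishes as well and the value of \<open>inf_laplace_X\<close> there, a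
  division by zero, is \<open>0\<close>, which makes the formula uniform.
\<close>
lemma mean_value_op_expansion:
  fixes \<phi> :: "'m::finite pt \<Rightarrow> real"
  assumes D: "open D" "z \<in> D" "C2_on D \<phi>" and adm: "admissible_test \<phi> z" and \<eta>: "\<eta> > 0"
    and ab: "alpha CARD('m) p + beta CARD('m) p = 1"
  shows "\<forall>\<^sub>F \<epsilon> in at_right 0. \<bar>mean_value_op p \<epsilon> \<phi> z - \<phi> z - \<epsilon>\<^sup>2 / 2 *
     (alpha CARD('m) p * inf_laplace_X \<phi> z + beta CARD('m) p / (real CARD('m) + 2) * laplace_X \<phi> z - transport \<phi> z)\<bar> \<le> \<eta> * \<epsilon>\<^sup>2"
proof -
  obtain X Y t where z: "z = (X, Y, t)" by (cases z)
  define \<alpha> where "\<alpha> = alpha CARD('m) p"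
  define \<beta> where "\<beta> = beta CARD('m) p"
  define g where "g = grad_X \<phi> z"
  define H where "H = hess_X \<phi> z"
  define I where "I = inf_laplace_X \<phi> z"
  define h where "h \<epsilon> X' = \<phi> (X', Y + (\<epsilon>\<^sup>2 / 2) *\<^sub>R X', t - \<epsilon>\<^sup>2 / 2)" for \<epsilon> X'
  define a where "a \<epsilon> = \<phi> z - \<epsilon>\<^sup>2 / 2 * transport \<phi> z" for \<epsilon>
  define \<theta> where "\<theta> = \<eta> / (2 * (\<bar>\<alpha>\<bar> + \<bar>\<beta>\<bar> + 1))"
  have \<theta>: "\<theta> > 0" using \<eta> by (simp add: \<theta>_def add_nonneg_pos)
  have \<theta>\<eta>: "(\<bar>\<alpha>\<bar> + \<bar>\<beta>\<bar>) * \<theta> \<le> \<eta> / 2"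
  proof -
    have "(\<bar>\<alpha>\<bar> + \<bar>\<beta>\<bar>) * \<theta> \<le> (\<bar>\<alpha>\<bar> + \<bar>\<beta>\<bar> + 1) * \<theta>" using \<theta> by simp
    also have "\<dots> = \<eta> / 2"
    proof -
      have "\<bar>\<alpha>\<bar> + \<bar>\<beta>\<bar> + 1 \<noteq> 0" by linarith
      then show ?thesis unfolding \<theta>_def by (simp only: times_divide_eq_right mult.commute[of 2] nonzero_mult_divide_mult_cancel_left not_False_eq_True)
    qed
    finally show ?thesis .
  qed
  obtain K where K: "K \<ge> 0" "\<And>\<epsilon> X h a \<theta>. \<epsilon> > 0 \<Longrightarrow>
      (\<And>k. norm k < \<epsilon> \<Longrightarrow> \<bar>h (X + k) - (a + g \<bullet> k + (H *v k) \<bullet> k / 2)\<bar> \<le> \<theta>) \<Longrightarrow>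
      \<bar>(SUP x\<in>ball X \<epsilon>. h x) + (INF x\<in>ball X \<epsilon>. h x) - (2 * a + \<epsilon>\<^sup>2 * I)\<bar> \<le> 2 * \<theta> + \<epsilon> ^ 3 * K"
  proof (cases "g = 0")
    case True
    then have 0: "H = 0" "I = 0" using adm by (auto simp: admissible_test_def g_def H_def I_def inf_laplace_X_def)
    show ?thesis
    proof (rule that[of 0])
      fix \<epsilon> :: real and X :: "real^'m" and h and a \<theta> :: real
      assume "\<epsilon> > 0" "\<And>k. norm k < \<epsilon> \<Longrightarrow> \<bar>h (X + k) - (a + g \<bullet> k + (H *v k) \<bullet> k / 2)\<bar> \<le> \<theta>"
      then show "\<bar>(SUP x\<in>ball X \<epsilon>. h x) + (INF x\<in>ball X \<epsilon>. h x) - (2 * a + \<epsilon>\<^sup>2 * I)\<bar> \<le> 2 * \<theta> + \<epsilon> ^ 3 * 0"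
        using SUP_INF_ball_close[of \<epsilon> h X a \<theta>] True 0 by simp
    qed simp
  next
    case False
    obtain C where C: "C \<ge> 0" "\<And>x y. \<bar>(H *v x) \<bullet> y\<bar> \<le> C * norm x * norm y"
      using matrix_bilinear_bound[of H] by metis
    show ?thesis
    proof (rule that[of "C\<^sup>2 / norm g"])
      fix \<epsilon> :: real and X :: "real^'m" and h and a \<theta> :: real
      assume "\<epsilon> > 0" "\<And>k. norm k < \<epsilon> \<Longrightarrow> \<bar>h (X + k) - (a + g \<bullet> k + (H *v k) \<bullet> k / 2)\<bar> \<le> \<theta>"
      from midrange_ball_expansion[OF C False this]
      show "\<bar>(SUP x\<in>ball X \<epsilon>. h x) + (INF x\<in>ball X \<epsilon>. h x) - (2 * a + \<epsilon>\<^sup>2 * I)\<bar> \<le> 2 * \<theta> + \<epsilon> ^ 3 * (C\<^sup>2 / norm g)"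
        by (simp add: I_def g_def H_def inf_laplace_X_def)
    qed (use C in simp)
  qed
  define \<epsilon>0 where "\<epsilon>0 = \<eta> / (\<bar>\<alpha>\<bar> * K + 1)"
  have \<epsilon>0: "\<epsilon>0 > 0" using \<eta> K by (simp add: \<epsilon>0_def add_nonneg_pos)
  show ?thesis
    using kinetic_shift_expansion[OF D(1) D(2)[unfolded z] D(3) \<theta>] eventually_at_right_real[OF \<epsilon>0]
  proof eventually_elim
    case (elim \<epsilon>)
    then have \<epsilon>: "0 < \<epsilon>" "\<epsilon> < \<epsilon>0" by auto
    have cont: "continuous_on (cball X \<epsilon>) (h \<epsilon>)" using elim by (simp add: h_def[abs_def])
    have hk: "\<bar>h \<epsilon> (X + k) - (a \<epsilon> + g \<bullet> k + (H *v k) \<bullet> k / 2)\<bar> \<le> \<theta> * \<epsilon>\<^sup>2" if "norm k < \<epsilon>" for k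
      using elim that by (simp add: h_def a_def g_def H_def z del: grad_X.simps hess_X.simps)
    define s where "s = (SUP x\<in>ball X \<epsilon>. h \<epsilon> x) + (INF x\<in>ball X \<epsilon>. h \<epsilon> x) - (2 * a \<epsilon> + \<epsilon>\<^sup>2 * I)"
    define r where "r = (LINT x:ball X \<epsilon>|lborel. h \<epsilon> x) / measure lborel (ball X \<epsilon>) - (a \<epsilon> + \<epsilon>\<^sup>2 / (2 * (real CARD('m) + 2)) * trace H)"
    have s: "\<bar>s\<bar> \<le> 2 * (\<theta> * \<epsilon>\<^sup>2) + \<epsilon> ^ 3 * K" unfolding s_def by (rule K(2)[OF \<epsilon>(1)]) (rule hk)
    have r: "\<bar>r\<bar> \<le> \<theta> * \<epsilon>\<^sup>2" unfolding r_def by (rule average_ball_expansion[OF \<epsilon>(1) cont]) (rule hk)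
    have "mean_value_op p \<epsilon> \<phi> z = \<alpha> / 2 * (s + (2 * a \<epsilon> + \<epsilon>\<^sup>2 * I)) + \<beta> * (r + (a \<epsilon> + \<epsilon>\<^sup>2 / (2 * (real CARD('m) + 2)) * trace H))"
      by (simp add: z s_def r_def \<alpha>_def \<beta>_def h_def)
    also have "\<dots> = (\<alpha> + \<beta>) * a \<epsilon> + \<epsilon>\<^sup>2 / 2 * (\<alpha> * I + \<beta> / (real CARD('m) + 2) * trace H) + (\<alpha> / 2 * s + \<beta> * r)"
      by (simp add: field_simps)
    finally have eq: "mean_value_op p \<epsilon> \<phi> z - \<phi> z - \<epsilon>\<^sup>2 / 2 *
       (\<alpha> * I + \<beta> / (real CARD('m) + 2) * trace H - transport \<phi> z) = \<alpha> / 2 * s + \<beta> * r"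
      using ab by (simp add: \<alpha>_def[symmetric] \<beta>_def[symmetric] a_def right_diff_distrib)
    have "\<bar>\<alpha> / 2 * s + \<beta> * r\<bar> \<le> \<bar>\<alpha>\<bar> / 2 * \<bar>s\<bar> + \<bar>\<beta>\<bar> * \<bar>r\<bar>"
      using abs_triangle_ineq[of "\<alpha> / 2 * s" "\<beta> * r"] by (simp add: abs_mult)
    also have "\<dots> \<le> \<bar>\<alpha>\<bar> / 2 * (2 * (\<theta> * \<epsilon>\<^sup>2) + \<epsilon> ^ 3 * K) + \<bar>\<beta>\<bar> * (\<theta> * \<epsilon>\<^sup>2)"
      using s r by (intro add_mono mult_left_mono) auto
    also have "\<dots> = ((\<bar>\<alpha>\<bar> + \<bar>\<beta>\<bar>) * \<theta> + \<epsilon> * (\<bar>\<alpha>\<bar> * K) / 2) * \<epsilon>\<^sup>2"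
      by (simp add: power2_eq_square power3_eq_cube field_simps)
    also have "\<dots> \<le> \<eta> * \<epsilon>\<^sup>2"
    proof (rule mult_right_mono)
      have "\<bar>\<alpha>\<bar> * K + 1 > 0" using K(1) by (simp add: add_nonneg_pos)
      then have "\<epsilon> * (\<bar>\<alpha>\<bar> * K + 1) \<le> \<eta>" using \<epsilon>(2) unfolding \<epsilon>0_def by (simp only: pos_less_divide_eq less_imp_le)
      then have "\<epsilon> * (\<bar>\<alpha>\<bar> * K) \<le> \<eta>" using \<epsilon> by (simp add: algebra_simps)
      then show "(\<bar>\<alpha>\<bar> + \<bar>\<beta>\<bar>) * \<theta> + \<epsilon> * (\<bar>\<alpha>\<bar> * K) / 2 \<le> \<eta>" using \<theta>\<eta> by linarith
    qed simp
    finally show ?case using eq by (simp add: \<alpha>_def \<beta>_def I_def H_def laplace_X_def)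
  qed
qed

text \<open>
  Dividing the expansion by \<open>\<epsilon>\<^sup>2\<close> turns the asymptotic inequality into the sign of its second order coefficient.
\<close>
lemma mean_value_inequality_iff:
  fixes \<phi> :: "'m::finite pt \<Rightarrow> real"
  assumes D: "open D" "z \<in> D" "C2_on D \<phi>" and adm: "admissible_test \<phi> z"
    and ab: "alpha CARD('m) p + beta CARD('m) p = 1"
  shows "(\<exists>r. r \<in> o[at_right 0](\<lambda>\<epsilon>::real. \<epsilon>\<^sup>2) \<and> (\<forall>\<^sub>F \<epsilon> in at_right 0. \<phi> z \<ge> mean_value_op p \<epsilon> \<phi> z + r \<epsilon>))
    \<longleftrightarrow> alpha CARD('m) p * inf_laplace_X \<phi> z + beta CARD('m) p / (real CARD('m) + 2) * laplace_X \<phi> z \<le> transport \<phi> z"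
    (is "?lhs \<longleftrightarrow> ?rhs")
proof -
  define L where "L = alpha CARD('m) p * inf_laplace_X \<phi> z + beta CARD('m) p / (real CARD('m) + 2) * laplace_X \<phi> z - transport \<phi> z"
  have exp: "\<forall>\<^sub>F \<epsilon> in at_right 0. \<bar>mean_value_op p \<epsilon> \<phi> z - \<phi> z - \<epsilon>\<^sup>2 / 2 * L\<bar> \<le> \<eta> * \<epsilon>\<^sup>2" if "\<eta> > 0" for \<eta>
    unfolding L_def by (rule mean_value_op_expansion[OF D adm that ab])
  have "?lhs \<longleftrightarrow> L \<le> 0"
  proof
    assume ?lhs
    then obtain r where r: "r \<in> o[at_right 0](\<lambda>\<epsilon>::real. \<epsilon>\<^sup>2)" "\<forall>\<^sub>F \<epsilon> in at_right 0. \<phi> z \<ge> mean_value_op p \<epsilon> \<phi> z + r \<epsilon>" by blast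
    show "L \<le> 0"
    proof (rule ccontr)
      assume "\<not> L \<le> 0"
      then have L8: "L / 8 > 0" by simp
      have "\<forall>\<^sub>F \<epsilon> in at_right (0::real). False"
        using exp[OF L8] landau_o.smallD[OF r(1) L8] r(2) eventually_at_right_less[of "0::real"]
      proof eventually_elim
        case (elim \<epsilon>)
        have "\<bar>r \<epsilon>\<bar> \<le> L / 8 * \<epsilon>\<^sup>2" using elim(2) by simp
        with elim(1,3) have "\<epsilon>\<^sup>2 / 2 * L \<le> L / 8 * \<epsilon>\<^sup>2 + L / 8 * \<epsilon>\<^sup>2" by linarith
        moreover have "\<epsilon>\<^sup>2 * L > 0" using elim L8 by simp
        ultimately show ?case by (simp add: mult.commute)
      qed
      then show False by simp
    qed
  next
    assume L: "L \<le> 0"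
    show ?lhs
    proof (intro exI conjI)
      define r where "r \<epsilon> = - (mean_value_op p \<epsilon> \<phi> z - \<phi> z - \<epsilon>\<^sup>2 / 2 * L)" for \<epsilon>
      show "r \<in> o[at_right 0](\<lambda>\<epsilon>::real. \<epsilon>\<^sup>2)"
      proof (rule landau_o.smallI)
        fix c :: real assume "c > 0"
        from exp[OF this] show "\<forall>\<^sub>F \<epsilon> in at_right 0. norm (r \<epsilon>) \<le> c * norm (\<epsilon>\<^sup>2)"
          unfolding r_def by eventually_elim simp
      qed
      show "\<forall>\<^sub>F \<epsilon> in at_right 0. \<phi> z \<ge> mean_value_op p \<epsilon> \<phi> z + r \<epsilon>"
        using L by (intro always_eventually) (simp add: r_def mult_nonneg_nonpos)
    qed
  qed
  then show ?thesis by (simp add: L_def)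
qed

section \<open>Extremal eigenvalues and the common form of the equations\<close>

text \<open>
  Perturbing the minimizer in the direction \<open>w = S n - l n\<close> changes \<open>(S x) \<bullet> x - l |x|\<^sup>2\<close>, which is
  nonnegative, by \<open>2 s |w|\<^sup>2 + O(s\<^sup>2)\<close>; this is impossible for small negative \<open>s\<close> unless \<open>w = 0\<close>.
\<close>
lemma eigenvector_of_rayleigh_minimum:
  fixes S :: "real ^ 'm ^ 'm"
  assumes sym: "\<And>v w. (S *v v) \<bullet> w = (S *v w) \<bullet> v"
    and n: "(S *v n) \<bullet> n = l * (norm n)\<^sup>2"
    and min: "\<And>x. l * (norm x)\<^sup>2 \<le> (S *v x) \<bullet> x"
  shows "S *v n = l *\<^sub>R n"
proof -
  define w where "w = S *v n - l *\<^sub>R n"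
  define q where "q = (S *v w) \<bullet> w - l * (w \<bullet> w)"
  have *: "0 \<le> 2 * s * (w \<bullet> w) + s\<^sup>2 * q" for s
  proof -
    have "0 \<le> (S *v (n + s *\<^sub>R w)) \<bullet> (n + s *\<^sub>R w) - l * ((n + s *\<^sub>R w) \<bullet> (n + s *\<^sub>R w))"
      using min[of "n + s *\<^sub>R w"] by (simp add: power2_norm_eq_inner)
    also have "\<dots> = ((S *v n) \<bullet> n - l * (n \<bullet> n)) + 2 * s * ((S *v n) \<bullet> w - l * (n \<bullet> w)) + s\<^sup>2 * q"
      by (simp add: q_def matrix_vector_right_distrib matrix_vector_mult_scaleR
          inner_add_left inner_add_right sym[of w n] inner_commute[of w n] power2_eq_square algebra_simps)
    also have "(S *v n) \<bullet> w - l * (n \<bullet> w) = w \<bullet> w" by (simp add: w_def inner_diff_left)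
    finally show ?thesis using n by (simp add: power2_norm_eq_inner)
  qed
  have "w \<bullet> w = 0"
  proof (rule ccontr)
    assume "w \<bullet> w \<noteq> 0"
    then have pos: "w \<bullet> w > 0" by simp
    define s where "s = - (w \<bullet> w) / (\<bar>q\<bar> + 1)"
    have s: "s < 0" using pos by (simp add: s_def divide_neg_pos)
    have "s * \<bar>q\<bar> \<ge> - (w \<bullet> w)"
      using pos by (simp add: s_def field_simps)
    then have "- (s * q) \<le> w \<bullet> w" using s by (cases "q \<ge> 0") (auto simp: abs_if mult_neg_neg mult_nonneg_nonpos less_imp_le intro: order_trans[of _ 0])
    then have "2 * (w \<bullet> w) + s * q > 0" using pos by linarith
    then have "s * (2 * (w \<bullet> w) + s * q) < 0" using s by (rule mult_neg_pos[rotated])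
    then show False using *[of s] by (simp add: power2_eq_square algebra_simps)
  qed
  then show ?thesis by (simp add: w_def)
qed

lemma min_eigenvalue_symmetric:
  fixes S :: "real ^ 'm ^ 'm"
  assumes sym: "\<And>v w. (S *v v) \<bullet> w = (S *v w) \<bullet> v"
  shows "is_eigenvalue S (min_eigenvalue S)" "\<And>c. is_eigenvalue S c \<Longrightarrow> min_eigenvalue S \<le> c"
    and "\<And>x. min_eigenvalue S * (norm x)\<^sup>2 \<le> (S *v x) \<bullet> x"
proof -
  have cS: "continuous_on A (\<lambda>x. (S *v x) \<bullet> x)" for A
    by (intro continuous_intros linear_continuous_on_compose[OF continuous_on_id]) simp
  have "axis undefined 1 \<in> sphere (0::real^'m) 1" by simp
  then obtain n where n: "norm n = 1" "\<And>x. norm x = 1 \<Longrightarrow> (S *v n) \<bullet> n \<le> (S *v x) \<bullet> x"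
    using continuous_attains_inf[OF compact_sphere _ cS, of "0::real^'m" 1] by fastforce
  define l where "l = (S *v n) \<bullet> n"
  have min: "l * (norm x)\<^sup>2 \<le> (S *v x) \<bullet> x" for x
  proof (cases "x = 0")
    case False
    define y where "y = (1 / norm x) *\<^sub>R x"
    have "norm y = 1" "x = norm x *\<^sub>R y" using False by (auto simp: y_def)
    have "(S *v x) \<bullet> x = (norm x)\<^sup>2 * ((S *v y) \<bullet> y)"
      by (subst (1 2) \<open>x = norm x *\<^sub>R y\<close>) (simp add: matrix_vector_mult_scaleR power2_eq_square)
    then show ?thesis using n(2)[OF \<open>norm y = 1\<close>] by (simp add: l_def mult.commute mult_right_mono)
  qed simp
  have "S *v n = l *\<^sub>R n"
    by (rule eigenvector_of_rayleigh_minimum[OF sym _ min]) (use n in \<open>simp add: l_def\<close>)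
  then have ev: "is_eigenvalue S l" using n unfolding is_eigenvalue_def by (intro exI[of _ n]) auto
  have le: "l \<le> c" if ev_c: "is_eigenvalue S c" for c
  proof -
    obtain v where v: "v \<noteq> 0" "S *v v = c *\<^sub>R v" using ev_c unfolding is_eigenvalue_def by blast
    then have "l * (norm v)\<^sup>2 \<le> c * (norm v)\<^sup>2" using min[of v] by (simp add: power2_norm_eq_inner)
    then show ?thesis using v by simp
  qed
  have l: "min_eigenvalue S = l" unfolding min_eigenvalue_def by (rule Least_equality[where P = "is_eigenvalue S", OF ev le])
  show "is_eigenvalue S (min_eigenvalue S)" "\<And>c. is_eigenvalue S c \<Longrightarrow> min_eigenvalue S \<le> c"
    "\<And>x. min_eigenvalue S * (norm x)\<^sup>2 \<le> (S *v x) \<bullet> x" using ev le min l by auto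
qed

lemma max_eigenvalue_eq_uminus_min:
  fixes S :: "real ^ 'm ^ 'm"
  assumes sym: "\<And>v w. (S *v v) \<bullet> w = (S *v w) \<bullet> v"
  shows "max_eigenvalue S = - min_eigenvalue (- S)"
proof -
  have ev: "is_eigenvalue (- S) c \<longleftrightarrow> is_eigenvalue S (- c)" for c
    unfolding is_eigenvalue_def uminus_matrix_vector_mult by (auto simp: minus_equation_iff[of "S *v _"])
  have sym': "((- S) *v v) \<bullet> w = ((- S) *v w) \<bullet> v" for v w
    using sym[of v w] by (simp add: uminus_matrix_vector_mult)
  note m = min_eigenvalue_symmetric[OF sym']
  show ?thesis
    unfolding max_eigenvalue_def
  proof (rule Greatest_equality)
    show "is_eigenvalue S (- min_eigenvalue (- S))" using m(1) ev by blast
    show "c \<le> - min_eigenvalue (- S)" if "is_eigenvalue S c" for c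
      using m(2)[of "- c"] ev[of "- c"] that by simp
  qed
qed

lemma min_eigenvalue_zero: "min_eigenvalue (0 :: real ^ 'm ^ 'm) = 0"
proof -
  have "is_eigenvalue (0 :: real ^ 'm ^ 'm) (min_eigenvalue (0 :: real ^ 'm ^ 'm))" by (rule min_eigenvalue_symmetric(1)) simp
  then show ?thesis unfolding is_eigenvalue_def by (auto simp: eq_commute[of 0])
qed

text \<open>
  The cases of finite and infinite \<open>p\<close> share the form
  \<open>a \<Delta>\<^sub>\<infinity> + b \<Delta> = c (\<partial>\<^sub>t - X \<bullet> \<nabla>\<^sub>Y)\<close>, with \<open>(a, b, c) = (p - 2, 1, m + p)\<close> and \<open>(1, 0, 1)\<close>. The sign conditions
  express ellipticity: \<open>a + b\<close> is the coefficient in the gradient direction and \<open>b\<close> the one in the orthogonal directions.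
  For finite \<open>p\<close> the former is \<open>p - 1\<close>, and this is where \<open>1 < p\<close> enters.
\<close>
lemma operator_weights:
  fixes p :: ereal
  assumes "1 < p"
  obtains a b c :: real where "c > 0" "b \<ge> 0" "a + b \<ge> 0"
    "alpha CARD('m::finite) p = a / c" "beta CARD('m) p / (real CARD('m) + 2) = b / c"
    "alpha CARD('m) p + beta CARD('m) p = 1"
    "\<And>(\<phi> :: 'm pt \<Rightarrow> real) z. supersolution_ineq p \<phi> z \<longleftrightarrow>
       (if grad_X \<phi> z \<noteq> 0 then a * inf_laplace_X \<phi> z + b * laplace_X \<phi> z \<le> c * transport \<phi> z
        else min_eigenvalue (a *\<^sub>R hess_X \<phi> z) + b * laplace_X \<phi> z \<le> c * transport \<phi> z)"
    "\<And>(\<phi> :: 'm pt \<Rightarrow> real) z. subsolution_ineq p \<phi> z \<longleftrightarrow>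
       (if grad_X \<phi> z \<noteq> 0 then c * transport \<phi> z \<le> a * inf_laplace_X \<phi> z + b * laplace_X \<phi> z
        else c * transport \<phi> z \<le> max_eigenvalue (a *\<^sub>R hess_X \<phi> z) + b * laplace_X \<phi> z)"
proof (cases "p = \<infinity>")
  case True
  show ?thesis
    by (rule that[of 1 0 1]) (auto simp: True alpha_def beta_def supersolution_ineq_def subsolution_ineq_def)
next
  case False
  define q where "q = real_of_ereal p"
  have q: "q > 1" using assms False by (cases p) (auto simp: q_def)
  define m where "m = real CARD('m)"
  have m: "m > 0" by (simp add: m_def)
  have ab: "alpha CARD('m) p = (q - 2) / (m + q)" "beta CARD('m) p = (m + 2) / (m + q)"
    using False by (simp_all add: alpha_def beta_def q_def m_def)
  show ?thesis
  proof (rule that[of "m + q" 1 "q - 2"])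
    show "alpha CARD('m) p + beta CARD('m) p = 1"
      unfolding ab add_divide_distrib[symmetric] using m q by simp
    show "beta CARD('m) p / (real CARD('m) + 2) = 1 / (m + q)"
      unfolding ab m_def[symmetric] using m q by simp
  qed (use False m q in \<open>auto simp: ab supersolution_ineq_def subsolution_ineq_def Let_def q_def[symmetric] m_def[symmetric]\<close>)
qed

section \<open>Test functions with vanishing gradient\<close>

text \<open>
  Doubling of variables with a quartic penalty: as \<open>j\<close> grows, the minimum points of \<open>f z h + j |h|\<^sup>4\<close>
  converge to \<open>(x, 0)\<close>, since \<open>x\<close> is the strict minimum point of \<open>f\<close> on the slice \<open>h = 0\<close>. For \<open>|h| \<ge> \<sigma>\<close> the penalty
  exceeds the lower bound \<open>- M\<close> of \<open>f\<close>; for \<open>|h| < \<sigma>\<close> and \<open>z\<close> away from \<open>x\<close>, uniform continuity keeps \<open>f\<close> positive.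
\<close>
lemma penalised_minimum:
  fixes f :: "'a::euclidean_space \<Rightarrow> 'b::euclidean_space \<Rightarrow> real"
  assumes cont: "continuous_on (cball x r \<times> cball 0 r) (\<lambda>(z, h). f z h)" and r: "r > 0"
    and zero: "f x 0 = 0" and pos: "\<And>z. z \<in> cball x r \<Longrightarrow> z \<noteq> x \<Longrightarrow> f z 0 > 0" and \<rho>: "\<rho> > 0"
  obtains j z0 h0 where "j > 0" "z0 \<in> cball x r" "h0 \<in> cball 0 r" "dist x z0 < \<rho>" "norm h0 < \<rho>"
    "\<And>z h. z \<in> cball x r \<Longrightarrow> h \<in> cball 0 r \<Longrightarrow> f z0 h0 + j * norm h0 ^ 4 \<le> f z h + j * norm h ^ 4"
proof -
  let ?K = "cball x r \<times> cball (0::'b) r"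
  have K: "compact ?K" by (intro compact_Times compact_cball)
  have xK: "(x, 0) \<in> ?K" using r by simp
  obtain M where M: "M \<ge> 0" "\<And>z h. (z, h) \<in> ?K \<Longrightarrow> - M \<le> f z h"
  proof -
    obtain w where "w \<in> ?K" "\<forall>y\<in>?K. (\<lambda>(z, h). f z h) w \<le> (\<lambda>(z, h). f z h) y"
      using continuous_attains_inf[OF K _ cont] xK by blast
    then show ?thesis by (intro that[of "\<bar>(\<lambda>(z, h). f z h) w\<bar>"]) force+
  qed
  obtain \<delta> where \<delta>: "\<delta> > 0" "\<And>z. z \<in> cball x r \<Longrightarrow> \<rho> \<le> dist x z \<Longrightarrow> \<delta> \<le> f z 0"
  proof (cases "cball x r - ball x \<rho> = {}")
    case True
    then show ?thesis by (intro that[of 1]) auto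
  next
    case False
    have "continuous_on (cball x r - ball x \<rho>) (\<lambda>z. (\<lambda>(z, h). f z h) (z, 0))"
      by (rule continuous_on_compose2[OF cont]) (use r in \<open>auto intro!: continuous_intros\<close>)
    then obtain w where "w \<in> cball x r - ball x \<rho>" "\<forall>y\<in>cball x r - ball x \<rho>. f w 0 \<le> f y 0"
      using continuous_attains_inf[OF compact_diff[OF compact_cball open_ball] False] by fastforce
    moreover from this have "w \<noteq> x" using \<rho> by auto
    ultimately show ?thesis using pos[of w] by (intro that[of "f w 0"]) auto
  qed
  obtain \<sigma>' where \<sigma>': "\<sigma>' > 0" "\<And>y y'. y \<in> ?K \<Longrightarrow> y' \<in> ?K \<Longrightarrow> dist y' y < \<sigma>' \<Longrightarrow> dist ((\<lambda>(z, h). f z h) y') ((\<lambda>(z, h). f z h) y) < \<delta>"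
    using compact_uniformly_continuous[OF cont K, unfolded uniformly_continuous_on_def, rule_format, OF \<delta>(1)] by auto
  define \<sigma> where "\<sigma> = min \<sigma>' \<rho>"
  have \<sigma>: "\<sigma> > 0" "\<sigma> \<le> \<rho>" "\<sigma> \<le> \<sigma>'" using \<sigma>' \<rho> by (auto simp: \<sigma>_def)
  define j where "j = (M + 1) / \<sigma> ^ 4"
  have j: "j > 0" using M \<sigma> by (simp add: j_def)
  have away: "f z h + j * norm h ^ 4 > 0" if "z \<in> cball x r" "h \<in> cball 0 r" "\<rho> \<le> dist x z \<or> \<rho> \<le> norm h" for z h
  proof (cases "\<sigma> \<le> norm h")
    case True
    have "M + 1 = j * \<sigma> ^ 4" using \<sigma> by (simp add: j_def)
    also have "\<dots> \<le> j * norm h ^ 4" using True \<sigma> j by (intro mult_left_mono power_mono) auto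
    finally show ?thesis using M(2)[of z h] that by simp
  next
    case False
    then have "\<rho> \<le> dist x z" using that \<sigma> by auto
    moreover have "dist (f z h) (f z 0) < \<delta>"
      using \<sigma>'(2)[of "(z, 0)" "(z, h)"] that False \<sigma> r by (simp add: dist_prod_def)
    ultimately have "f z h > 0" using \<delta>(2)[of z] that by (simp add: dist_real_def)
    then show ?thesis using j by (simp add: add_pos_nonneg)
  qed
  have "continuous_on ?K (\<lambda>y. (\<lambda>(z, h). f z h) y + j * norm (snd y) ^ 4)"
    by (intro continuous_intros cont)
  then obtain w where w: "w \<in> ?K" "\<forall>y\<in>?K. (\<lambda>(z, h). f z h) w + j * norm (snd w) ^ 4 \<le> (\<lambda>(z, h). f z h) y + j * norm (snd y) ^ 4"
    using continuous_attains_inf[OF K, of "\<lambda>y. (\<lambda>(z, h). f z h) y + j * norm (snd y) ^ 4"] xK by blast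
  obtain z0 h0 where w0: "w = (z0, h0)" by (cases w)
  have in0: "z0 \<in> cball x r" "h0 \<in> cball 0 r" using w(1) w0 by auto
  have "f z0 h0 + j * norm h0 ^ 4 \<le> 0" using w(2)[rule_format, OF xK] w0 zero by simp
  then have "dist x z0 < \<rho> \<and> norm h0 < \<rho>" using away[OF in0] by force
  moreover have "f z0 h0 + j * norm h0 ^ 4 \<le> f z h + j * norm h ^ 4" if "z \<in> cball x r" "h \<in> cball 0 r" for z h
    using w(2)[rule_format, of "(z, h)"] that w0 by simp
  ultimately show ?thesis using that[OF j in0] by blast
qed

lemma C2_on_inner_affine:
  fixes L M :: "'a::real_normed_vector \<Rightarrow> 'b::euclidean_space"
  assumes "bounded_linear L" "bounded_linear M"
  shows "C2_on D (\<lambda>x. (L x - p) \<bullet> (M x - q))"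
proof -
  have *: "C2_on D (\<lambda>x. (N x - c) \<bullet> b)" if "bounded_linear N" for N :: "'a \<Rightarrow> 'b" and c b
    unfolding inner_diff_left
    by (rule C2_on_diff[OF C2_on_bounded_linear[OF bounded_linear_compose[OF bounded_linear_inner_left that]] C2_on_const])
  show ?thesis by (rule C2_on_inner; rule *; rule assms)
qed

text \<open>
  A function \<open>\<psi>\<close> touching \<open>u\<close> only locally is turned into a test function on all of \<open>D\<close> with nearly the same
  Taylor expansion. The given global minorant \<open>\<phi>\<close> serves away from \<open>z0\<close>: the convex combination
  \<open>(1 - \<kappa>) \<phi> + \<kappa> \<psi>\<close> stays below \<open>u\<close>, and subtracting \<open>|z - z0|\<^sup>4\<close> makes the contact strict. The cut-off
  \<open>\<kappa> = (1 - |z - z0|\<^sup>4/r\<^sup>4)\<^sub>+\<^sup>3\<close> is not constant near \<open>z0\<close>, but \<open>1 - \<kappa> = O(|z - z0|\<^sup>4)\<close> suffices.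
\<close>
lemma global_test_function:
  fixes \<phi> \<psi> u :: "'a::euclidean_space \<Rightarrow> real"
  assumes \<phi>: "C2_on D \<phi>" "\<And>z. z \<in> D \<Longrightarrow> \<phi> z \<le> u z" and \<psi>: "C2_on D \<psi>" "\<And>z. z \<in> ball z0 r \<Longrightarrow> \<psi> z \<le> u z"
    and z0: "\<psi> z0 = u z0" and D: "ball z0 r \<subseteq> D" "r > 0"
  obtains \<Phi> C \<delta> where "C2_on D \<Phi>" "touches_below D \<Phi> u z0" "C \<ge> 0" "\<delta> > 0"
    "\<And>v. norm v < \<delta> \<Longrightarrow> \<bar>\<Phi> (z0 + v) - \<psi> (z0 + v)\<bar> \<le> C * norm v ^ 4"
proof -
  define N where "N z = ((z - z0) \<bullet> (z - z0)) * ((z - z0) \<bullet> (z - z0))" for z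
  have N: "N z = norm (z - z0) ^ 4" for z
    by (simp add: N_def power2_norm_eq_inner[symmetric] power_add[symmetric])
  have C2N: "C2_on D N"
    unfolding N_def[abs_def] by (intro C2_on_mult C2_on_inner_affine bounded_linear_ident)
  define \<kappa> where "\<kappa> z = (max 0 (1 - 1 / r ^ 4 * N z)) ^ 3" for z
  have C2\<kappa>: "C2_on D \<kappa>"
    unfolding \<kappa>_def[abs_def] by (intro C2_on_cutoff C2_on_diff C2_on_const C2_on_cmult C2N)
  have \<kappa>01: "0 \<le> \<kappa> z" "\<kappa> z \<le> 1" for z
    by (auto simp: \<kappa>_def N D intro!: power_le_one)
  have \<kappa>0: "\<kappa> z = 0" if "z \<notin> ball z0 r" for z
  proof -
    have "r ^ 4 \<le> N z" using that D unfolding N by (intro power_mono) (auto simp: dist_norm norm_minus_commute)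
    then show ?thesis using D by (simp add: \<kappa>_def field_simps)
  qed
  have \<kappa>1: "1 - \<kappa> z \<le> 3 / r ^ 4 * N z" for z
  proof -
    define s where "s = 1 / r ^ 4 * N z"
    have "s \<ge> 0" using D by (simp add: s_def N)
    have "1 - (max 0 (1 - s)) ^ 3 \<le> 3 * s"
    proof (cases "s \<le> 1")
      case True
      then show ?thesis using Bernoulli_inequality[of "- s" 3] by (simp add: max_def)
    qed simp
    then show ?thesis by (simp add: \<kappa>_def s_def)
  qed
  define \<Phi> where "\<Phi> z = \<phi> z + \<kappa> z * (\<psi> z - \<phi> z) - N z" for z
  have C2\<Phi>: "C2_on D \<Phi>"
    unfolding \<Phi>_def[abs_def] by (intro C2_on_diff C2_on_add C2_on_mult \<phi> \<psi> C2\<kappa> C2N)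
  have z0D: "z0 \<in> D" using D by auto
  have N0: "N z0 = 0" by (simp add: N)
  have "\<kappa> z0 = 1" by (simp add: \<kappa>_def N0)
  then have \<Phi>0: "\<Phi> z0 = u z0" by (simp add: \<Phi>_def N0 z0)
  have below: "\<Phi> z < u z" if "z \<in> D" "z \<noteq> z0" for z
  proof -
    have "\<phi> z + \<kappa> z * (\<psi> z - \<phi> z) \<le> u z"
    proof (cases "z \<in> ball z0 r")
      case True
      have "\<phi> z + \<kappa> z * (\<psi> z - \<phi> z) = (1 - \<kappa> z) * \<phi> z + \<kappa> z * \<psi> z" by (simp add: algebra_simps)
      also have "\<dots> \<le> (1 - \<kappa> z) * u z + \<kappa> z * u z"
        using \<kappa>01[of z] \<phi>(2)[OF that(1)] \<psi>(2)[OF True] by (intro add_mono mult_left_mono) auto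
      also have "\<dots> = u z" by (simp add: algebra_simps)
      finally show ?thesis .
    qed (use \<kappa>0 \<phi> that in auto)
    moreover have "N z > 0" using that by (simp add: N)
    ultimately show ?thesis by (simp add: \<Phi>_def)
  qed
  have tb: "touches_below D \<Phi> u z0" unfolding touches_below_def using z0D \<Phi>0 below by auto
  have "continuous (at z0) (\<lambda>z. \<psi> z - \<phi> z)"
  proof -
    have "continuous (at z0) f" if "C2_on D f" for f :: "'a \<Rightarrow> real"
      using that z0D unfolding C2_on_def by (blast dest: has_derivative_continuous)
    then show ?thesis using \<phi> \<psi> by (intro continuous_intros) auto
  qed
  then obtain \<delta> where \<delta>: "\<delta> > 0" "\<And>z. dist z z0 < \<delta> \<Longrightarrow> dist (\<psi> z - \<phi> z) (\<psi> z0 - \<phi> z0) < 1"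
    unfolding continuous_at_eps_delta by (metis zero_less_one dist_norm)
  define c where "c = \<bar>\<psi> z0 - \<phi> z0\<bar> + 1"
  show ?thesis
  proof (rule that[OF C2\<Phi> tb _ \<delta>(1)])
    show "0 \<le> 3 / r ^ 4 * c + 1" using D by (simp add: c_def)
    fix v :: 'a assume v: "norm v < \<delta>"
    let ?z = "z0 + v"
    have d: "\<bar>\<psi> ?z - \<phi> ?z\<bar> \<le> c" using \<delta>(2)[of ?z] v by (simp add: dist_norm c_def)
    have "\<Phi> ?z - \<psi> ?z = - ((1 - \<kappa> ?z) * (\<psi> ?z - \<phi> ?z)) - N ?z" by (simp add: \<Phi>_def algebra_simps)
    also have "\<bar>\<dots>\<bar> \<le> (1 - \<kappa> ?z) * \<bar>\<psi> ?z - \<phi> ?z\<bar> + N ?z"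
      using abs_triangle_ineq4[of "- ((1 - \<kappa> ?z) * (\<psi> ?z - \<phi> ?z))" "N ?z"] \<kappa>01(2)[of ?z] by (simp add: abs_mult N)
    also have "\<dots> \<le> (3 / r ^ 4 * N ?z) * c + N ?z"
      using \<kappa>1[of ?z] d \<kappa>01[of ?z] D by (intro add_mono mult_mono) (auto simp: N c_def)
    also have "\<dots> = (3 / r ^ 4 * c + 1) * norm v ^ 4" by (simp add: N algebra_simps)
    finally show "\<bar>\<Phi> ?z - \<psi> ?z\<bar> \<le> (3 / r ^ 4 * c + 1) * norm v ^ 4" .
  qed
qed

text \<open>
  Combines the globalization of a local test function with the uniqueness of jets: the differential inequality
  known for global admissible test functions holds for the coefficients of any local one.
\<close>
lemma admissible_inequality_at_contact:
  fixes u \<phi> \<psi> :: "'m::finite pt \<Rightarrow> real" and A :: "real ^ 'm ^ 'm"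
  assumes D: "open D" and \<phi>: "C2_on D \<phi>" "\<And>z. z \<in> D \<Longrightarrow> \<phi> z \<le> u z"
    and \<psi>: "C2_on D \<psi>" "\<And>z. z \<in> ball z0 r \<Longrightarrow> \<psi> z \<le> u z" "\<psi> z0 = u z0"
    and r: "ball z0 r \<subseteq> D" "r > 0"
    and A: "\<And>k k'. (A *v k) \<bullet> k' = (A *v k') \<bullet> k" and Q: "\<And>s w. Q (s *\<^sub>R w) = s\<^sup>2 * Q w"
    and exp: "C' \<ge> 0" "\<And>v. \<bar>\<psi> (z0 + v) - \<psi> z0 - (g \<bullet> fst v + q \<bullet> fst (snd v) + \<tau> * snd (snd v))
          - ((A *v fst v) \<bullet> fst v / 2 + Q (snd v))\<bar> \<le> C' * norm v ^ 4"
    and gA: "g \<noteq> 0 \<or> A = 0"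
    and adm: "\<And>\<Phi>. C2_on D \<Phi> \<Longrightarrow> touches_below D \<Phi> u z0 \<Longrightarrow> admissible_test \<Phi> z0 \<Longrightarrow>
       a * inf_laplace_X \<Phi> z0 + b * laplace_X \<Phi> z0 \<le> c * transport \<Phi> z0"
  shows "a * (((A *v g) \<bullet> g) / (norm g)\<^sup>2) + b * trace A \<le> c * (\<tau> - fst z0 \<bullet> q)"
proof -
  obtain \<Phi> C \<delta> where \<Phi>: "C2_on D \<Phi>" "touches_below D \<Phi> u z0" "C \<ge> 0" "\<delta> > 0"
    "\<And>v. norm v < \<delta> \<Longrightarrow> \<bar>\<Phi> (z0 + v) - \<psi> (z0 + v)\<bar> \<le> C * norm v ^ 4"
    using global_test_function[OF \<phi> \<psi> r] by metis
  have z0: "z0 \<in> D" using r by auto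
  have \<Phi>0: "\<Phi> z0 = \<psi> z0" using \<Phi>(2) \<psi>(3) by (simp add: touches_below_def)
  have "\<exists>\<delta>>0. \<forall>v. norm v < \<delta> \<longrightarrow>
       \<bar>\<Phi> (z0 + v) - \<Phi> z0 - (g \<bullet> fst v + q \<bullet> fst (snd v) + \<tau> * snd (snd v))
          - ((A *v fst v) \<bullet> fst v / 2 + Q (snd v))\<bar> \<le> \<eta> * (norm v)\<^sup>2" if \<eta>: "\<eta> > 0" for \<eta>
  proof (intro exI conjI allI impI)
    define d where "d = min \<delta> (sqrt (\<eta> / (C + C' + 1)))"
    show "d > 0" using \<eta> \<Phi> exp(1) by (simp add: d_def)
    fix v :: "'m pt" assume v: "norm v < d"
    have "(norm v)\<^sup>2 \<le> (sqrt (\<eta> / (C + C' + 1)))\<^sup>2" using v by (intro power_mono) (auto simp: d_def)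
    also have "\<dots> = \<eta> / (C + C' + 1)" using \<eta> \<Phi>(3) exp(1) by simp
    finally have "(norm v)\<^sup>2 \<le> \<eta> / (C + C' + 1)" .
    then have "(C + C' + 1) * (norm v)\<^sup>2 \<le> \<eta>"
      using \<Phi>(3) exp(1) by (simp add: pos_le_divide_eq mult.commute)
    moreover have "(C + C') * (norm v)\<^sup>2 \<le> (C + C' + 1) * (norm v)\<^sup>2" by (intro mult_right_mono) auto
    ultimately have "(C + C') * (norm v)\<^sup>2 \<le> \<eta>" by linarith
    then have "(C + C') * (norm v)\<^sup>2 * (norm v)\<^sup>2 \<le> \<eta> * (norm v)\<^sup>2" by (rule mult_right_mono) simp
    moreover have "(norm v)\<^sup>2 * (norm v)\<^sup>2 = norm v ^ 4" by (simp flip: power_add)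
    ultimately have "C * norm v ^ 4 + C' * norm v ^ 4 \<le> \<eta> * (norm v)\<^sup>2"
      by (simp add: mult.assoc flip: distrib_right)
    moreover have "\<bar>\<Phi> (z0 + v) - \<psi> (z0 + v)\<bar> \<le> C * norm v ^ 4" using \<Phi>(5) v by (simp add: d_def)
    ultimately show "\<bar>\<Phi> (z0 + v) - \<Phi> z0 - (g \<bullet> fst v + q \<bullet> fst (snd v) + \<tau> * snd (snd v))
          - ((A *v fst v) \<bullet> fst v / 2 + Q (snd v))\<bar> \<le> \<eta> * (norm v)\<^sup>2"
      using exp(2)[of v] unfolding \<Phi>0 by linarith
  qed
  note jet = jet_unique[where \<phi> = \<Phi> and A = A and g = g and b = q and c = \<tau> and Q = Q, OF D z0 \<Phi>(1) A this Q]
  have j: "grad_X \<Phi> z0 = g" "grad_Y \<Phi> z0 = q" "deriv_t \<Phi> z0 = \<tau>" "hess_X \<Phi> z0 = A"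
    by (rule jet; assumption)+
  have "admissible_test \<Phi> z0" using gA by (auto simp: admissible_test_def j)
  from adm[OF \<Phi>(1,2) this] show ?thesis
    by (simp add: inf_laplace_X_def laplace_X_def transport_def j)
qed

text \<open>
  Where \<open>\<nabla>\<^sub>X \<phi> = 0\<close>, the mixed second order terms between \<open>X\<close> and \<open>(Y, t)\<close> can be absorbed by Young's
  inequality, at the price of a small multiple of \<open>|X|\<^sup>2\<close> and a large multiple of \<open>|(Y, t)|\<^sup>2\<close>. The latter does not
  affect the first derivatives in \<open>(Y, t)\<close>, which are the only ones that occur in the equation.
\<close>
lemma separated_quadratic_minorant:
  fixes \<phi> :: "'m::finite pt \<Rightarrow> real"
  assumes D: "open D" "z \<in> D" "C2_on D \<phi>" and g0: "grad_X \<phi> z = 0" and \<eta>: "\<eta> > 0"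
  obtains K r where "r > 0" "cball z r \<subseteq> D"
    "\<And>v. norm v \<le> r \<Longrightarrow> \<phi> z + grad_Y \<phi> z \<bullet> fst (snd v) + deriv_t \<phi> z * snd (snd v)
       + (hess_X \<phi> z *v fst v) \<bullet> fst v / 2 - \<eta> * (norm (fst v))\<^sup>2 - K * (norm (snd v))\<^sup>2 \<le> \<phi> (z + v)"
proof -
  obtain B :: "'m pt \<Rightarrow>\<^sub>L 'm pt \<Rightarrow>\<^sub>L real" where B: "\<And>v w. B v w = B w v"
    "\<And>k k'. B (k, 0, 0) (k', 0, 0) = (hess_X \<phi> z *v k) \<bullet> k'"
    "\<And>\<eta>. \<eta> > 0 \<Longrightarrow> \<exists>\<delta>>0. \<forall>v. norm v < \<delta> \<longrightarrow>
       \<bar>\<phi> (z + v) - \<phi> z - (grad_X \<phi> z \<bullet> fst v + grad_Y \<phi> z \<bullet> fst (snd v) + deriv_t \<phi> z * snd (snd v)) - B v v / 2\<bar>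
         \<le> \<eta> * (norm v)\<^sup>2"
    using C2_expansion[OF D] by metis
  have \<eta>2: "\<eta> / 2 > 0" using \<eta> by simp
  obtain \<delta> where \<delta>: "\<delta> > 0" "\<And>v. norm v < \<delta> \<Longrightarrow>
       \<bar>\<phi> (z + v) - \<phi> z - (grad_X \<phi> z \<bullet> fst v + grad_Y \<phi> z \<bullet> fst (snd v) + deriv_t \<phi> z * snd (snd v)) - B v v / 2\<bar>
         \<le> \<eta> / 2 * (norm v)\<^sup>2" using B(3)[OF \<eta>2] by blast
  obtain e where e: "e > 0" "ball z e \<subseteq> D" using D(1,2) open_contains_ball by blast
  define N where "N = norm B"
  define K where "K = N\<^sup>2 / (2 * \<eta>) + N / 2 + \<eta> / 2"
  show ?thesis
  proof (rule that[of "min \<delta> e / 2" K])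
    show "min \<delta> e / 2 > 0" using \<delta> e by simp
    show "cball z (min \<delta> e / 2) \<subseteq> D" using e \<delta> by (force simp: subset_iff)
    fix v :: "'m pt" assume "norm v \<le> min \<delta> e / 2"
    then have v: "norm v < \<delta>" using \<delta> e by simp
    define x where "x = norm (fst v)"
    define y where "y = norm (snd v)"
    have nv: "(norm v)\<^sup>2 = x\<^sup>2 + y\<^sup>2" by (simp add: norm_prod_def x_def y_def)
    have veq: "v = (fst v, 0, 0) + (0, snd v)" by (simp add: prod_eq_iff)
    have "B v v = (hess_X \<phi> z *v fst v) \<bullet> fst v + 2 * B (fst v, 0, 0) (0, snd v) + B (0, snd v) (0, snd v)"
      by (subst (1 2) veq) (simp add: blinfun.add_left blinfun.add_right B(2) B(1)[of "(0, snd v)" "(fst v, 0, 0)"] del: add_Pair)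
    moreover have "\<bar>B (fst v, 0, 0) (0, snd v)\<bar> \<le> N * x * y"
      using blinfun_bilinear_bound[of B "(fst v, 0, 0)" "(0, snd v)"] by (simp add: N_def x_def y_def norm_Pair)
    moreover have "\<bar>B (0, snd v) (0, snd v)\<bar> \<le> N * y * y"
      using blinfun_bilinear_bound[of B "(0, snd v)" "(0, snd v)"] by (simp add: N_def y_def norm_Pair)
    moreover have "N * x * y \<le> \<eta> / 2 * x\<^sup>2 + N\<^sup>2 / (2 * \<eta>) * y\<^sup>2"
    proof -
      have "0 \<le> (\<eta> * x - N * y)\<^sup>2 / (2 * \<eta>)" using \<eta> by simp
      also have "\<dots> = \<eta> / 2 * x\<^sup>2 + N\<^sup>2 / (2 * \<eta>) * y\<^sup>2 - N * x * y"
        using \<eta> by (simp add: power2_eq_square field_simps)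
      finally show ?thesis by simp
    qed
    moreover have "K * y\<^sup>2 = N\<^sup>2 / (2 * \<eta>) * y\<^sup>2 + N * y * y / 2 + \<eta> / 2 * y\<^sup>2"
      by (simp add: K_def power2_eq_square algebra_simps)
    moreover have "\<eta> / 2 * (norm v)\<^sup>2 = \<eta> / 2 * x\<^sup>2 + \<eta> / 2 * y\<^sup>2" unfolding nv by (rule distrib_left)
    moreover have "\<eta> * x\<^sup>2 = \<eta> / 2 * x\<^sup>2 + \<eta> / 2 * x\<^sup>2" by simp
    ultimately show "\<phi> z + grad_Y \<phi> z \<bullet> fst (snd v) + deriv_t \<phi> z * snd (snd v)
       + (hess_X \<phi> z *v fst v) \<bullet> fst v / 2 - \<eta> * (norm (fst v))\<^sup>2 - K * (norm (snd v))\<^sup>2 \<le> \<phi> (z + v)"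
      using \<delta>(2)[OF v] unfolding g0 x_def[symmetric] y_def[symmetric] inner_zero_left by linarith
  qed
qed

text \<open>
  Suppose the inequality fails at \<open>zh\<close>, where
  \<open>\<nabla>\<^sub>X \<phi> = 0\<close>. Replace \<open>\<phi>\<close> near \<open>zh\<close> by a separated quadratic minorant \<open>S z 0 = l(Y, t) + (A x) \<bullet> x / 2\<close> with
  \<open>x = X - Xh\<close> and \<open>A = H - 2 \<eta>\<close>, shift its \<open>X\<close> argument by \<open>h\<close>, and minimize \<open>u z - S z h + j |h|\<^sup>4\<close> over \<open>(z, h)\<close>.

  If the minimum has \<open>h0 \<noteq> 0\<close>, optimality in \<open>h\<close> shows that the shifted quadratic, which touches \<open>u\<close> at \<open>z0\<close>, has
  nonzero gradient there. It still has the Hessian \<open>A\<close>, so the inequality at \<open>z0\<close> contradicts the failure at \<open>zh\<close>, since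
  \<open>a (A g) \<bullet> g / |g|\<^sup>2\<close> is bounded below through the smallest eigenvalue of \<open>a H\<close>.

  If \<open>h0 = 0\<close>, optimality in \<open>h\<close> shows \<open>A \<le> 0\<close>. The choice \<open>h = X0 - X\<close> freezes the quadratic part at its value
  for \<open>z0\<close>, so \<open>u\<close> is touched at \<open>z0\<close> by \<open>l(Y, t) - j |X - X0|\<^sup>4\<close> plus a constant, whose \<open>X\<close> gradient and \<open>X\<close> Hessian
  vanish at \<open>z0\<close>. Hence the transport term is nonnegative there, whereas the failure together with \<open>A \<le> 0\<close>, \<open>b \<ge> 0\<close> and
  \<open>a + b \<ge> 0\<close> makes it negative.
\<close>
lemma degenerate_supersolution_inequality:
  fixes u \<phi> :: "'m::finite pt \<Rightarrow> real"
  assumes D: "open D" and u: "continuous_on D u" and abc: "c > 0" "b \<ge> 0" "a + b \<ge> 0"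
    and adm: "\<And>\<Phi> z. C2_on D \<Phi> \<Longrightarrow> touches_below D \<Phi> u z \<Longrightarrow> admissible_test \<Phi> z \<Longrightarrow>
       a * inf_laplace_X \<Phi> z + b * laplace_X \<Phi> z \<le> c * transport \<Phi> z"
    and \<phi>: "C2_on D \<phi>" "touches_below D \<phi> u zh" "grad_X \<phi> zh = 0"
  shows "min_eigenvalue (a *\<^sub>R hess_X \<phi> zh) + b * laplace_X \<phi> zh \<le> c * transport \<phi> zh"
proof (rule ccontr)
  assume fail: "\<not> ?thesis"
  have zh: "zh \<in> D" "u zh = \<phi> zh" "\<And>w. w \<in> D \<Longrightarrow> w \<noteq> zh \<Longrightarrow> \<phi> w < u w"
    using \<phi>(2) by (auto simp: touches_below_def)
  define H where "H = hess_X \<phi> zh"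
  define G where "G = min_eigenvalue (a *\<^sub>R H) + b * trace H - c * transport \<phi> zh"
  have G: "G > 0" using fail by (simp add: G_def H_def laplace_X_def)
  have symH: "(H *v k) \<bullet> k' = (H *v k') \<bullet> k" for k k'
    unfolding H_def by (rule hess_X_symmetric[OF D zh(1) \<phi>(1)])
  have rayleigh: "min_eigenvalue (a *\<^sub>R H) * (norm x)\<^sup>2 \<le> a * ((H *v x) \<bullet> x)" for x
  proof -
    have "((a *\<^sub>R H) *v v) \<bullet> w = ((a *\<^sub>R H) *v w) \<bullet> v" for v w
      using symH[of v w] by (simp add: scaleR_matrix_vector_mult)
    from min_eigenvalue_symmetric(3)[OF this, of x] show ?thesis by (simp add: scaleR_matrix_vector_mult)
  qed
  \<comment> \<open>Passing from \<open>H\<close> to \<open>A = H - 2 \<eta>\<close> costs at most half of the gap \<open>G\<close>.\<close>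
  define \<eta> where "\<eta> = G / (4 * (\<bar>a\<bar> + b * real CARD('m) + 1))"
  have den: "\<bar>a\<bar> + b * real CARD('m) + 1 > 0" using abc by (simp add: add_nonneg_pos)
  have \<eta>: "\<eta> > 0" using G den by (simp add: \<eta>_def)
  have \<eta>G: "2 * \<eta> * (a + b * real CARD('m)) \<le> G / 2"
  proof -
    have "2 * \<eta> * (a + b * real CARD('m)) \<le> 2 * \<eta> * (\<bar>a\<bar> + b * real CARD('m) + 1)"
      using \<eta> by (intro mult_left_mono) auto
    also have "\<dots> = G / 2"
    proof -
      have "2 * (G / (4 * d)) * d = G / 2" if "d > 0" for d using that by simp
      from this[OF den] show ?thesis unfolding \<eta>_def .
    qed
    finally show ?thesis .
  qed
  define A where "A = H - (2 * \<eta>) *\<^sub>R mat 1"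
  have Av: "A *v x = H *v x - (2 * \<eta>) *\<^sub>R x" for x
    by (simp add: A_def matrix_vector_mult_diff_rdistrib scaleR_matrix_vector_mult)
  have symA: "(A *v k) \<bullet> k' = (A *v k') \<bullet> k" for k k'
    using symH[of k k'] by (simp add: Av inner_diff_left inner_commute[of k k'])
  have trA: "trace A = trace H - 2 * \<eta> * real CARD('m)"
    by (simp add: A_def trace_def mat_def sum_subtractf)
  have quadA: "(A *v (x + y)) \<bullet> (x + y) = (A *v x) \<bullet> x + 2 * ((A *v x) \<bullet> y) + (A *v y) \<bullet> y" for x y
    using symA[of x y] by (simp add: matrix_vector_right_distrib inner_add_left inner_add_right)
  have linA: "linear ((*v) A)" by simp
  define gY where "gY = grad_Y \<phi> zh"
  define \<tau> where "\<tau> = deriv_t \<phi> zh"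
  obtain K r where r: "r > 0" "cball zh r \<subseteq> D" and
    minor: "\<And>v. norm v \<le> r \<Longrightarrow> \<phi> zh + gY \<bullet> fst (snd v) + \<tau> * snd (snd v)
       + (H *v fst v) \<bullet> fst v / 2 - \<eta> * (norm (fst v))\<^sup>2 - K * (norm (snd v))\<^sup>2 \<le> \<phi> (zh + v)"
    using separated_quadratic_minorant[OF D zh(1) \<phi>(1,3) \<eta>] unfolding H_def gY_def \<tau>_def by metis
  define l where "l w = \<phi> zh + gY \<bullet> fst w + \<tau> * snd w - K * (w \<bullet> w)" for w
  define S where "S z h = l (snd z - snd zh) + (A *v (fst z - fst zh + h)) \<bullet> (fst z - fst zh + h) / 2" for z h
  have S0: "S z 0 \<le> \<phi> z" if "z \<in> cball zh r" for z
  proof -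
    define v where "v = z - zh"
    have "(A *v fst v) \<bullet> fst v = (H *v fst v) \<bullet> fst v - 2 * (\<eta> * (norm (fst v))\<^sup>2)"
      by (simp add: Av inner_diff_left power2_norm_eq_inner)
    moreover have "S z 0 = \<phi> zh + gY \<bullet> fst (snd v) + \<tau> * snd (snd v) - K * (norm (snd v))\<^sup>2 + (A *v fst v) \<bullet> fst v / 2"
      by (simp add: S_def l_def v_def power2_norm_eq_inner)
    moreover have "norm v \<le> r" "zh + v = z" using that by (simp_all add: v_def dist_norm norm_minus_commute)
    ultimately show ?thesis using minor[of v] by (simp add: diff_divide_distrib)
  qed
  have Szh: "S zh 0 = u zh" using zh(2) by (simp add: S_def l_def)
  \<comment> \<open>The value of the transport operator on \<open>l\<close> at \<open>z\<close>; for \<open>z\<close> close to \<open>zh\<close> it spends the other half of \<open>G\<close>.\<close>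
  define T where "T z = (\<tau> - 2 * K * snd (snd z - snd zh)) - fst z \<bullet> (gY - (2 * K) *\<^sub>R fst (snd z - snd zh))" for z
  have Tzh: "T zh = transport \<phi> zh" by (simp add: T_def transport_def gY_def \<tau>_def)
  have "continuous (at zh) (\<lambda>z. c * T z)" unfolding T_def by (intro continuous_intros)
  then obtain \<rho>1 where \<rho>1: "\<rho>1 > 0" "\<And>z. dist z zh < \<rho>1 \<Longrightarrow> dist (c * T z) (c * T zh) < G / 2"
    unfolding continuous_at_eps_delta using G by (metis dist_norm half_gt_zero)
  define \<rho> where "\<rho> = min \<rho>1 (r / 2)"
  have \<rho>: "\<rho> > 0" using \<rho>1 r by (simp add: \<rho>_def)
  have cA: "continuous_on W (\<lambda>y. A *v (f y))" if "continuous_on W f" for W :: "('m pt \<times> (real^'m)) set" and f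
    by (rule linear_continuous_on_compose[OF that linA])
  have cu: "continuous_on (cball zh r \<times> cball 0 r) (\<lambda>y :: 'm pt \<times> (real^'m). u (fst y))"
    by (rule continuous_on_compose2[OF u]) (use r in \<open>auto intro!: continuous_intros\<close>)
  have cont: "continuous_on (cball zh r \<times> cball 0 r) (\<lambda>(z, h). u z - S z h)"
    unfolding S_def l_def split_beta by (intro continuous_intros cu cA) auto
  have pos: "u z - S z 0 > 0" if "z \<in> cball zh r" "z \<noteq> zh" for z
    using S0[OF that(1)] zh(3)[of z] that r by auto
  have zero: "u zh - S zh 0 = 0" using Szh by simp
  obtain j z0 h0 where j: "j > 0" and in0: "z0 \<in> cball zh r" "h0 \<in> cball 0 r" and near: "dist zh z0 < \<rho>" "norm h0 < \<rho>"
    and min: "\<And>z h. z \<in> cball zh r \<Longrightarrow> h \<in> cball 0 r \<Longrightarrow>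
      u z0 - S z0 h0 + j * norm h0 ^ 4 \<le> u z - S z h + j * norm h ^ 4"
    using penalised_minimum[OF cont r(1) zero pos \<rho>] by metis
  have cT: "c * T z0 < min_eigenvalue (a *\<^sub>R H) + b * trace H - G / 2"
  proof -
    have "\<bar>c * T z0 - c * T zh\<bar> < G / 2"
      using \<rho>1(2)[of z0] near by (simp add: \<rho>_def dist_commute dist_real_def)
    then show ?thesis unfolding Tzh using G_def by linarith
  qed
  have ball: "ball z0 (r / 2) \<subseteq> cball zh r"
  proof
    fix z assume "z \<in> ball z0 (r / 2)"
    then show "z \<in> cball zh r" using near dist_triangle[of zh z z0] by (simp add: \<rho>_def)
  qed
  have ballD: "ball z0 (r / 2) \<subseteq> D" "r / 2 > 0" using ball r by auto
  define q where "q = gY - (2 * K) *\<^sub>R fst (snd z0 - snd zh)"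
  define \<tau>0 where "\<tau>0 = \<tau> - 2 * K * snd (snd z0 - snd zh)"
  have lexp: "l (snd (z0 + v) - snd zh) = l (snd z0 - snd zh) + (q \<bullet> fst (snd v) + \<tau>0 * snd (snd v)) - K * (snd v \<bullet> snd v)" for v
    by (simp add: l_def q_def \<tau>0_def inner_prod_def algebra_simps inner_add_left inner_add_right inner_diff_left inner_diff_right inner_commute)
  define Q where "Q w = - K * (w \<bullet> w)" for w :: "(real^'m) \<times> real"
  have Q: "Q (s *\<^sub>R w) = s\<^sup>2 * Q w" for s w by (simp add: Q_def power2_eq_square)
  have C2l: "C2_on D (\<lambda>z. l (snd z - snd zh))"
  proof -
    have "(\<lambda>z :: 'm pt. l (snd z - snd zh)) = (\<lambda>z. gY \<bullet> fst (snd z) + \<tau> * snd (snd z)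
        + (\<phi> zh - gY \<bullet> fst (snd zh) - \<tau> * snd (snd zh)) - K * ((snd z - snd zh) \<bullet> (snd z - snd zh)))"
      by (auto simp: l_def algebra_simps)
    moreover have "C2_on D (\<lambda>z. gY \<bullet> fst (snd z))"
      by (rule C2_on_bounded_linear[OF bounded_linear_compose[OF bounded_linear_inner_right
            bounded_linear_compose[OF bounded_linear_fst bounded_linear_snd]]])
    moreover have "C2_on D (\<lambda>z. snd (snd z))"
      by (rule C2_on_bounded_linear[OF bounded_linear_compose[OF bounded_linear_snd bounded_linear_snd]])
    ultimately show ?thesis
      by (simp only:) (intro C2_on_diff C2_on_add C2_on_const C2_on_cmult C2_on_inner_affine bounded_linear_snd)
  qed
  have \<phi>u: "\<phi> z \<le> u z" if "z \<in> D" for z using zh(2) zh(3)[OF that] by (cases "z = zh") auto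
  show False
  proof (cases "h0 = 0")
    case False
    define g where "g = A *v (fst z0 - fst zh + h0)"
    \<comment> \<open>Stationarity in \<open>h\<close>, tested along the ray through \<open>h0\<close>.\<close>
    have "g \<bullet> h0 = 4 * j * norm h0 ^ 4"
    proof -
      define P where "P s = j * norm h0 ^ 4 * (1 + s) ^ 4 - s * (g \<bullet> h0) - s\<^sup>2 * ((A *v h0) \<bullet> h0 / 2)" for s
      have P: "P 0 \<le> P s" if s: "\<bar>s\<bar> < 1" for s
      proof -
        have "norm ((1 + s) *\<^sub>R h0) \<le> 2 * norm h0" using s by (simp add: mult_right_mono)
        then have "(1 + s) *\<^sub>R h0 \<in> cball 0 r" using near by (simp add: \<rho>_def)
        from min[OF in0(1) this]
        have "- S z0 h0 + j * norm h0 ^ 4 \<le> - S z0 ((1 + s) *\<^sub>R h0) + j * norm ((1 + s) *\<^sub>R h0) ^ 4" by simp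
        moreover have "norm ((1 + s) *\<^sub>R h0) ^ 4 = (1 + s) ^ 4 * norm h0 ^ 4" using s by (simp add: power_mult_distrib)
        moreover have "S z0 ((1 + s) *\<^sub>R h0) = S z0 h0 + s * (g \<bullet> h0) + s\<^sup>2 * ((A *v h0) \<bullet> h0 / 2)"
        proof -
          have e: "fst z0 - fst zh + (1 + s) *\<^sub>R h0 = (fst z0 - fst zh + h0) + s *\<^sub>R h0" by (simp add: algebra_simps)
          show ?thesis unfolding S_def e quadA g_def
            by (simp add: matrix_vector_mult_scaleR power2_eq_square add_divide_distrib)
        qed
        ultimately show ?thesis by (simp add: P_def mult_ac)
      qed
      have "(P has_real_derivative (4 * j * norm h0 ^ 4 - g \<bullet> h0)) (at 0)"
        unfolding P_def[abs_def] by (auto intro!: derivative_eq_intros)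
      from DERIV_local_min[OF this, of 1] P show ?thesis by simp
    qed
    then have g: "g \<noteq> 0" using j False by auto
    define \<psi> where "\<psi> z = l (snd z - snd zh) + (A *v (fst z - (fst zh - h0))) \<bullet> (fst z - (fst zh - h0)) / 2 + (u z0 - S z0 h0)" for z
    have \<psi>S: "\<psi> z = S z h0 + (u z0 - S z0 h0)" for z by (simp add: \<psi>_def S_def algebra_simps)
    have "C2_on D \<psi>"
    proof -
      have "\<psi> z = l (snd z - snd zh) + 1 / 2 * ((A *v fst z - A *v (fst zh - h0)) \<bullet> (fst z - (fst zh - h0))) + (u z0 - S z0 h0)" for z
        by (simp add: \<psi>_def matrix_vector_mult_diff_distrib)
      then have "\<psi> = (\<lambda>z. l (snd z - snd zh) + 1 / 2 * ((A *v fst z - A *v (fst zh - h0)) \<bullet> (fst z - (fst zh - h0))) + (u z0 - S z0 h0))" by auto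
      moreover have "bounded_linear (\<lambda>z :: 'm pt. A *v fst z)"
        by (rule bounded_linear_compose[OF _ bounded_linear_fst]) (use linA in \<open>simp add: linear_linear\<close>)
      ultimately show ?thesis
        by (simp only:) (intro C2_on_add C2_on_const C2_on_cmult C2l C2_on_inner_affine bounded_linear_fst)
    qed
    moreover have "\<psi> z \<le> u z" if "z \<in> ball z0 (r / 2)" for z
      using min[of z h0] ball that in0 unfolding \<psi>S by auto
    moreover have "\<psi> z0 = u z0" unfolding \<psi>S by simp
    moreover have "\<bar>\<psi> (z0 + v) - \<psi> z0 - (g \<bullet> fst v + q \<bullet> fst (snd v) + \<tau>0 * snd (snd v))
          - ((A *v fst v) \<bullet> fst v / 2 + Q (snd v))\<bar> \<le> 0 * norm v ^ 4" for v
    proof -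
      have e: "fst (z0 + v) - fst zh + h0 = (fst z0 - fst zh + h0) + fst v" by simp
      have "S (z0 + v) h0 = S z0 h0 + (g \<bullet> fst v + q \<bullet> fst (snd v) + \<tau>0 * snd (snd v)) + ((A *v fst v) \<bullet> fst v / 2 + Q (snd v))"
        unfolding S_def e lexp quadA g_def by (simp add: Q_def add_divide_distrib)
      then show ?thesis unfolding \<psi>S by simp
    qed
    ultimately have "a * (((A *v g) \<bullet> g) / (norm g)\<^sup>2) + b * trace A \<le> c * (\<tau>0 - fst z0 \<bullet> q)"
      using g by (intro admissible_inequality_at_contact[where \<psi> = \<psi> and Q = Q and C' = 0, OF D \<phi>(1) \<phi>u _ _ _ ballD symA Q _ _ _ adm]) auto
    also have "\<dots> = c * T z0" by (simp add: T_def \<tau>0_def q_def)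
    finally have ineq: "a * (((A *v g) \<bullet> g) / (norm g)\<^sup>2) + b * trace A \<le> c * T z0" .
    have IA: "((A *v g) \<bullet> g) / (norm g)\<^sup>2 = ((H *v g) \<bullet> g) / (norm g)\<^sup>2 - 2 * \<eta>"
      using g by (simp add: Av inner_diff_left power2_norm_eq_inner diff_divide_distrib)
    have "a * (I - 2 * \<eta>) + b * trace A = a * I + b * trace H - 2 * \<eta> * (a + b * real CARD('m))" for I
      by (simp add: trA algebra_simps)
    from ineq[unfolded IA this]
    have "a * (((H *v g) \<bullet> g) / (norm g)\<^sup>2) + b * trace H - 2 * \<eta> * (a + b * real CARD('m)) \<le> c * T z0" .
    moreover have "min_eigenvalue (a *\<^sub>R H) \<le> a * (((H *v g) \<bullet> g) / (norm g)\<^sup>2)"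
      using rayleigh[of g] g by (simp add: pos_le_divide_eq)
    ultimately have "min_eigenvalue (a *\<^sub>R H) + b * trace H - 2 * \<eta> * (a + b * real CARD('m)) \<le> c * T z0"
      by linarith
    then show False using cT \<eta>G by linarith
  next
    case True
    \<comment> \<open>Adding the minimality for \<open>h = s w\<close> and \<open>h = - s w\<close> removes the linear term and leaves
      \<open>s\<^sup>2 (A w) \<bullet> w \<le> 2 j s\<^sup>4 |w|\<^sup>4\<close>, which fails for small \<open>s\<close> if \<open>(A w) \<bullet> w > 0\<close>.\<close>
    have Aneg: "(A *v w) \<bullet> w \<le> 0" for w
    proof (rule ccontr)
      assume "\<not> (A *v w) \<bullet> w \<le> 0"
      then have w: "(A *v w) \<bullet> w > 0" "w \<noteq> 0" by auto
      define W where "W = (A *v w) \<bullet> w"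
      define s where "s = min (r / norm w) (sqrt (W / (4 * j * norm w ^ 4)))"
      have s: "s > 0" using w r j by (simp add: s_def W_def)
      have in1: "s *\<^sub>R w \<in> cball 0 r" "- s *\<^sub>R w \<in> cball 0 r"
        using s w r by (auto simp: s_def min_def field_simps split: if_splits)
      have nrm: "norm (s *\<^sub>R w) ^ 4 = s ^ 4 * norm w ^ 4" "norm (- s *\<^sub>R w) ^ 4 = s ^ 4 * norm w ^ 4" by (simp_all add: power_mult_distrib)
      have "- S z0 0 \<le> - S z0 (s *\<^sub>R w) + j * (s ^ 4 * norm w ^ 4)" "- S z0 0 \<le> - S z0 (- s *\<^sub>R w) + j * (s ^ 4 * norm w ^ 4)"
        using min[OF in0(1) in1(1)] min[OF in0(1) in1(2)] unfolding nrm True by simp_all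
      moreover have "S z0 (s *\<^sub>R w) + S z0 (- s *\<^sub>R w) = 2 * S z0 0 + s\<^sup>2 * W"
        unfolding S_def quadA
        by (simp add: W_def matrix_vector_mult_scaleR linear_neg[OF linA] power2_eq_square add_divide_distrib diff_divide_distrib)
      ultimately have "s\<^sup>2 * W \<le> 2 * j * (s ^ 4 * norm w ^ 4)" by linarith
      also have "\<dots> = s\<^sup>2 * (2 * j * norm w ^ 4 * s\<^sup>2)" by (simp add: power2_eq_square power4_eq_xxxx)
      finally have "W \<le> 2 * j * norm w ^ 4 * s\<^sup>2" using s by simp
      also have "\<dots> \<le> 2 * j * norm w ^ 4 * (W / (4 * j * norm w ^ 4))"
      proof (rule mult_left_mono)
        have "s\<^sup>2 \<le> (sqrt (W / (4 * j * norm w ^ 4)))\<^sup>2" using s by (intro power_mono) (auto simp: s_def)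
        also have "\<dots> = W / (4 * j * norm w ^ 4)" using w j by (simp add: W_def)
        finally show "s\<^sup>2 \<le> W / (4 * j * norm w ^ 4)" .
      qed (use j in simp)
      also have "\<dots> = W / 2" using j w by simp
      finally show False using w by (simp add: W_def)
    qed
    \<comment> \<open>\<open>\<psi> z\<close> is \<open>S z (X0 - X) - j |X0 - X|\<^sup>4\<close>, normalized to touch \<open>u\<close> at \<open>z0\<close>.\<close>
    define k0 where "k0 = (A *v (fst z0 - fst zh)) \<bullet> (fst z0 - fst zh) / 2 + (u z0 - S z0 0)"
    define \<psi> where "\<psi> z = l (snd z - snd zh) + k0 - j * (((fst z - fst z0) \<bullet> (fst z - fst z0)) * ((fst z - fst z0) \<bullet> (fst z - fst z0)))" for z
    have n4: "(x \<bullet> x) * (x \<bullet> x) = norm x ^ 4" for x :: "real^'m"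
      by (simp add: power2_norm_eq_inner[symmetric] power_add[symmetric])
    have \<psi>S: "\<psi> z = S z (fst z0 - fst z) + (u z0 - S z0 0) - j * norm (fst z0 - fst z) ^ 4" for z
    proof -
      have "fst z - fst zh + (fst z0 - fst z) = fst z0 - fst zh" by simp
      then show ?thesis unfolding \<psi>_def n4 S_def k0_def by (simp add: norm_minus_commute)
    qed
    have "C2_on D \<psi>"
      unfolding \<psi>_def[abs_def]
      by (intro C2_on_diff C2_on_add C2_on_const C2_on_cmult C2_on_mult C2l C2_on_inner_affine bounded_linear_fst)
    moreover have "\<psi> z \<le> u z" if "z \<in> ball z0 (r / 2)" for z
    proof -
      have "dist (fst z0) (fst z) \<le> dist z0 z" by (rule dist_fst_le)
      then have "fst z0 - fst z \<in> cball 0 r" using that r by (simp add: dist_norm norm_minus_commute)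
      from min[OF _ this, of z] show ?thesis using ball that unfolding \<psi>S True by auto
    qed
    moreover have "\<psi> z0 = u z0" unfolding \<psi>S by simp
    moreover have "\<bar>\<psi> (z0 + v) - \<psi> z0 - (0 \<bullet> fst v + q \<bullet> fst (snd v) + \<tau>0 * snd (snd v))
          - ((0 *v fst v) \<bullet> fst v / 2 + Q (snd v))\<bar> \<le> j * norm v ^ 4" for v
    proof -
      have "\<psi> (z0 + v) - \<psi> z0 - (0 \<bullet> fst v + q \<bullet> fst (snd v) + \<tau>0 * snd (snd v)) - ((0 *v fst v) \<bullet> fst v / 2 + Q (snd v))
          = - (j * norm (fst v) ^ 4)"
        unfolding \<psi>_def lexp n4 by (simp add: Q_def)
      moreover have "norm (fst v) ^ 4 \<le> norm v ^ 4" using dist_fst_le[of v 0] by (intro power_mono) auto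
      ultimately show ?thesis using j by simp
    qed
    ultimately have "a * ((((0::real^'m^'m) *v 0) \<bullet> 0) / (norm (0::real^'m))\<^sup>2) + b * trace (0::real^'m^'m) \<le> c * (\<tau>0 - fst z0 \<bullet> q)"
      using j by (intro admissible_inequality_at_contact[where \<psi> = \<psi> and Q = Q and C' = j and A = 0 and g = 0, OF D \<phi>(1) \<phi>u _ _ _ ballD _ Q _ _ _ adm]) auto
    then have ineq: "0 \<le> c * T z0" by (simp add: T_def \<tau>0_def q_def trace_def)
    define i :: 'm where "i = undefined"
    have diag: "A $ k $ k \<le> 0" for k
      using Aneg[of "axis k 1"] by (simp add: inner_axis matrix_vector_mul_component inner_axis)
    have "trace A \<le> A $ i $ i"
    proof -
      have "trace A = A $ i $ i + (\<Sum>k\<in>UNIV - {i}. A $ k $ k)" by (simp add: trace_def sum.remove)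
      moreover have "(\<Sum>k\<in>UNIV - {i}. A $ k $ k) \<le> 0" by (intro sum_nonpos diag)
      ultimately show ?thesis by simp
    qed
    then have "b * trace A \<le> b * A $ i $ i" using abc by (intro mult_left_mono)
    moreover have "(a + b) * A $ i $ i \<le> 0" using abc diag by (intro mult_nonneg_nonpos)
    moreover have "min_eigenvalue (a *\<^sub>R H) \<le> a * (A $ i $ i + 2 * \<eta>)"
    proof -
      have "(H *v axis i 1) \<bullet> axis i 1 = A $ i $ i + 2 * \<eta>"
        by (simp add: A_def inner_axis matrix_vector_mul_component mat_def)
      then show ?thesis using rayleigh[of "axis i 1"] by simp
    qed
    ultimately have "min_eigenvalue (a *\<^sub>R H) + b * trace H \<le> 2 * \<eta> * (a + b * real CARD('m))"
      by (simp add: trA algebra_simps)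
    then show False using cT \<eta>G ineq by linarith
  qed
qed

section \<open>Reflection and the equivalence\<close>

lemma jet_uminus:
  fixes \<phi> :: "'m::finite pt \<Rightarrow> real"
  assumes D: "open D" "z \<in> D" "C2_on D \<phi>"
  shows "grad_X (\<lambda>z. - \<phi> z) z = - grad_X \<phi> z" "hess_X (\<lambda>z. - \<phi> z) z = - hess_X \<phi> z"
    "transport (\<lambda>z. - \<phi> z) z = - transport \<phi> z"
proof -
  from D(3) obtain f' f'' where f: "\<And>x. x \<in> D \<Longrightarrow> (\<phi> has_derivative blinfun_apply (f' x)) (at x)"
    "\<forall>x\<in>D. (f' has_derivative blinfun_apply (f'' x)) (at x)" unfolding C2_on_def by blast
  have g: "((\<lambda>z. - \<phi> z) has_derivative blinfun_apply (- f' x)) (at x)" if "x \<in> D" for x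
    by (rule has_derivative_eq_rhs[OF has_derivative_minus[OF f(1)[OF that]]]) (auto simp: blinfun.minus_left)
  have g': "((\<lambda>x. - f' x) has_derivative blinfun_apply (- f'' z)) (at z)"
    by (rule has_derivative_eq_rhs[OF has_derivative_minus[OF f(2)[rule_format, OF D(2)]]]) (auto simp: blinfun.minus_left)
  note F = jet_of_C2[OF D(1,2) f(1) f(2)[rule_format, OF D(2)]]
  note N = jet_of_C2[where f' = "\<lambda>x. - f' x", OF D(1,2) g g']
  have lin: "grad_X (\<lambda>z. - \<phi> z) z \<bullet> fst v + grad_Y (\<lambda>z. - \<phi> z) z \<bullet> fst (snd v) + deriv_t (\<lambda>z. - \<phi> z) z * snd (snd v)
    = - (grad_X \<phi> z \<bullet> fst v + grad_Y \<phi> z \<bullet> fst (snd v) + deriv_t \<phi> z * snd (snd v))" for v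
    using N(1)[of v] F(1)[of v] by (simp add: blinfun.minus_left)
  have "grad_X (\<lambda>z. - \<phi> z) z \<bullet> k = (- grad_X \<phi> z) \<bullet> k" for k using lin[of "(k, 0, 0)"] by simp
  then show "grad_X (\<lambda>z. - \<phi> z) z = - grad_X \<phi> z" by (metis vector_eq_rdot)
  have "grad_Y (\<lambda>z. - \<phi> z) z \<bullet> k = (- grad_Y \<phi> z) \<bullet> k" for k using lin[of "(0, k, 0)"] by simp
  then have "grad_Y (\<lambda>z. - \<phi> z) z = - grad_Y \<phi> z" by (metis vector_eq_rdot)
  moreover have "deriv_t (\<lambda>z. - \<phi> z) z = - deriv_t \<phi> z" using lin[of "(0, 0, 1)"] by simp
  ultimately show "transport (\<lambda>z. - \<phi> z) z = - transport \<phi> z" by (simp add: transport_def)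
  have "(hess_X (\<lambda>z. - \<phi> z) z *v k) \<bullet> k' = ((- hess_X \<phi> z) *v k) \<bullet> k'" for k k'
    using N(2)[of k k'] F(2)[of k k'] by (simp add: blinfun.minus_left uminus_matrix_vector_mult)
  then have "hess_X (\<lambda>z. - \<phi> z) z *v k = (- hess_X \<phi> z) *v k" for k by (metis vector_eq_rdot)
  then show "hess_X (\<lambda>z. - \<phi> z) z = - hess_X \<phi> z" by (metis matrix_eq)
qed

lemma subsolution_ineq_uminus:
  fixes \<phi> :: "'m::finite pt \<Rightarrow> real"
  assumes D: "open D" "z \<in> D" "C2_on D \<phi>" and p: "1 < p"
  shows "subsolution_ineq p \<phi> z \<longleftrightarrow> supersolution_ineq p (\<lambda>z. - \<phi> z) z"
proof -
  obtain a b c :: real where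
    sup: "\<And>(\<phi> :: 'm pt \<Rightarrow> real) z. supersolution_ineq p \<phi> z \<longleftrightarrow>
       (if grad_X \<phi> z \<noteq> 0 then a * inf_laplace_X \<phi> z + b * laplace_X \<phi> z \<le> c * transport \<phi> z
        else min_eigenvalue (a *\<^sub>R hess_X \<phi> z) + b * laplace_X \<phi> z \<le> c * transport \<phi> z)"
    and sub: "\<And>(\<phi> :: 'm pt \<Rightarrow> real) z. subsolution_ineq p \<phi> z \<longleftrightarrow>
       (if grad_X \<phi> z \<noteq> 0 then c * transport \<phi> z \<le> a * inf_laplace_X \<phi> z + b * laplace_X \<phi> z
        else c * transport \<phi> z \<le> max_eigenvalue (a *\<^sub>R hess_X \<phi> z) + b * laplace_X \<phi> z)"
    by (rule operator_weights[OF p, where 'm = 'm]) blast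
  note J = jet_uminus[OF D]
  have "((a *\<^sub>R hess_X \<phi> z) *v v) \<bullet> w = ((a *\<^sub>R hess_X \<phi> z) *v w) \<bullet> v" for v w
    using hess_X_symmetric[OF D, of v w] by (simp add: scaleR_matrix_vector_mult)
  then have "max_eigenvalue (a *\<^sub>R hess_X \<phi> z) = - min_eigenvalue (a *\<^sub>R hess_X (\<lambda>z. - \<phi> z) z)"
    using max_eigenvalue_eq_uminus_min[of "a *\<^sub>R hess_X \<phi> z"] by (simp add: J)
  moreover have "inf_laplace_X (\<lambda>z. - \<phi> z) z = - inf_laplace_X \<phi> z"
    by (simp add: inf_laplace_X_def J uminus_matrix_vector_mult linear_neg[OF matrix_vector_mul_linear])
  moreover have "laplace_X (\<lambda>z. - \<phi> z) z = - laplace_X \<phi> z"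
    by (simp add: laplace_X_def J trace_def sum_negf)
  ultimately show ?thesis unfolding sub sup J by auto
qed

lemma mean_value_op_uminus: "mean_value_op p \<epsilon> (\<lambda>z. - w z) z = - mean_value_op p \<epsilon> w z"
proof -
  obtain X Y t where z: "z = (X, Y, t)" by (cases z)
  have S: "(SUP x\<in>A. - f x) = - (INF x\<in>A. f x)" "(INF x\<in>A. - f x) = - (SUP x\<in>A. f x)" for A :: "(real^'a) set" and f :: "real^'a \<Rightarrow> real"
    using INF_eq_uminus_SUP[of f A] INF_eq_uminus_SUP[of "\<lambda>x. - f x" A] by simp_all
  show ?thesis
    by (simp add: z S set_lebesgue_integral_def algebra_simps)
qed

text \<open>
  On admissible test functions the mean value inequality and the differential inequality agree by the asymptotic
  expansion. The remaining test functions, with vanishing gradient and nonzero Hessian, are covered by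
  \<open>degenerate_supersolution_inequality\<close>.
\<close>
lemma mean_value_below_iff_supersolution:
  fixes u :: "'m::finite pt \<Rightarrow> real"
  assumes D: "open D" and p: "1 < p" and u: "continuous_on D u"
  shows "(\<forall>z\<in>D. \<forall>\<phi>. C2_on D \<phi> \<longrightarrow> touches_below D \<phi> u z \<longrightarrow> admissible_test \<phi> z \<longrightarrow>
        (\<exists>r. r \<in> o[at_right 0](\<lambda>\<epsilon>::real. \<epsilon>\<^sup>2) \<and> (\<forall>\<^sub>F \<epsilon> in at_right 0. \<phi> z \<ge> mean_value_op p \<epsilon> \<phi> z + r \<epsilon>)))
    \<longleftrightarrow> (\<forall>\<phi> z. C2_on D \<phi> \<longrightarrow> touches_below D \<phi> u z \<longrightarrow> supersolution_ineq p \<phi> z)"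
proof -
  obtain a b c :: real where abc: "c > 0" "b \<ge> 0" "a + b \<ge> 0"
    and ab: "alpha CARD('m) p = a / c" "beta CARD('m) p / (real CARD('m) + 2) = b / c"
      "alpha CARD('m) p + beta CARD('m) p = 1"
    and sup: "\<And>(\<phi> :: 'm pt \<Rightarrow> real) z. supersolution_ineq p \<phi> z \<longleftrightarrow>
       (if grad_X \<phi> z \<noteq> 0 then a * inf_laplace_X \<phi> z + b * laplace_X \<phi> z \<le> c * transport \<phi> z
        else min_eigenvalue (a *\<^sub>R hess_X \<phi> z) + b * laplace_X \<phi> z \<le> c * transport \<phi> z)"
    by (rule operator_weights[OF p, where 'm = 'm]) blast
  have mv: "(\<exists>r. r \<in> o[at_right 0](\<lambda>\<epsilon>::real. \<epsilon>\<^sup>2) \<and> (\<forall>\<^sub>F \<epsilon> in at_right 0. \<phi> z \<ge> mean_value_op p \<epsilon> \<phi> z + r \<epsilon>))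
     \<longleftrightarrow> a * inf_laplace_X \<phi> z + b * laplace_X \<phi> z \<le> c * transport \<phi> z"
    if "z \<in> D" "C2_on D \<phi>" "admissible_test \<phi> z" for \<phi> z
    unfolding mean_value_inequality_iff[OF D that ab(3)] ab(1,2) using abc(1) by (simp add: field_simps)
  have adm: "supersolution_ineq p \<phi> z \<longleftrightarrow> a * inf_laplace_X \<phi> z + b * laplace_X \<phi> z \<le> c * transport \<phi> z"
    if "admissible_test \<phi> z" for \<phi> :: "'m pt \<Rightarrow> real" and z
    using that by (auto simp: sup admissible_test_def inf_laplace_X_def min_eigenvalue_zero)
  show ?thesis
  proof (intro iffI allI impI ballI)
    fix \<phi> z
    assume L: "\<forall>z\<in>D. \<forall>\<phi>. C2_on D \<phi> \<longrightarrow> touches_below D \<phi> u z \<longrightarrow> admissible_test \<phi> z \<longrightarrow>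
        (\<exists>r. r \<in> o[at_right 0](\<lambda>\<epsilon>::real. \<epsilon>\<^sup>2) \<and> (\<forall>\<^sub>F \<epsilon> in at_right 0. \<phi> z \<ge> mean_value_op p \<epsilon> \<phi> z + r \<epsilon>))"
    and \<phi>: "C2_on D \<phi>" "touches_below D \<phi> u z"
    have *: "a * inf_laplace_X \<Phi> w + b * laplace_X \<Phi> w \<le> c * transport \<Phi> w"
      if "C2_on D \<Phi>" "touches_below D \<Phi> u w" "admissible_test \<Phi> w" for \<Phi> w
      using L mv[OF _ that(1,3)] that by (auto simp: touches_below_def)
    show "supersolution_ineq p \<phi> z"
    proof (cases "grad_X \<phi> z = 0")
      case True
      then show ?thesis using degenerate_supersolution_inequality[OF D u abc * \<phi>] by (simp add: sup)
    next
      case False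
      then show ?thesis using *[OF \<phi>] by (simp add: sup admissible_test_def)
    qed
  next
    fix z \<phi>
    assume "\<forall>\<phi> z. C2_on D \<phi> \<longrightarrow> touches_below D \<phi> u z \<longrightarrow> supersolution_ineq p \<phi> z"
      "z \<in> D" "C2_on D \<phi>" "touches_below D \<phi> u z" "admissible_test \<phi> z"
    then show "\<exists>r. r \<in> o[at_right 0](\<lambda>\<epsilon>::real. \<epsilon>\<^sup>2) \<and> (\<forall>\<^sub>F \<epsilon> in at_right 0. \<phi> z \<ge> mean_value_op p \<epsilon> \<phi> z + r \<epsilon>)"
      using mv adm by blast
  qed
qed

theorem theorem3p4:
  fixes D :: "((real ^ 'm::finite) \<times> (real ^ 'm) \<times> real) set"
    and u :: "(real ^ 'm) \<times> (real ^ 'm) \<times> real \<Rightarrow> real"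
    and p :: ereal
  assumes "open D" and "1 < p" and "continuous_on D u"
  shows "(\<forall>z\<in>D. mean_value_viscosity_at p D u z) \<longleftrightarrow> viscosity_solution p D u"
proof -
  let ?below = "\<lambda>\<phi> z. \<exists>r. r \<in> o[at_right 0](\<lambda>\<epsilon>::real. \<epsilon>\<^sup>2) \<and> (\<forall>\<^sub>F \<epsilon> in at_right 0. \<phi> z \<ge> mean_value_op p \<epsilon> \<phi> z + r \<epsilon>)"
  let ?above = "\<lambda>\<phi> z. \<exists>r. r \<in> o[at_right 0](\<lambda>\<epsilon>::real. \<epsilon>\<^sup>2) \<and> (\<forall>\<^sub>F \<epsilon> in at_right 0. \<phi> z \<le> mean_value_op p \<epsilon> \<phi> z + r \<epsilon>)"
  have lsc: "lower_semicontinuous_on D u"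
    unfolding lower_semicontinuous_on_def
    using continuous_openin_preimage_gen[OF assms(3), of "{a<..}" for a] by (auto simp: vimage_def Int_def)
  have usc: "upper_semicontinuous_on D u"
    unfolding upper_semicontinuous_on_def
    using continuous_openin_preimage_gen[OF assms(3), of "{..<a}" for a] by (auto simp: vimage_def Int_def)
  have flip: "?above \<phi> z \<longleftrightarrow> ?below (\<lambda>z. - \<phi> z) z" for \<phi> z
  proof
    assume "?above \<phi> z"
    then obtain r where "r \<in> o[at_right 0](\<lambda>\<epsilon>::real. \<epsilon>\<^sup>2)" "\<forall>\<^sub>F \<epsilon> in at_right 0. \<phi> z \<le> mean_value_op p \<epsilon> \<phi> z + r \<epsilon>" by blast
    then show "?below (\<lambda>z. - \<phi> z) z"
      by (intro exI[of _ "\<lambda>\<epsilon>. - r \<epsilon>"]) (auto simp: mean_value_op_uminus elim!: eventually_mono)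
  next
    assume "?below (\<lambda>z. - \<phi> z) z"
    then obtain r where "r \<in> o[at_right 0](\<lambda>\<epsilon>::real. \<epsilon>\<^sup>2)"
      "\<forall>\<^sub>F \<epsilon> in at_right 0. - \<phi> z \<ge> - mean_value_op p \<epsilon> \<phi> z + r \<epsilon>" by (auto simp: mean_value_op_uminus)
    then show "?above \<phi> z"
      by (intro exI[of _ "\<lambda>\<epsilon>. - r \<epsilon>"]) (auto elim!: eventually_mono)
  qed
  have touch: "touches_above D \<phi> u z \<longleftrightarrow> touches_below D (\<lambda>z. - \<phi> z) (\<lambda>z. - u z) z" for \<phi> z
    by (auto simp: touches_above_def touches_below_def)
  have adm: "admissible_test (\<lambda>z. - \<phi> z) z \<longleftrightarrow> admissible_test \<phi> z" if "z \<in> D" "C2_on D \<phi>" for \<phi> z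
    unfolding admissible_test_def jet_uminus[OF assms(1) that] by simp
  \<comment> \<open>Test functions may be replaced by their negatives, which exchanges contact from above with contact from below.\<close>
  have neg: "(\<forall>\<phi>. C2_on D \<phi> \<longrightarrow> P \<phi>) \<longleftrightarrow> (\<forall>\<phi>. C2_on D \<phi> \<longrightarrow> P (\<lambda>z. - \<phi> z))" for P
  proof (intro iffI allI impI)
    fix \<phi> assume "\<forall>\<phi>. C2_on D \<phi> \<longrightarrow> P (\<lambda>z. - \<phi> z)" "C2_on D \<phi>"
    then have "P (\<lambda>z. - (- \<phi> z))" using C2_on_minus by blast
    then show "P \<phi>" by simp
  qed (use C2_on_minus in blast)
  have "(\<forall>z\<in>D. \<forall>\<phi>. C2_on D \<phi> \<longrightarrow> touches_above D \<phi> u z \<longrightarrow> admissible_test \<phi> z \<longrightarrow> ?above \<phi> z)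
     \<longleftrightarrow> (\<forall>z\<in>D. \<forall>\<phi>. C2_on D \<phi> \<longrightarrow> touches_below D \<phi> (\<lambda>z. - u z) z \<longrightarrow> admissible_test \<phi> z \<longrightarrow> ?below \<phi> z)"
    unfolding flip touch
    by (subst (2) neg) (use adm in blast)
  also have "\<dots> \<longleftrightarrow> (\<forall>\<phi> z. C2_on D \<phi> \<longrightarrow> touches_below D \<phi> (\<lambda>z. - u z) z \<longrightarrow> supersolution_ineq p \<phi> z)"
    by (rule mean_value_below_iff_supersolution[OF assms(1,2)]) (intro continuous_intros assms)
  also have "\<dots> \<longleftrightarrow> (\<forall>z. \<forall>\<phi>. C2_on D \<phi> \<longrightarrow> touches_below D (\<lambda>z. - \<phi> z) (\<lambda>z. - u z) z \<longrightarrow> supersolution_ineq p (\<lambda>z. - \<phi> z) z)"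
    using neg[of "\<lambda>\<phi>. touches_below D \<phi> (\<lambda>z. - u z) z \<longrightarrow> supersolution_ineq p \<phi> z" for z] by blast
  also have "\<dots> \<longleftrightarrow> (\<forall>\<phi> z. C2_on D \<phi> \<longrightarrow> touches_above D \<phi> u z \<longrightarrow> subsolution_ineq p \<phi> z)"
    using subsolution_ineq_uminus[OF assms(1) _ _ assms(2)] unfolding touch by (metis touches_below_def)
  finally have above: "(\<forall>z\<in>D. \<forall>\<phi>. C2_on D \<phi> \<longrightarrow> touches_above D \<phi> u z \<longrightarrow> admissible_test \<phi> z \<longrightarrow> ?above \<phi> z)
     \<longleftrightarrow> (\<forall>\<phi> z. C2_on D \<phi> \<longrightarrow> touches_above D \<phi> u z \<longrightarrow> subsolution_ineq p \<phi> z)" .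
  show ?thesis
    unfolding mean_value_viscosity_at_def viscosity_solution_def viscosity_supersolution_def viscosity_subsolution_def
      ball_conj_distrib above mean_value_below_iff_supersolution[OF assms]
    using lsc usc assms(3) by blast
qed

end
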